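(* Suppose $f:\mathbb{R}^d\to\mathbb{R}$ satisfies Assumptions A (convexity with modulus $\mu\ge0$) and B ($(H_0,H_1)$-smoothness) of the context, $F(x_0)\le\Delta_0$, and the stochastic gradient oracle is conditionally unbiased and satisfies, for some $1<p\le2$ and $\alpha\ge0$, $$\mathbb{E}_t\|g(x,\xi_t)-\nabla f(x)\|^p\le\tau_\alpha^pF(x)^\alpha .$$ Run RCSAG (see the context) with target $\varepsilon\in(0,\Delta_0]$, confidence $\rho\in(0,1)$, phase noise bound $\varsigma_{p,\Delta}^p:=\tau_\alpha^p(4\Delta)^\alpha$, and the following choice of the auxiliary sets $Q_s$: in the convex case, $Q_s=Q$ for all $s$, where $Q$ is a fixed closed convex set containing $x_0$ and $x^\star$ with $D:=\operatorname{diam}(Q)\in(0,\infty)$; in the strongly convex case ($\mu>0$), $Q_s=B(w_s,\sqrt{2\Delta_s/\mu})$. Then, with probability at least $1-\rho$, RCSAG returns $w_S$ satisfying $F(w_S)\le\varepsilon$. Put $q=p/(p-1)$ and $S=\lceil\log_2(\Delta_0/\varepsilon)\rceil$. The number of stochastic-gradient calls consists of the noise-free terms, namely $$\widetilde O_{\rho,p}\Bigl(S+D\bigl(\sqrt{H_0/\varepsilon}+\sqrt{H_1}\,J_H\bigr)\Bigr)\ \text{(convex case)},\qquad \widetilde O_{\rho,p}\Bigl(\bigl(1+\sqrt{H_0/\mu}\bigr)S+\sqrt{H_1\Delta_0/\mu}\Bigr)\ \text{(strongly convex case)},$$ and, in addition to them, the noise contributes $$N^{\rm cvx}_\alpha=\widetilde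 O_{\rho,p}\bigl((\tau_\alpha D)^q\,\mathcal K_p(\alpha)\bigr)\ \text{(convex case)},\qquad N^{\rm sc}_\alpha=\widetilde O_{\rho,p}\Bigl(\Bigl(\frac{\tau_\alpha}{\sqrt\mu}\Bigr)^q\mathcal K_{p/2}(\alpha)\Bigr)\ \text{(strongly convex case)},$$ where, for $\beta>0$, $$\mathcal K_\beta(\alpha):=\begin{cases}\varepsilon^{-(\beta-\alpha)/(p-1)},&\alpha<\beta,\\ \log(\Delta_0/\varepsilon),&\alpha=\beta,\\ \Delta_0^{(\alpha-\beta)/(p-1)},&\alpha>\beta.\end{cases}$$
   Context: Setting. $\|\cdot\|$ is the Euclidean norm on $\mathbb{R}^d$, $B(x,r)$ is the ball of center $x$ and radius $r$, $f^\star=\min f$, the set of minimizers is nonempty, $x^\star$ is a fixed minimizer, and $F(x)=f(x)-f^\star$. Notation. $\widetilde O_{\rho,p}(\cdot)$ suppresses constants depending on $p$ and logarithms in the confidence and the phase indices, but not polynomial dependence on the displayed problem parameters. Assumption A. $f$ is differentiable and, for some $\mu\ge0$, $f(y)\ge f(x)+\langle\nabla f(x),y-x\rangle+\frac{\mu}{2}\|y-x\|^2$ for all $x,y\in\mathbb{R}^d$. Assumption B. There exist $H_0,H_1\ge0$ such that, with $r_H:=((2\sqrt3+\sqrt6)\sqrt{H_1})^{-1}$ if $H_1>0$ and $r_H:=\infty$ if $H_1=0$, for all $x,y$ with $\|y-x\|\le r_H$, $f(y)\le f(x)+\langle\nabla f(x),y-x\rangle+(H_0+H_1F(x))\|y-x\|^2$.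 Oracle. $\mathcal F_t$ is the filtration generated by the samples through iteration $t$, and $\mathbb{E}_t[\cdot]=\mathbb{E}[\cdot\mid\mathcal F_{t-1}]$. Every $\mathcal F_{t-1}$-measurable query $x$ admits a fresh sample $g(x,\xi_t)$ with $\mathbb{E}_t[g(x,\xi_t)]=\nabla f(x)$ (conditional unbiasedness) and the moment bound stated in the claim; for $\alpha=0$ this is a uniform noise bound. One call is one evaluation of $g(x,\xi_t)$ using one fresh sample. Crossover count. $\log_2^+(x)=\max\{0,\log_2x\}$. For $H_0,H_1>0$, $J_H=\min\{S,\lceil\log_2^+(H_1\Delta_0/H_0)\rceil\}$; $J_H=0$ if $H_1=0$; $J_H=S$ if $H_0=0<H_1$. RCSAG. Set $w_0=x_0$ and $S=\lceil\log_2(\Delta_0/\varepsilon)\rceil$. For $s=0,\dots,S-1$: $\Delta_s=2^{-s}\Delta_0$, $\rho_s=6\rho/[\pi^2(s+1)^2]$, choose $Q_s$, set $D_s=\operatorname{diam}(Q_s)$, and let $w_{s+1}$ be the output of RCSAG-Phase$(w_s,\Delta_s,Q_s,D_s,\rho_s)$. Return $w_S$. RCSAG-Phase$(w,\Delta,Q,D,\rho)$. Parameters: $C_\star=19+12\sqrt2$ if $H_1>0$, else $C_\star=2$; $\mathcal H_\Delta=H_0+H_1\Delta$; $G_\Delta=\sqrt{32C_\star\Delta\mathcal H_\Delta}$; $\varsigma_{p,\Delta}$ as in the claim; $\Lambda=\max\{2G_\Delta,(64\varsigma_{p,\Delta}^pD/\Delta)^{1/(p-1)}\}$; $R=D\Lambda/\Delta$;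 $T=\lceil1024(1+R)\log(8/\rho)\rceil$; $a=5D^2/(\Delta T)$; $\operatorname{clip}_\Lambda(v)=v\min\{1,\Lambda/\|v\|\}$. Set $y_0=z_0=w$, $A_0=D^2/\Delta$, $A_t=A_0+ta$. For $t=1,\dots,T$: $u_t=(A_{t-1}y_{t-1}+az_{t-1})/A_t$; $g_t=g(u_t,\xi_t)$ using one fresh sample; $\widehat g_t=\operatorname{clip}_\Lambda(g_t)$; $z_t=\Pi_Q(z_{t-1}-a\widehat g_t)$, where $\Pi_Q$ is Euclidean projection onto $Q$; $y_t=(A_{t-1}y_{t-1}+az_t)/A_t$. Return $y_T$.
   Formalization: In the case α=β, log(Δ0/ε) is replaced by max{1, log(Δ0/ε)}, since the bound fails for ε just below Δ0; and the constant in the noise terms may depend on α as well as p, since a constant uniform in α is impossible (a factor 4^{α/(p-1)} occurs). *)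

theory Defs
  imports "HOL-Probability.Probability"
begin

section \<open>The objective\<close>

definition gap :: "('a \<Rightarrow> real) \<Rightarrow> 'a \<Rightarrow> real" where
  "gap f x = f x - (INF y. f y)"

definition convex_modulus :: "real \<Rightarrow> ('a::euclidean_space \<Rightarrow> real) \<Rightarrow> ('a \<Rightarrow> 'a) \<Rightarrow> bool" where
  "convex_modulus \<mu> f grad \<longleftrightarrow>
     0 \<le> \<mu> \<and> (\<forall>x. GDERIV f x :> grad x) \<and>
     (\<forall>x y. f y \<ge> f x + grad x \<bullet> (y - x) + \<mu> / 2 * (norm (y - x))\<^sup>2)"

definition smooth_radius :: "real \<Rightarrow> ereal" where
  "smooth_radius H1 =
     (if 0 < H1 then ereal (1 / ((2 * sqrt 3 + sqrt 6) * sqrt H1)) else \<infinity>)"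

definition H_smooth :: "real \<Rightarrow> real \<Rightarrow> ('a::euclidean_space \<Rightarrow> real) \<Rightarrow> ('a \<Rightarrow> 'a) \<Rightarrow> bool" where
  "H_smooth H0 H1 f grad \<longleftrightarrow>
     0 \<le> H0 \<and> 0 \<le> H1 \<and>
     (\<forall>x y. ereal (norm (y - x)) \<le> smooth_radius H1 \<longrightarrow>
        f y \<le> f x + grad x \<bullet> (y - x) + (H0 + H1 * gap f x) * (norm (y - x))\<^sup>2)"


section \<open>The stochastic oracle\<close>

text \<open>Library \<open>powr\<close> has \<open>0 powr 0 = 0\<close>; the moment bound needs \<open>0\<^sup>0 = 1\<close>, so that it is a
  uniform bound when the exponent is zero.\<close>

definition rpow :: "real \<Rightarrow> real \<Rightarrow> real" where
  "rpow x a = (if a = 0 then 1 else x powr a)"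

text \<open>Samples are numbered from 1 over the whole run; at time 0 this is the trivial
  \<open>\<sigma>\<close>-algebra.\<close>

definition sample_filtration ::
  "'w measure \<Rightarrow> 'e measure \<Rightarrow> (nat \<Rightarrow> 'w \<Rightarrow> 'e) \<Rightarrow> nat \<Rightarrow> 'w measure" where
  "sample_filtration M E \<xi> t =
     sigma (space M) {\<xi> i -` B \<inter> space M | i B. i \<in> {1..t} \<and> B \<in> sets E}"

definition vec_cond_exp ::
  "'w measure \<Rightarrow> 'w measure \<Rightarrow> ('w \<Rightarrow> 'a::euclidean_space) \<Rightarrow> 'w \<Rightarrow> 'a" where
  "vec_cond_exp M F X \<omega> = (\<Sum>b\<in>Basis. real_cond_exp M F (\<lambda>\<omega>. X \<omega> \<bullet> b) \<omega> *\<^sub>R b)"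

text \<open>A query need not be integrable. Both conditions still make sense, because
  \<open>real_cond_exp\<close> is built from \<open>nn_cond_exp\<close> of the positive and negative parts, and the
  moment condition makes these finite almost surely.\<close>

definition stochastic_oracle ::
  "'w measure \<Rightarrow> 'e measure \<Rightarrow> (nat \<Rightarrow> 'w \<Rightarrow> 'e) \<Rightarrow> ('a::euclidean_space \<Rightarrow> 'e \<Rightarrow> 'a) \<Rightarrow>
   ('a \<Rightarrow> real) \<Rightarrow> ('a \<Rightarrow> 'a) \<Rightarrow> real \<Rightarrow> real \<Rightarrow> real \<Rightarrow> bool" where
  "stochastic_oracle M E \<xi> g f grad p \<alpha> \<tau> \<longleftrightarrow>
     prob_space M \<and> (\<forall>t\<ge>1. \<xi> t \<in> measurable M E) \<and>
     (\<lambda>(x, e). g x e) \<in> borel_measurable (borel \<Otimes>\<^sub>M E) \<and>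
     (\<forall>t\<ge>1. \<forall>x \<in> borel_measurable (sample_filtration M E \<xi> (t - 1)).
        (AE \<omega> in M. vec_cond_exp M (sample_filtration M E \<xi> (t - 1))
                        (\<lambda>\<omega>. g (x \<omega>) (\<xi> t \<omega>)) \<omega> = grad (x \<omega>)) \<and>
        (AE \<omega> in M. nn_cond_exp M (sample_filtration M E \<xi> (t - 1))
                        (\<lambda>\<omega>. ennreal (norm (g (x \<omega>) (\<xi> t \<omega>) - grad (x \<omega>)) powr p)) \<omega>
                     \<le> ennreal (\<tau> powr p * rpow (gap f (x \<omega>)) \<alpha>)))"


section \<open>RCSAG-Phase\<close>

definition C_star :: "real \<Rightarrow> real" where
  "C_star H1 = (if 0 < H1 then 19 + 12 * sqrt 2 else 2)"

definition G_level :: "real \<Rightarrow> real \<Rightarrow> real \<Rightarrow> real" where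
  "G_level H0 H1 \<Delta> = sqrt (32 * C_star H1 * \<Delta> * (H0 + H1 * \<Delta>))"

text \<open>The \<open>p\<close>-th power of the phase noise level; the algorithm only uses this power. Below it is
  passed around as a function \<open>\<nu>\<close> of the phase gap.\<close>

definition noise_pow :: "real \<Rightarrow> real \<Rightarrow> real \<Rightarrow> real \<Rightarrow> real" where
  "noise_pow p \<alpha> \<tau> \<Delta> = \<tau> powr p * (4 * \<Delta>) powr \<alpha>"

definition clip_level :: "real \<Rightarrow> real \<Rightarrow> real \<Rightarrow> (real \<Rightarrow> real) \<Rightarrow> real \<Rightarrow> real \<Rightarrow> real" where
  "clip_level H0 H1 p \<nu> \<Delta> D =
     max (2 * G_level H0 H1 \<Delta>) ((64 * \<nu> \<Delta> * D / \<Delta>) powr (1 / (p - 1)))"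

definition phase_len ::
  "real \<Rightarrow> real \<Rightarrow> real \<Rightarrow> (real \<Rightarrow> real) \<Rightarrow> real \<Rightarrow> real \<Rightarrow> real \<Rightarrow> nat" where
  "phase_len H0 H1 p \<nu> \<Delta> D \<rho> =
     nat \<lceil>1024 * (1 + D * clip_level H0 H1 p \<nu> \<Delta> D / \<Delta>) * ln (8 / \<rho>)\<rceil>"

definition clip :: "real \<Rightarrow> 'a::real_normed_vector \<Rightarrow> 'a" where
  "clip \<Lambda> v = min 1 (\<Lambda> / norm v) *\<^sub>R v"

text \<open>The state \<open>(y, z, k)\<close> carries the number \<open>k\<close> of oracle calls made so far in the whole run.
  The oracle \<open>orc k\<close> evaluates the stochastic gradient with the \<open>k\<close>-th sample, so every call
  uses a sample not used before.\<close>

primrec phase_iter ::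
  "'a::euclidean_space set \<Rightarrow> real \<Rightarrow> real \<Rightarrow> real \<Rightarrow> (nat \<Rightarrow> 'a \<Rightarrow> 'a) \<Rightarrow> 'a \<Rightarrow> nat \<Rightarrow> nat
     \<Rightarrow> 'a \<times> 'a \<times> nat" where
  "phase_iter Q a A0 \<Lambda> orc w k0 0 = (w, w, k0)"
| "phase_iter Q a A0 \<Lambda> orc w k0 (Suc t) =
     (let (y, z, k) = phase_iter Q a A0 \<Lambda> orc w k0 t;
          A = A0 + real t * a;
          A' = A0 + real (Suc t) * a;
          u = (A *\<^sub>R y + a *\<^sub>R z) /\<^sub>R A';
          z' = closest_point Q (z - a *\<^sub>R clip \<Lambda> (orc (Suc k) u));
          y' = (A *\<^sub>R y + a *\<^sub>R z') /\<^sub>R A'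
      in (y', z', Suc k))"

definition rcsag_phase ::
  "real \<Rightarrow> real \<Rightarrow> real \<Rightarrow> (real \<Rightarrow> real) \<Rightarrow> (nat \<Rightarrow> 'a \<Rightarrow> 'a) \<Rightarrow> nat \<Rightarrow>
   'a::euclidean_space \<Rightarrow> real \<Rightarrow> 'a set \<Rightarrow> real \<Rightarrow> real \<Rightarrow> 'a \<times> nat" where
  "rcsag_phase H0 H1 p \<nu> orc k0 w \<Delta> Q D \<rho> =
     (let \<Lambda> = clip_level H0 H1 p \<nu> \<Delta> D;
          T = phase_len H0 H1 p \<nu> \<Delta> D \<rho>;
          a = 5 * D\<^sup>2 / (\<Delta> * real T);
          (y, z, k) = phase_iter Q a (D\<^sup>2 / \<Delta>) \<Lambda> orc w k0 T
      in (y, k))"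


section \<open>RCSAG\<close>

definition num_phases :: "real \<Rightarrow> real \<Rightarrow> nat" where
  "num_phases \<Delta>0 \<epsilon> = nat \<lceil>log 2 (\<Delta>0 / \<epsilon>)\<rceil>"

definition phase_gap :: "real \<Rightarrow> nat \<Rightarrow> real" where
  "phase_gap \<Delta>0 s = \<Delta>0 / 2 ^ s"

definition phase_conf :: "real \<Rightarrow> nat \<Rightarrow> real" where
  "phase_conf \<rho> s = 6 * \<rho> / (pi\<^sup>2 * (real s + 1)\<^sup>2)"

text \<open>\<open>rcsag \<dots> Qsel orc x0 s\<close> is the pair of \<open>w\<^sub>s\<close> and the number of oracle calls made before
  phase \<open>s\<close>. The auxiliary set of phase \<open>s\<close> is \<open>Qsel s w\<^sub>s\<close>.\<close>

primrec rcsag ::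
  "real \<Rightarrow> real \<Rightarrow> real \<Rightarrow> (real \<Rightarrow> real) \<Rightarrow> real \<Rightarrow> real \<Rightarrow>
   (nat \<Rightarrow> 'a \<Rightarrow> 'a::euclidean_space set) \<Rightarrow> (nat \<Rightarrow> 'a \<Rightarrow> 'a) \<Rightarrow> 'a \<Rightarrow> nat \<Rightarrow> 'a \<times> nat" where
  "rcsag H0 H1 p \<nu> \<Delta>0 \<rho> Qsel orc x0 0 = (x0, 0)"
| "rcsag H0 H1 p \<nu> \<Delta>0 \<rho> Qsel orc x0 (Suc s) =
     (let (w, k) = rcsag H0 H1 p \<nu> \<Delta>0 \<rho> Qsel orc x0 s;
          Q = Qsel s w
      in rcsag_phase H0 H1 p \<nu> orc k w (phase_gap \<Delta>0 s) Q (diameter Q) (phase_conf \<rho> s))"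

definition sc_radius :: "real \<Rightarrow> real \<Rightarrow> nat \<Rightarrow> real" where
  "sc_radius \<mu> \<Delta>0 s = sqrt (2 * phase_gap \<Delta>0 s / \<mu>)"


section \<open>Complexity\<close>

text \<open>The number of calls of a run whose \<open>s\<close>-th auxiliary set has diameter \<open>Ds s\<close>. No reference
  to the dimension of the space is left, so that constants in bounds on it cannot depend on the
  dimension.\<close>

definition scheduled_calls ::
  "real \<Rightarrow> real \<Rightarrow> real \<Rightarrow> (real \<Rightarrow> real) \<Rightarrow> real \<Rightarrow> real \<Rightarrow> real \<Rightarrow> (nat \<Rightarrow> real) \<Rightarrow> nat" where
  "scheduled_calls H0 H1 p \<nu> \<Delta>0 \<epsilon> \<rho> Ds =
     (\<Sum>s<num_phases \<Delta>0 \<epsilon>. phase_len H0 H1 p \<nu> (phase_gap \<Delta>0 s) (Ds s) (phase_conf \<rho> s))"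

definition crossover :: "real \<Rightarrow> real \<Rightarrow> real \<Rightarrow> real \<Rightarrow> nat" where
  "crossover H0 H1 \<Delta>0 \<epsilon> =
     (if H1 = 0 then 0
      else if H0 = 0 then num_phases \<Delta>0 \<epsilon>
      else min (num_phases \<Delta>0 \<epsilon>) (nat \<lceil>max 0 (log 2 (H1 * \<Delta>0 / H0))\<rceil>))"

text \<open>In the borderline case the logarithm is read as at least 1, as is usual inside
  \<open>O\<close>-bounds: for \<open>\<epsilon>\<close> just below \<open>\<Delta>0\<close> one full phase is run although \<open>ln (\<Delta>0 / \<epsilon>)\<close> is
  arbitrarily small.\<close>

definition noise_exponent_factor :: "real \<Rightarrow> real \<Rightarrow> real \<Rightarrow> real \<Rightarrow> real \<Rightarrow> real" where
  "noise_exponent_factor p \<beta> \<alpha> \<Delta>0 \<epsilon> =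
     (if \<alpha> < \<beta> then \<epsilon> powr (- (\<beta> - \<alpha>) / (p - 1))
      else if \<alpha> = \<beta> then max 1 (ln (\<Delta>0 / \<epsilon>))
      else \<Delta>0 powr ((\<alpha> - \<beta>) / (p - 1)))"

text \<open>The logarithm in the confidence and the phase indices suppressed by the soft-\<open>O\<close>.\<close>

definition conf_log :: "real \<Rightarrow> nat \<Rightarrow> real" where
  "conf_log \<rho> S = 1 + ln (1 / \<rho>) + ln (1 + real S)"

end

theory Submission
  imports Defs
begin

text \<open>
  Put \<open>F = gap f\<close>. A phase is an accelerated gradient method with clipped stochastic gradients,
  and the claim is that it halves \<open>F\<close> with the desired confidence; the run is a chain of phases,
  and a union bound over \<open>\<Sum>s. phase_conf \<rho> s \<le> \<rho>\<close> (\<open>sum_phase_conf_le\<close>) finishes the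
  probabilistic half.

  The potential of a phase is \<open>A\<^sub>t F(y\<^sub>t) + \<parallel>z\<^sub>t - x\<^sup>*\<parallel>\<^sup>2 / 2\<close>. It starts at no more than \<open>3/2 D\<^sup>2\<close>, and since
  \<open>A\<^sub>T = 6 D\<^sup>2 / \<Delta>\<close>, the phase succeeds if it never exceeds \<open>3 D\<^sup>2\<close>. As long as this barrier is
  respected, \<open>F(y\<^sub>t) \<le> 3 \<Delta>\<close>, and the steps are so short that the query point still has
  \<open>F(u\<^sub>t) \<le> 4 \<Delta>\<close>. This one inequality controls everything that grows with \<open>F\<close>: the
  local smoothness constant, the gradient norm, which is at most \<open>G_level\<close> and hence at most half
  of the clipping level, and the noise moment, which is at most \<open>noise_pow\<close>. A step then raises
  the potential only by a noise term (\<open>accelerated_step\<close>).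

  The noise is heavy-tailed, but clipping makes it bounded, with a small bias and a small second
  moment (\<open>clip_bias_le\<close>, \<open>clip_error_sq_le\<close>). Therefore the exponential of the scaled potential,
  killed at the barrier, is almost a supermartingale (\<open>clipped_step_exp_moment\<close>,
  \<open>weight_supermartingale_step\<close>). With \<open>\<rho>\<close> the confidence of the phase, the scale is
  \<open>ln (8 / \<rho>) / D\<^sup>2\<close>: the expectation grows by a factor of at most \<open>exp (ln (8 / \<rho>) / 4)\<close> over the
  phase, while it starts at no more than \<open>exp (- 3/2 ln (8 / \<rho>))\<close> times the value at the barrier. So
  the barrier is crossed with probability at most \<open>\<rho> / 8\<close> (\<open>phase_failure\<close>). Working with an expectation that carries the indicator of the
  barrier event avoids stopping times.

  The number of calls does not depend on the samples. With \<open>\<Delta>\<^sub>s = \<Delta>0 / 2\<^sup>s\<close>, the length of phase \<open>s\<close>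
  splits into a constant, a smoothness part, and a power of \<open>\<Delta>\<^sub>s\<close> that comes from the noise
  (\<open>phase_len_le\<close>). Sums over the phases are geometric, with three exceptions where the summand is
  constant in \<open>s\<close>: the \<open>H1\<close> part of the convex case before the crossover (afterwards it is dominated by
  the \<open>H0\<close> part), the \<open>H0\<close> part of the strongly convex case, and the noise part if its exponent
  vanishes.
\<close>


section \<open>The objective\<close>

lemma G_level_nonneg: "0 \<le> H0 \<Longrightarrow> 0 \<le> H1 \<Longrightarrow> 0 < \<Delta> \<Longrightarrow> 0 \<le> G_level H0 H1 \<Delta>"
  by (simp add: G_level_def C_star_def)

locale smooth_convex_objective =
  fixes f :: "'a::euclidean_space \<Rightarrow> real" and grad :: "'a \<Rightarrow> 'a" and xstar :: 'a
    and \<mu> H0 H1 :: real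
  assumes convex: "convex_modulus \<mu> f grad"
    and smooth: "H_smooth H0 H1 f grad"
    and minimizer: "is_arg_min f (\<lambda>_. True) xstar"
begin

lemma gap_eq: "gap f x = f x - f xstar"
proof -
  have le: "f xstar \<le> f y" for y
    using minimizer by (auto simp: is_arg_min_def not_less)
  have "(INF y. f y) = f xstar"
    by (rule cInf_eq_minimum) (use le in auto)
  then show ?thesis by (simp add: gap_def)
qed

lemma gap_nonneg: "0 \<le> gap f x"
  using minimizer by (auto simp: gap_eq is_arg_min_def not_less)

lemma gap_minimizer [simp]: "gap f xstar = 0"
  by (simp add: gap_eq)

lemma smoothness_nonneg: "0 \<le> H0" "0 \<le> H1"
  using smooth by (auto simp: H_smooth_def)

lemma strong_first_order:
  "gap f y \<ge> gap f x + grad x \<bullet> (y - x) + \<mu> / 2 * (norm (y - x))\<^sup>2"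
  using convex unfolding convex_modulus_def gap_eq by (metis add_diff_eq diff_add_eq diff_right_mono)

lemma first_order: "gap f y \<ge> gap f x + grad x \<bullet> (y - x)"
proof -
  have "0 \<le> \<mu> / 2 * (norm (y - x))\<^sup>2"
    using convex by (simp add: convex_modulus_def)
  then show ?thesis using strong_first_order[of x y] by linarith
qed

lemma local_upper_bound:
  assumes "ereal (norm (y - x)) \<le> smooth_radius H1"
  shows "gap f y \<le> gap f x + grad x \<bullet> (y - x) + (H0 + H1 * gap f x) * (norm (y - x))\<^sup>2"
  using smooth assms unfolding H_smooth_def gap_eq by fastforce

text \<open>Take a step of length \<open>s\<close> against the gradient; the minimum value bounds the result from below.\<close>

lemma gradient_step_bound:
  assumes "0 \<le> s" and "ereal s \<le> smooth_radius H1"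
  shows "s * norm (grad x) \<le> gap f x + (H0 + H1 * gap f x) * s\<^sup>2"
proof (cases "grad x = 0")
  case True
  have "0 \<le> (H0 + H1 * gap f x) * s\<^sup>2"
    using smoothness_nonneg gap_nonneg by simp
  then show ?thesis using True gap_nonneg[of x] by simp
next
  case False
  define y where "y = x - (s / norm (grad x)) *\<^sub>R grad x"
  have n: "norm (y - x) = s" using False \<open>0 \<le> s\<close> by (simp add: y_def)
  have i: "grad x \<bullet> (y - x) = - s * norm (grad x)"
    using False by (simp add: y_def dot_square_norm power2_eq_square)
  have "0 \<le> gap f y" by (rule gap_nonneg)
  also have "\<dots> \<le> gap f x + grad x \<bullet> (y - x) + (H0 + H1 * gap f x) * (norm (y - x))\<^sup>2"
    using assms n by (intro local_upper_bound) simp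
  finally show ?thesis unfolding n i by simp
qed

text \<open>The bound \<open>gradient_step_bound\<close> is optimal for \<open>s = \<parallel>grad x\<parallel> / (2 h)\<close>, where
  \<open>h = H0 + H1 F(x)\<close>, and then gives \<open>\<parallel>grad x\<parallel>\<^sup>2 \<le> 4 h F(x)\<close>. If this step leaves the ball of
  radius \<open>r\<close> where smoothness holds, a step of length \<open>r\<close> gives \<open>\<parallel>grad x\<parallel> \<le> F(x) / r + h r\<close>, and
  the radius satisfies \<open>1 / r\<^sup>2 = (18 + 12 \<surd>2) H1\<close>, so that \<open>F(x)\<^sup>2 / r\<^sup>2\<close> is a multiple of \<open>F(x) h\<close>.\<close>

lemma gradient_norm_bound:
  "(norm (grad x))\<^sup>2 \<le> 2 * C_star H1 * gap f x * (H0 + H1 * gap f x)"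
proof -
  define G F h where "G = norm (grad x)" and "F = gap f x" and "h = H0 + H1 * gap f x"
  have G: "0 \<le> G" and F: "0 \<le> F" and h: "0 \<le> h"
    using smoothness_nonneg gap_nonneg by (auto simp: G_def F_def h_def)
  have step: "s * G \<le> F + h * s\<^sup>2" if "0 \<le> s" "ereal s \<le> smooth_radius H1" for s
    using gradient_step_bound[OF that] by (simp add: G_def F_def h_def)
  have opt: "G\<^sup>2 \<le> 4 * (F * h)" if "0 < h" "ereal (G / (2 * h)) \<le> smooth_radius H1"
  proof -
    have "G / (2 * h) * G \<le> F + h * (G / (2 * h))\<^sup>2"
      using that G by (intro step) auto
    then show ?thesis using that by (simp add: field_simps power2_eq_square)
  qed
  have "G\<^sup>2 \<le> 2 * C_star H1 * (F * h)"
  proof (cases "H1 = 0")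
    case True
    then have rad: "ereal s \<le> smooth_radius H1" for s by (simp add: smooth_radius_def)
    show ?thesis
    proof (cases "h = 0")
      case h0: True
      have "G = 0"
      proof (rule ccontr)
        assume "G \<noteq> 0"
        then show False
          using step[of "(F + 1) / G"] rad h0 F G by (auto simp: field_simps)
      qed
      then show ?thesis using h0 by simp
    next
      case False
      then show ?thesis using opt[OF _ rad] h True by (simp add: C_star_def)
    qed
  next
    case False
    then have H1: "0 < H1" using smoothness_nonneg by simp
    define c :: real where "c = 18 + 12 * sqrt 2"
    define r where "r = 1 / ((2 * sqrt 3 + sqrt 6) * sqrt H1)"
    have r: "0 < r" using H1 by (simp add: r_def add_pos_pos)
    have rad: "smooth_radius H1 = ereal r" using H1 by (simp add: smooth_radius_def r_def)
    have "sqrt 6 = sqrt 2 * sqrt (3::real)" by (simp flip: real_sqrt_mult)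
    then have sq: "(2 * sqrt 3 + sqrt 6)\<^sup>2 = c"
      by (simp add: c_def power2_eq_square algebra_simps)
    have c: "18 \<le> c" by (simp add: c_def)
    have "0 < 2 * sqrt 3 + sqrt (6::real)" by (simp add: add_pos_pos)
    then have "2 * sqrt 3 + sqrt 6 \<noteq> (0::real)" by linarith
    then have rr: "c * H1 * r\<^sup>2 = 1"
      using H1 unfolding sq[symmetric] r_def
      by (simp add: power_divide power_mult_distrib)
    have Cs: "C_star H1 = c + 1" using H1 by (simp add: C_star_def c_def)
    have Fh: "0 \<le> F * h" using F h by simp
    show ?thesis
    proof (cases "G \<le> 2 * h * r")
      case True
      show ?thesis
      proof (cases "h = 0")
        case True
        then show ?thesis using \<open>G \<le> 2 * h * r\<close> G by simp
      next
        case False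
        then have "G\<^sup>2 \<le> 4 * (F * h)"
          using opt rad True h by (simp add: field_simps)
        also have "\<dots> \<le> 2 * C_star H1 * (F * h)"
          using Cs c Fh by (intro mult_right_mono) auto
        finally show ?thesis .
      qed
    next
      case False
      have st: "r * G \<le> F + h * r\<^sup>2" using step[of r] r rad by simp
      have "2 * h * r * r \<le> G * r" using False r by (intro mult_right_mono) auto
      then have hr: "h * r\<^sup>2 \<le> F" using st by (simp add: power2_eq_square algebra_simps)
      have H1F: "H1 * F \<le> h" using smoothness_nonneg by (simp add: h_def F_def)
      have "(r * G)\<^sup>2 \<le> (F + h * r\<^sup>2)\<^sup>2"
        using st r G by (intro power_mono) auto
      also have "\<dots> = F * F + 2 * (F * (h * r\<^sup>2)) + (h * r\<^sup>2) * (h * r\<^sup>2)"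
        by (simp add: power2_eq_square algebra_simps)
      also have "\<dots> \<le> (c * H1 * r\<^sup>2) * (F * F) + 2 * (F * (h * r\<^sup>2)) + F * (h * r\<^sup>2)"
        unfolding rr using hr h F by (intro add_mono mult_right_mono) auto
      also have "\<dots> = r\<^sup>2 * (c * (F * (H1 * F)) + 3 * (F * h))"
        by (simp add: algebra_simps)
      also have "\<dots> \<le> r\<^sup>2 * (c * (F * h) + 3 * (F * h))"
        using H1F F c by (intro mult_left_mono add_mono) auto
      finally have "r\<^sup>2 * G\<^sup>2 \<le> r\<^sup>2 * ((c + 3) * (F * h))"
        by (simp add: power_mult_distrib algebra_simps)
      then have "G\<^sup>2 \<le> (c + 3) * (F * h)" using r by simp
      also have "\<dots> \<le> 2 * C_star H1 * (F * h)"
        using Cs c Fh by (intro mult_right_mono) auto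
      finally show ?thesis .
    qed
  qed
  then show ?thesis by (simp add: G_def F_def h_def mult.assoc)
qed

lemma gradient_minimizer: "grad xstar = 0"
  using gradient_norm_bound[of xstar] by simp

lemma quadratic_growth: "\<mu> / 2 * (norm (x - xstar))\<^sup>2 \<le> gap f x"
  using strong_first_order[of xstar x] by (simp add: gradient_minimizer)

lemma gradient_le_level:
  assumes "0 \<le> \<Delta>" and "gap f x \<le> 4 * \<Delta>"
  shows "norm (grad x) \<le> G_level H0 H1 \<Delta>"
proof -
  have C: "0 \<le> C_star H1" by (simp add: C_star_def)
  note nn = smoothness_nonneg gap_nonneg[of x]
  have "(norm (grad x))\<^sup>2 \<le> 2 * C_star H1 * (gap f x * (H0 + H1 * gap f x))"
    using gradient_norm_bound[of x] by (simp add: mult.assoc)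
  also have "\<dots> \<le> 2 * C_star H1 * ((4 * \<Delta>) * (4 * (H0 + H1 * \<Delta>)))"
  proof (intro mult_left_mono mult_mono)
    have "H1 * gap f x \<le> H1 * (4 * \<Delta>)" using assms nn by (intro mult_left_mono) auto
    then show "H0 + H1 * gap f x \<le> 4 * (H0 + H1 * \<Delta>)" using nn by simp
  qed (use assms nn C in auto)
  also have "\<dots> = 32 * C_star H1 * \<Delta> * (H0 + H1 * \<Delta>)" by simp
  finally show ?thesis
    by (simp add: G_level_def real_le_rsqrt)
qed

text \<open>The gradient is the pointwise limit of difference quotients of a continuous function.\<close>

lemma grad_measurable [measurable]: "grad \<in> borel_measurable borel"
  and objective_measurable [measurable]: "f \<in> borel_measurable borel"
proof -
  have der: "(f has_derivative (\<lambda>h. h \<bullet> grad x)) (at x)" for x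
    using convex by (auto simp: convex_modulus_def gderiv_def)
  show fm [measurable]: "f \<in> borel_measurable borel"
    by (intro borel_measurable_continuous_onI continuous_at_imp_continuous_on ballI)
       (metis der has_derivative_continuous)
  have "(\<lambda>x. grad x \<bullet> b) \<in> borel_measurable borel" for b
  proof (rule borel_measurable_LIMSEQ_real)
    fix x
    have "((\<lambda>t. f (x + t *\<^sub>R b)) has_derivative (\<lambda>t. (t *\<^sub>R b) \<bullet> grad x)) (at 0)"
      using der[of x] by (intro has_derivative_compose[of "\<lambda>t. x + t *\<^sub>R b" _ 0 UNIV f])
        (auto intro!: derivative_eq_intros)
    then have "((\<lambda>t. f (x + t *\<^sub>R b)) has_field_derivative grad x \<bullet> b) (at 0)"
      by (simp add: has_field_derivative_def inner_commute mult_commute_abs)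
    then have "((\<lambda>t. (f (x + t *\<^sub>R b) - f x) / t) \<longlongrightarrow> grad x \<bullet> b) (at 0)"
      by (simp add: has_field_derivative_iff)
    moreover have "filterlim (\<lambda>n. 1 / real (Suc n)) (at 0) sequentially"
      unfolding filterlim_at using LIMSEQ_Suc[OF lim_1_over_n] by auto
    ultimately show "(\<lambda>n. (f (x + (1 / real (Suc n)) *\<^sub>R b) - f x) / (1 / real (Suc n)))
        \<longlonglongrightarrow> grad x \<bullet> b"
      by (rule filterlim_compose)
  qed measurable
  then show "grad \<in> borel_measurable borel"
    by (rule borel_measurable_euclidean_space[THEN iffD2, rule_format])
qed

end


section \<open>A deterministic accelerated step\<close>

text \<open>The three-point inequality of mirror descent: the obtuse-angle property of the projection,
  rewritten with the cosine rule.\<close>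

lemma closest_point_three_point:
  fixes z c v :: "'a::euclidean_space"
  assumes "closed Q" "convex Q" "c \<in> Q"
  defines "z' \<equiv> closest_point Q (z - v)"
  shows "v \<bullet> (z' - c) \<le> (norm (z - c))\<^sup>2 / 2 - (norm (z' - c))\<^sup>2 / 2 - (norm (z' - z))\<^sup>2 / 2"
proof -
  have "((z - v) - z') \<bullet> (c - z') \<le> 0"
    unfolding z'_def by (rule closest_point_dot[OF assms(2,1,3)])
  moreover have "(norm (z - c))\<^sup>2 = (norm (z' - c))\<^sup>2 + (norm (z' - z))\<^sup>2 - 2 * ((z' - c) \<bullet> (z' - z))"
    by (simp add: power2_norm_eq_inner algebra_simps inner_commute)
  ultimately show ?thesis
    by (simp add: algebra_simps inner_commute)
qed

context smooth_convex_objective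
begin

text \<open>Linear coupling. The query point \<open>u\<close> averages \<open>y\<close> and \<open>z\<close>, so the convexity bounds at \<open>u\<close>
  against \<open>y\<close> (weight \<open>A\<close>) and against the minimizer (weight \<open>a\<close>) combine into
  \<open>a * (grad u \<bullet> (z - xstar))\<close>; the quadratic terms from smoothness and from replacing \<open>grad u\<close> by
  its estimate \<open>v\<close> are paid for by the \<open>- \<parallel>z' - z\<parallel>\<^sup>2 / 2\<close> of the projection step.\<close>

lemma accelerated_step_core:
  fixes y z v :: 'a and A a :: real
  assumes "closed Q" "convex Q" "xstar \<in> Q" "0 \<le> A" "0 < a"
  defines "u \<equiv> (A *\<^sub>R y + a *\<^sub>R z) /\<^sub>R (A + a)"
  defines "z' \<equiv> closest_point Q (z - a *\<^sub>R v)"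
  defines "y' \<equiv> (A *\<^sub>R y + a *\<^sub>R z') /\<^sub>R (A + a)"
  assumes rad: "ereal (norm (y' - u)) \<le> smooth_radius H1"
    and curv: "(H0 + H1 * gap f u) * a\<^sup>2 \<le> (A + a) / 4"
  shows "(A + a) * gap f y' + (norm (z' - xstar))\<^sup>2 / 2
    \<le> A * gap f y + (norm (z - xstar))\<^sup>2 / 2
       + a * ((grad u - v) \<bullet> (z - xstar)) + a\<^sup>2 * (norm (grad u - v))\<^sup>2"
proof -
  define A' where "A' = A + a"
  have A': "0 < A'" using assms by (simp add: A'_def)
  define h where "h = H0 + H1 * gap f u"
  define e where "e = grad u - v"
  have yu: "y' - u = (a / A') *\<^sub>R (z' - z)"
    by (simp add: y'_def u_def A'_def algebra_simps divide_inverse)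
  have Au: "A *\<^sub>R (y - u) + a *\<^sub>R (xstar - u) = a *\<^sub>R (xstar - z)"
  proof -
    have "A' *\<^sub>R u = A *\<^sub>R y + a *\<^sub>R z" using A' by (simp add: u_def A'_def)
    then show ?thesis by (simp add: A'_def algebra_simps)
  qed
  have up: "A' * gap f y' \<le> A' * gap f u + a * (grad u \<bullet> (z' - z)) + h * a\<^sup>2 / A' * (norm (z' - z))\<^sup>2"
  proof -
    have "gap f y' \<le> gap f u + grad u \<bullet> (y' - u) + h * (norm (y' - u))\<^sup>2"
      unfolding h_def by (rule local_upper_bound[OF rad])
    then have "A' * gap f y' \<le> A' * (gap f u + grad u \<bullet> (y' - u) + h * (norm (y' - u))\<^sup>2)"
      using A' by (intro mult_left_mono) auto
    also have "\<dots> = A' * gap f u + a * (grad u \<bullet> (z' - z)) + h * a\<^sup>2 / A' * (norm (z' - z))\<^sup>2"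
    proof -
      have "norm (y' - u) = a / A' * norm (z' - z)" "grad u \<bullet> (y' - u) = a / A' * (grad u \<bullet> (z' - z))"
        using A' \<open>0 < a\<close> by (simp_all add: yu)
      moreover have "A' * (h * (a / A' * n)\<^sup>2) = h * a\<^sup>2 / A' * n\<^sup>2" for n
        using A' by (simp add: power2_eq_square)
      ultimately show ?thesis
        using A' by (simp add: distrib_left)
    qed
    finally show ?thesis .
  qed
  have lo: "A' * gap f u \<le> A * gap f y + a * (grad u \<bullet> (z - xstar))"
  proof -
    have "A * (gap f u + grad u \<bullet> (y - u)) \<le> A * gap f y"
      using first_order[of u y] \<open>0 \<le> A\<close> by (intro mult_left_mono) auto
    moreover have "a * (gap f u + grad u \<bullet> (xstar - u)) \<le> a * gap f xstar"
      using first_order[of u xstar] \<open>0 < a\<close> by (intro mult_left_mono) auto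
    moreover have "A * (grad u \<bullet> (y - u)) + a * (grad u \<bullet> (xstar - u)) = a * (grad u \<bullet> (xstar - z))"
      using arg_cong[OF Au, of "inner (grad u)"] by (simp add: inner_add_right)
    ultimately show ?thesis
      by (simp add: A'_def algebra_simps inner_diff_right)
  qed
  have pr: "a * (v \<bullet> (z' - xstar)) \<le> (norm (z - xstar))\<^sup>2 / 2 - (norm (z' - xstar))\<^sup>2 / 2
      - (norm (z' - z))\<^sup>2 / 2"
    using closest_point_three_point[OF assms(1-3), of "a *\<^sub>R v" z] by (simp add: z'_def)
  have cs: "a * (e \<bullet> (z' - z)) \<le> a\<^sup>2 * (norm e)\<^sup>2 + (norm (z' - z))\<^sup>2 / 4"
  proof -
    have "e \<bullet> (z' - z) \<le> norm e * norm (z' - z)" by (rule norm_cauchy_schwarz)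
    then have "a * (e \<bullet> (z' - z)) \<le> a * (norm e * norm (z' - z))"
      using \<open>0 < a\<close> by (intro mult_left_mono) auto
    moreover have "0 \<le> (a * norm e - norm (z' - z) / 2)\<^sup>2" by simp
    ultimately show ?thesis
      by (simp add: power2_eq_square algebra_simps)
  qed
  have "h * a\<^sup>2 / A' \<le> 1 / 4"
    using curv A' by (simp add: h_def A'_def field_simps)
  then have q: "h * a\<^sup>2 / A' * (norm (z' - z))\<^sup>2 \<le> 1 / 4 * (norm (z' - z))\<^sup>2"
    by (intro mult_right_mono) auto
  have split: "a * (grad u \<bullet> (z' - z)) + a * (grad u \<bullet> (z - xstar))
      = a * (v \<bullet> (z' - xstar)) + a * (e \<bullet> (z' - z)) + a * (e \<bullet> (z - xstar))"
    by (simp add: e_def algebra_simps inner_diff_right inner_diff_left)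
  show ?thesis
    using up lo pr cs q split unfolding A'_def[symmetric] e_def[symmetric] by linarith
qed

lemma G_level_sq:
  assumes "0 \<le> \<Delta>"
  shows "(G_level H0 H1 \<Delta>)\<^sup>2 = 32 * C_star H1 * \<Delta> * (H0 + H1 * \<Delta>)"
proof -
  have "0 \<le> 32 * C_star H1 * \<Delta> * (H0 + H1 * \<Delta>)"
    using assms smoothness_nonneg by (simp add: C_star_def)
  then show ?thesis by (simp add: G_level_def)
qed

lemma curvature_le_level:
  assumes "0 < \<Delta>"
  shows "64 * \<Delta> * (H0 + H1 * \<Delta>) \<le> (G_level H0 H1 \<Delta>)\<^sup>2"
proof -
  have "32 * 2 * (\<Delta> * (H0 + H1 * \<Delta>)) \<le> 32 * C_star H1 * (\<Delta> * (H0 + H1 * \<Delta>))"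
    using assms smoothness_nonneg by (intro mult_right_mono) (auto simp: C_star_def)
  then show ?thesis using assms by (simp add: G_level_sq mult.assoc)
qed

lemma level_nonneg: "0 < \<Delta> \<Longrightarrow> 0 \<le> G_level H0 H1 \<Delta>"
  by (rule G_level_nonneg[OF smoothness_nonneg])

text \<open>The level \<open>G_level\<close> contains \<open>\<Delta> \<surd>H1\<close> up to a constant, so a step that is short compared with
  \<open>\<Delta> / G_level\<close> is short compared with \<open>1 / \<surd>H1\<close>.\<close>

lemma short_step_in_smooth_radius:
  assumes "0 < \<Delta>" "0 \<le> \<delta>" and small: "\<delta> * G_level H0 H1 \<Delta> \<le> \<Delta>"
  shows "ereal \<delta> \<le> smooth_radius H1"
proof (cases "0 < H1")
  case False
  then show ?thesis by (simp add: smooth_radius_def)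
next
  case True
  define k :: real where "k = 2 * sqrt 3 + sqrt 6"
  have k: "0 < k" by (simp add: k_def add_pos_pos)
  have "sqrt 6 = sqrt 2 * sqrt (3::real)" by (simp flip: real_sqrt_mult)
  then have k2: "k\<^sup>2 = 18 + 12 * sqrt 2"
    by (simp add: k_def power2_eq_square algebra_simps)
  have "\<delta>\<^sup>2 * (32 * C_star H1 * \<Delta> * (H0 + H1 * \<Delta>)) \<le> \<Delta>\<^sup>2"
    using power_mono[OF small, of 2] assms level_nonneg[of \<Delta>] by (simp add: power_mult_distrib G_level_sq)
  moreover have "\<delta>\<^sup>2 * (k\<^sup>2 * \<Delta> * (H1 * \<Delta>)) \<le> \<delta>\<^sup>2 * (32 * C_star H1 * \<Delta> * (H0 + H1 * \<Delta>))"
    using assms smoothness_nonneg True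
    by (intro mult_left_mono mult_mono) (auto simp: k2 C_star_def)
  ultimately have "(\<delta> * (k * sqrt H1))\<^sup>2 * \<Delta>\<^sup>2 \<le> 1 * \<Delta>\<^sup>2"
    using True by (simp add: power_mult_distrib power2_eq_square algebra_simps)
  then have "(\<delta> * (k * sqrt H1))\<^sup>2 \<le> 1\<^sup>2" using assms(1) by (simp del: one_power2)
  then have "\<delta> * (k * sqrt H1) \<le> 1" by (rule power2_le_imp_le) simp
  then have "\<delta> \<le> 1 / (k * sqrt H1)" using True k by (simp add: pos_le_divide_eq)
  then show ?thesis using True by (simp add: smooth_radius_def k_def)
qed

text \<open>The barrier \<open>A * gap f y \<le> 3 * D\<^sup>2\<close> alone makes the step admissible: it gives \<open>F(y) \<le> 3 \<Delta>\<close>, and as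
  \<open>\<parallel>u - y\<parallel> \<le> \<eta> D\<close> is tiny compared with \<open>\<Delta> / G_level\<close>, moving from \<open>y\<close> to \<open>u\<close> costs at most \<open>\<Delta>\<close>
  and the curvature at \<open>u\<close> is small enough for \<open>accelerated_step_core\<close>.\<close>

lemma accelerated_step:
  fixes y z v :: 'a and A a \<eta> D \<Delta> :: real
  assumes Q: "closed Q" "convex Q" "xstar \<in> Q" "y \<in> Q" "z \<in> Q"
    and diam: "\<And>p q. p \<in> Q \<Longrightarrow> q \<in> Q \<Longrightarrow> norm (p - q) \<le> D"
    and pos: "0 < D" "0 < \<Delta>" "0 < a" "0 \<le> \<eta>"
    and a: "a \<le> \<eta> * (D\<^sup>2 / \<Delta>)" and A: "D\<^sup>2 / \<Delta> \<le> A"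
    and small: "\<eta> * D * G_level H0 H1 \<Delta> \<le> \<Delta> / 800"
    and pot: "A * gap f y \<le> 3 * D\<^sup>2"
  defines "u \<equiv> (A *\<^sub>R y + a *\<^sub>R z) /\<^sub>R (A + a)"
  defines "z' \<equiv> closest_point Q (z - a *\<^sub>R v)"
  defines "y' \<equiv> (A *\<^sub>R y + a *\<^sub>R z') /\<^sub>R (A + a)"
  shows "gap f u \<le> 4 * \<Delta>"
    and "(A + a) * gap f y' + (norm (z' - xstar))\<^sup>2 / 2
    \<le> A * gap f y + (norm (z - xstar))\<^sup>2 / 2
       + a * ((grad u - v) \<bullet> (z - xstar)) + a\<^sup>2 * (norm (grad u - v))\<^sup>2"
proof -
  define G where "G = G_level H0 H1 \<Delta>"
  have G: "0 \<le> G" using pos by (simp add: G_def level_nonneg)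
  have A0: "0 < A" using A pos by (smt (verit) divide_pos_pos zero_less_power)
  have z'Q: "z' \<in> Q" unfolding z'_def using Q by (intro closest_point_in_set) auto
  have ratio: "a / (A + a) \<le> \<eta>"
  proof -
    have "a \<le> \<eta> * (D\<^sup>2 / \<Delta>)" by (rule a)
    also have "\<dots> \<le> \<eta> * (A + a)" using A pos by (intro mult_left_mono) auto
    finally show ?thesis using A0 pos by (simp add: field_simps)
  qed
  have short: "norm ((a / (A + a)) *\<^sub>R (p - q)) \<le> \<eta> * D" if "p \<in> Q" "q \<in> Q" for p q
  proof -
    have "norm ((a / (A + a)) *\<^sub>R (p - q)) = a / (A + a) * norm (p - q)"
      using A0 pos by simp
    also have "\<dots> \<le> \<eta> * D"
      using ratio diam[OF that] pos A0 by (intro mult_mono) auto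
    finally show ?thesis .
  qed
  have radius: "ereal r \<le> smooth_radius H1" if "r \<le> \<eta> * D" for r
  proof -
    have "ereal (\<eta> * D) \<le> smooth_radius H1"
      using small pos by (intro short_step_in_smooth_radius[of \<Delta>]) auto
    then show ?thesis using that by (meson ereal_less_eq(3) order_trans)
  qed
  have hD: "(H0 + H1 * \<Delta>) * (\<eta> * D)\<^sup>2 \<le> \<Delta> / 1000000"
  proof -
    have "64 * \<Delta> * (H0 + H1 * \<Delta>) * (\<eta> * D)\<^sup>2 \<le> G\<^sup>2 * (\<eta> * D)\<^sup>2"
      unfolding G_def using pos curvature_le_level by (intro mult_right_mono) auto
    also have "\<dots> = (\<eta> * D * G)\<^sup>2" by (simp add: power_mult_distrib)
    also have "\<dots> \<le> (\<Delta> / 800)\<^sup>2"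
      using small G pos by (intro power_mono) (auto simp: G_def)
    finally have "\<Delta> * (64 * (H0 + H1 * \<Delta>) * (\<eta> * D)\<^sup>2) \<le> \<Delta> * (\<Delta> / 640000)"
      by (simp add: power2_eq_square algebra_simps)
    then have "64 * (H0 + H1 * \<Delta>) * (\<eta> * D)\<^sup>2 \<le> \<Delta> / 640000" using pos by simp
    then show ?thesis using pos unfolding mult.assoc by linarith
  qed
  have level: "H0 + H1 * F \<le> c * (H0 + H1 * \<Delta>)" if "F \<le> c * \<Delta>" "1 \<le> c" for F c
  proof -
    have "H1 * F \<le> H1 * (c * \<Delta>)" using that smoothness_nonneg by (intro mult_left_mono)
    moreover have "1 * H0 \<le> c * H0" using that smoothness_nonneg by (intro mult_right_mono) auto
    ultimately show ?thesis by (simp add: algebra_simps)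
  qed
  have Fy: "gap f y \<le> 3 * \<Delta>"
  proof -
    have "D\<^sup>2 / \<Delta> * gap f y \<le> A * gap f y" using A gap_nonneg by (intro mult_right_mono)
    also have "\<dots> \<le> 3 * D\<^sup>2" by (rule pot)
    finally show ?thesis using pos by (simp add: field_simps)
  qed
  have uy: "u - y = (a / (A + a)) *\<^sub>R (z - y)"
  proof -
    have "(A + a) *\<^sub>R u = A *\<^sub>R y + a *\<^sub>R z" using A0 pos by (simp add: u_def)
    then have "(A + a) *\<^sub>R (u - y) = a *\<^sub>R (z - y)" by (simp add: algebra_simps)
    moreover have ne: "A + a \<noteq> 0" using A0 pos by simp
    ultimately have "(A + a) *\<^sub>R (u - y) = (A + a) *\<^sub>R ((a / (A + a)) *\<^sub>R (z - y))" by simp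
    with ne show ?thesis by (metis scaleR_cancel_left)
  qed
  have nuy: "norm (u - y) \<le> \<eta> * D" unfolding uy using Q by (intro short)
  show Fu: "gap f u \<le> 4 * \<Delta>"
  proof -
    have "gap f u \<le> gap f y + grad y \<bullet> (u - y) + (H0 + H1 * gap f y) * (norm (u - y))\<^sup>2"
      by (intro local_upper_bound radius nuy)
    also have "grad y \<bullet> (u - y) \<le> norm (grad y) * norm (u - y)" by (rule norm_cauchy_schwarz)
    also have "\<dots> \<le> G * (\<eta> * D)"
      unfolding G_def using Fy pos nuy G G_def
      by (intro mult_mono gradient_le_level) auto
    also have "G * (\<eta> * D) \<le> \<Delta> / 800" using small by (simp add: G_def mult.commute)
    also have "(H0 + H1 * gap f y) * (norm (u - y))\<^sup>2 \<le> 3 * (H0 + H1 * \<Delta>) * (\<eta> * D)\<^sup>2"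
      using level[OF Fy] nuy smoothness_nonneg gap_nonneg pos
      by (intro mult_mono power_mono) auto
    also have "\<dots> \<le> 3 * (\<Delta> / 1000000)" using hD unfolding mult.assoc by (intro mult_left_mono) auto
    finally show ?thesis using Fy pos by simp
  qed
  have curv: "(H0 + H1 * gap f u) * a\<^sup>2 \<le> (A + a) / 4"
  proof -
    have "a\<^sup>2 \<le> (\<eta> * (D\<^sup>2 / \<Delta>))\<^sup>2" using a pos by (intro power_mono) auto
    then have "(H0 + H1 * gap f u) * a\<^sup>2 \<le> 4 * (H0 + H1 * \<Delta>) * (\<eta> * (D\<^sup>2 / \<Delta>))\<^sup>2"
      using level[OF Fu] smoothness_nonneg gap_nonneg pos by (intro mult_mono) auto
    also have "\<dots> = 4 * ((H0 + H1 * \<Delta>) * (\<eta> * D)\<^sup>2) * (D\<^sup>2 / \<Delta>\<^sup>2)"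
      by (simp add: power_mult_distrib power_divide power2_eq_square)
    also have "\<dots> \<le> 4 * (\<Delta> / 1000000) * (D\<^sup>2 / \<Delta>\<^sup>2)"
      using hD by (intro mult_right_mono) auto
    also have "\<dots> = 4 / 1000000 * (D\<^sup>2 / \<Delta>)" using pos by (simp add: power2_eq_square)
    also have "\<dots> \<le> 4 / 1000000 * A" using A by simp
    also have "\<dots> \<le> (A + a) / 4" using A0 pos by simp
    finally show ?thesis .
  qed
  have yu: "y' - u = (a / (A + a)) *\<^sub>R (z' - z)"
    by (simp add: y'_def u_def algebra_simps divide_inverse)
  have "ereal (norm (y' - u)) \<le> smooth_radius H1"
    unfolding yu by (intro radius short z'Q Q)
  then show "(A + a) * gap f y' + (norm (z' - xstar))\<^sup>2 / 2
    \<le> A * gap f y + (norm (z - xstar))\<^sup>2 / 2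
       + a * ((grad u - v) \<bullet> (z - xstar)) + a\<^sup>2 * (norm (grad u - v))\<^sup>2"
    unfolding u_def z'_def y'_def using Q A0 pos curv[unfolded u_def]
    by (intro accelerated_step_core) auto
qed

end


section \<open>Clipping\<close>

lemma norm_clip_excess:
  fixes h :: "'a::real_normed_vector"
  assumes "0 \<le> \<Lambda>" "\<Lambda> < norm h"
  shows "norm (h - clip \<Lambda> h) = norm h - \<Lambda>"
proof -
  have r: "\<Lambda> / norm h \<le> 1" using assms by (simp add: divide_le_eq_1)
  then have "h - clip \<Lambda> h = (1 - \<Lambda> / norm h) *\<^sub>R h"
    by (simp add: clip_def min_absorb2 scaleR_left_diff_distrib)
  also have "norm \<dots> = (1 - \<Lambda> / norm h) * norm h" using r by simp
  also have "\<dots> = norm h - \<Lambda>" using assms by (auto simp: left_diff_distrib)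
  finally show ?thesis .
qed

text \<open>Clipping is a projection, hence nonexpansive and continuous.\<close>

lemma clip_eq_closest_point:
  assumes "0 \<le> \<Lambda>"
  shows "clip \<Lambda> h = closest_point (cball 0 \<Lambda>) (h::'a::euclidean_space)"
proof -
  have n: "norm (clip \<Lambda> h) \<le> \<Lambda>"
  proof (cases "norm h \<le> \<Lambda>")
    case True
    then have "norm (clip \<Lambda> h) \<le> 1 * norm h"
      using assms unfolding clip_def norm_scaleR by (intro mult_right_mono) auto
    then show ?thesis using True by simp
  next
    case False
    then show ?thesis using assms by (auto simp: clip_def min_def field_simps)
  qed
  have "dist h (clip \<Lambda> h) \<le> dist h z" if "z \<in> cball 0 \<Lambda>" for z
  proof (cases "norm h \<le> \<Lambda>")
    case True
    then have "clip \<Lambda> h = h" using assms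
      by (cases "h = 0") (auto simp: clip_def min_def field_simps)
    then show ?thesis by simp
  next
    case False
    then have "dist h (clip \<Lambda> h) = norm h - \<Lambda>"
      using assms by (simp add: dist_norm norm_clip_excess)
    also have "\<dots> \<le> norm h - norm z" using that by simp
    also have "\<dots> \<le> dist h z" by (simp add: dist_norm norm_triangle_ineq2)
    finally show ?thesis .
  qed
  then show ?thesis
    using assms n by (intro closest_point_unique) auto
qed

lemma norm_clip_le: "0 \<le> \<Lambda> \<Longrightarrow> norm (clip \<Lambda> (h::'a::euclidean_space)) \<le> \<Lambda>"
  using closest_point_in_set[of "cball 0 \<Lambda>" h] by (simp add: clip_eq_closest_point)

lemma clip_borel_measurable:
  assumes "0 \<le> \<Lambda>"
  shows "(clip \<Lambda> :: 'a::euclidean_space \<Rightarrow> 'a) \<in> borel_measurable borel"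
proof -
  have "continuous_on UNIV (closest_point (cball 0 \<Lambda>) :: 'a \<Rightarrow> 'a)"
    using assms by (intro continuous_on_closest_point) auto
  moreover have "clip \<Lambda> = (closest_point (cball 0 \<Lambda>) :: 'a \<Rightarrow> 'a)"
    using assms by (intro ext clip_eq_closest_point)
  ultimately show ?thesis by (simp add: borel_measurable_continuous_onI)
qed

text \<open>Where clipping acts, the noise is at least \<open>\<Lambda> / 2\<close>, since the mean is at most \<open>\<Lambda> / 2\<close>. So the first
  power of the noise is bounded by its \<open>p\<close>-th power times \<open>(\<Lambda> / 2) powr (1 - p)\<close>.\<close>

lemma clip_bias_le:
  fixes h c :: "'a::euclidean_space"
  assumes "0 < \<Lambda>" "norm c \<le> \<Lambda> / 2" "1 < p" "p \<le> 2"
  shows "norm (h - clip \<Lambda> h) \<le> 2 * \<Lambda> powr (1 - p) * norm (h - c) powr p"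
proof (cases "norm h \<le> \<Lambda>")
  case True
  then have "clip \<Lambda> h = h" using assms
    by (cases "h = 0") (auto simp: clip_def min_def field_simps)
  then show ?thesis by simp
next
  case False
  define n where "n = norm (h - c)"
  have n: "norm h - \<Lambda> / 2 \<le> n"
    using norm_triangle_ineq2[of h c] assms unfolding n_def by linarith
  have n2: "\<Lambda> / 2 \<le> n" using n False by linarith
  have "norm (h - clip \<Lambda> h) = norm h - \<Lambda>"
    using False assms by (intro norm_clip_excess) auto
  also have "\<dots> \<le> n" using n assms by linarith
  also have "\<dots> = n powr (1 - p) * n powr p"
    using n2 assms by (simp flip: powr_add)
  also have "\<dots> \<le> (\<Lambda> / 2) powr (1 - p) * n powr p"
    using n2 assms by (intro mult_right_mono powr_mono2') auto
  also have "(\<Lambda> / 2) powr (1 - p) = 2 powr (p - 1) * \<Lambda> powr (1 - p)"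
    using assms powr_minus_divide[of 2 "p - 1"] by (simp add: powr_divide)
  also have "\<dots> * n powr p \<le> 2 * \<Lambda> powr (1 - p) * n powr p"
  proof (intro mult_right_mono)
    show "2 powr (p - 1) \<le> (2::real)"
      using powr_mono[of "p - 1" 1 "2::real"] assms by simp
  qed auto
  finally show ?thesis by (simp add: n_def)
qed

text \<open>The error is at most the noise, because \<open>c\<close> is a fixed point of the nonexpansive clipping, and at
  most \<open>3/2 \<Lambda>\<close>. Interpolating between the two turns the \<open>p\<close>-th moment into a second moment.\<close>

lemma clip_error_sq_le:
  fixes h c :: "'a::euclidean_space"
  assumes "0 < \<Lambda>" "norm c \<le> \<Lambda> / 2" "1 < p" "p \<le> 2"
  shows "(norm (c - clip \<Lambda> h))\<^sup>2 \<le> 3 / 2 * \<Lambda> powr (2 - p) * norm (h - c) powr p"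
proof -
  define m where "m = norm (c - clip \<Lambda> h)"
  define n where "n = norm (h - c)"
  have "norm (clip \<Lambda> h) \<le> \<Lambda>" using assms by (simp add: norm_clip_le)
  then have m1: "m \<le> 3 / 2 * \<Lambda>"
    using norm_triangle_ineq4[of c "clip \<Lambda> h"] assms unfolding m_def by linarith
  have "closest_point (cball 0 \<Lambda>) c = c" using assms by (intro closest_point_self) simp
  then have "m = dist (closest_point (cball 0 \<Lambda>) c) (closest_point (cball 0 \<Lambda>) h)"
    using assms by (simp add: m_def dist_norm clip_eq_closest_point)
  also have "\<dots> \<le> dist c h"
    using assms by (intro closest_point_lipschitz) auto
  finally have m2: "m \<le> n" by (simp add: n_def dist_norm norm_minus_commute)
  show ?thesis
  proof (cases "m = 0")
    case True
    then show ?thesis using assms by (simp add: m_def)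
  next
    case False
    then have m: "0 < m" by (simp add: m_def)
    then have "m\<^sup>2 = m powr (2 - p) * m powr p"
      by (simp flip: powr_add add: powr_numeral)
    also have "\<dots> \<le> (3 / 2 * \<Lambda>) powr (2 - p) * n powr p"
      using m m1 m2 assms by (intro mult_mono powr_mono2) auto
    also have "(3 / 2 * \<Lambda>) powr (2 - p) = (3 / 2) powr (2 - p) * \<Lambda> powr (2 - p)"
      using assms by (intro powr_mult) 
    also have "\<dots> * n powr p \<le> 3 / 2 * \<Lambda> powr (2 - p) * n powr p"
    proof (intro mult_right_mono)
      show "(3 / 2) powr (2 - p) \<le> (3 / 2 :: real)"
        using powr_mono[of "2 - p" 1 "3 / 2 :: real"] assms by simp
    qed auto
    finally show ?thesis by (simp add: m_def n_def)
  qed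
qed

lemma exp_le_quadratic:
  fixes x :: real
  assumes "\<bar>x\<bar> \<le> 1"
  shows "exp x \<le> 1 + x + x\<^sup>2"
proof (cases "0 \<le> x")
  case True
  then show ?thesis using exp_bound[of x] assms by simp
next
  case False
  define y where "y = - x"
  have y: "0 \<le> y" "y \<le> 1" using False assms by (auto simp: y_def)
  have "1 \<le> (1 - y + y\<^sup>2) * (1 + y)"
    using y by (simp add: algebra_simps power2_eq_square)
  also have "\<dots> \<le> (1 - y + y\<^sup>2) * exp y"
    using y exp_ge_add_one_self[of y] by (intro mult_left_mono) (auto simp: add_nonneg_nonneg)
  finally have "exp (- y) \<le> 1 - y + y\<^sup>2"
    by (simp add: exp_minus field_simps)
  then show ?thesis by (simp add: y_def)
qed


section \<open>Exponential moments of the noise of one step\<close>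

lemma integrable_and_moment_of_cond_bound:
  fixes N :: "'w \<Rightarrow> real"
  assumes "prob_space M" "subalgebra M F" and N: "N \<in> borel_measurable M" "\<And>\<omega>. 0 \<le> N \<omega>"
    and W: "W \<in> borel_measurable F" "\<And>\<omega>. 0 \<le> W \<omega>" "\<And>\<omega>. W \<omega> \<le> 1"
    and bound: "AE \<omega> in M. nn_cond_exp M F (\<lambda>\<omega>. ennreal (N \<omega>)) \<omega> \<le> ennreal s" and s: "0 \<le> s"
  shows "integrable M (\<lambda>\<omega>. W \<omega> * N \<omega>)"
    and "(\<integral>\<omega>. W \<omega> * N \<omega> \<partial>M) \<le> s * (\<integral>\<omega>. W \<omega> \<partial>M)"
proof -
  interpret prob_space M by fact
  interpret finite_measure_subalgebra M F by unfold_locales fact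
  have [measurable]: "N \<in> borel_measurable M" "W \<in> borel_measurable M" "W \<in> borel_measurable F"
    using N W measurable_from_subalg[OF assms(2)] by auto
  have W_int: "integrable M W"
    by (rule integrable_const_bound[where B = 1]) (use W in auto)
  have "(\<integral>\<^sup>+\<omega>. ennreal (W \<omega> * N \<omega>) \<partial>M) = (\<integral>\<^sup>+\<omega>. ennreal (W \<omega>) * ennreal (N \<omega>) \<partial>M)"
    by (simp add: ennreal_mult N W)
  also have "\<dots> = (\<integral>\<^sup>+\<omega>. ennreal (W \<omega>) * nn_cond_exp M F (\<lambda>\<omega>. ennreal (N \<omega>)) \<omega> \<partial>M)"
    by (rule nn_cond_exp_intg[symmetric]) auto
  also have "\<dots> \<le> (\<integral>\<^sup>+\<omega>. ennreal (W \<omega>) * ennreal s \<partial>M)"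
    by (rule nn_integral_mono_AE, use bound in eventually_elim) (auto intro: mult_left_mono)
  also have "\<dots> = (\<integral>\<^sup>+\<omega>. ennreal (s * W \<omega>) \<partial>M)"
    using s W by (simp add: ennreal_mult mult.commute)
  also have "\<dots> = ennreal (\<integral>\<omega>. s * W \<omega> \<partial>M)"
    using s W W_int by (intro nn_integral_eq_integral) auto
  finally have le: "(\<integral>\<^sup>+\<omega>. ennreal (W \<omega> * N \<omega>) \<partial>M) \<le> ennreal (s * (\<integral>\<omega>. W \<omega> \<partial>M))" by simp
  show int: "integrable M (\<lambda>\<omega>. W \<omega> * N \<omega>)"
    by (rule integrableI_nonneg) (use le N W in \<open>auto simp: top_unique less_top[symmetric]\<close>)
  have "ennreal (\<integral>\<omega>. W \<omega> * N \<omega> \<partial>M) \<le> ennreal (s * (\<integral>\<omega>. W \<omega> \<partial>M))"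
    using le int N W by (subst nn_integral_eq_integral[symmetric]) auto
  then show "(\<integral>\<omega>. W \<omega> * N \<omega> \<partial>M) \<le> s * (\<integral>\<omega>. W \<omega> \<partial>M)"
    using s W by (simp add: integral_nonneg)
qed

text \<open>Unbiasedness is given coordinatewise through conditional expectations; here it becomes orthogonality
  to every bounded vector that is measurable with respect to the past.\<close>

lemma unbiased_inner_integral:
  fixes h c v :: "'w \<Rightarrow> 'a::euclidean_space"
  assumes "prob_space M" "subalgebra M F"
    and h: "integrable M h" and c: "c \<in> borel_measurable M" "\<And>\<omega>. norm (c \<omega>) \<le> C"
    and v: "v \<in> borel_measurable F" "\<And>\<omega>. norm (v \<omega>) \<le> D"
    and unb: "AE \<omega> in M. vec_cond_exp M F h \<omega> = c \<omega>"
  shows "integrable M (\<lambda>\<omega>. (c \<omega> - h \<omega>) \<bullet> v \<omega>)" and "(\<integral>\<omega>. (c \<omega> - h \<omega>) \<bullet> v \<omega> \<partial>M) = 0"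
proof -
  interpret prob_space M by fact
  interpret finite_measure_subalgebra M F by unfold_locales fact
  have [measurable]: "c \<in> borel_measurable M" "v \<in> borel_measurable M" "v \<in> borel_measurable F"
    "h \<in> borel_measurable M"
    using c v h measurable_from_subalg[OF assms(2)] by auto
  have ci: "integrable M c" by (rule integrable_const_bound[where B = C]) (use c in auto)
  have vb: "\<bar>v \<omega> \<bullet> b\<bar> \<le> D" if "b \<in> Basis" for b \<omega>
    using Basis_le_norm[OF that, of "v \<omega>"] v(2)[of \<omega>] by linarith
  have term_int: "integrable M (\<lambda>\<omega>. (v \<omega> \<bullet> b) * (k \<omega> \<bullet> b))"
    if "b \<in> Basis" "integrable M k" for b and k :: "'w \<Rightarrow> 'a"
  proof (rule Bochner_Integration.integrable_bound)
    show "integrable M (\<lambda>\<omega>. D * norm (k \<omega> \<bullet> b))" using that by simp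
    show "AE \<omega> in M. norm ((v \<omega> \<bullet> b) * (k \<omega> \<bullet> b)) \<le> norm (D * norm (k \<omega> \<bullet> b))"
    proof (rule AE_I2)
      fix \<omega>
      have "\<bar>v \<omega> \<bullet> b\<bar> * \<bar>k \<omega> \<bullet> b\<bar> \<le> D * \<bar>k \<omega> \<bullet> b\<bar>"
        using vb[OF that(1)] by (intro mult_right_mono) auto
      also have "\<dots> \<le> \<bar>D * \<bar>k \<omega> \<bullet> b\<bar>\<bar>" by (rule abs_ge_self)
      finally show "norm ((v \<omega> \<bullet> b) * (k \<omega> \<bullet> b)) \<le> norm (D * norm (k \<omega> \<bullet> b))"
        by (simp add: abs_mult)
    qed
  qed (use that in \<open>auto intro!: borel_measurable_times borel_measurable_inner\<close>)
  have eq: "(\<integral>\<omega>. (v \<omega> \<bullet> b) * (c \<omega> \<bullet> b) \<partial>M) = (\<integral>\<omega>. (v \<omega> \<bullet> b) * (h \<omega> \<bullet> b) \<partial>M)" if "b \<in> Basis" for b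
  proof -
    have "(\<integral>\<omega>. (v \<omega> \<bullet> b) * (h \<omega> \<bullet> b) \<partial>M) =
        (\<integral>\<omega>. (v \<omega> \<bullet> b) * real_cond_exp M F (\<lambda>\<omega>. h \<omega> \<bullet> b) \<omega> \<partial>M)"
      by (rule real_cond_exp_intg(2)[symmetric]) (use term_int[OF that h] in auto)
    also have "\<dots> = (\<integral>\<omega>. (v \<omega> \<bullet> b) * (c \<omega> \<bullet> b) \<partial>M)"
    proof (rule integral_cong_AE)
      show "AE \<omega> in M. (v \<omega> \<bullet> b) * real_cond_exp M F (\<lambda>\<omega>. h \<omega> \<bullet> b) \<omega> = (v \<omega> \<bullet> b) * (c \<omega> \<bullet> b)"
        using unb
      proof eventually_elim
        case (elim \<omega>)
        have "vec_cond_exp M F h \<omega> \<bullet> b = real_cond_exp M F (\<lambda>\<omega>. h \<omega> \<bullet> b) \<omega>"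
          unfolding vec_cond_exp_def using that by (rule inner_sum_left_Basis)
        then show ?case using elim by simp
      qed
    qed measurable
    finally show ?thesis by simp
  qed
  have expand: "(c \<omega> - h \<omega>) \<bullet> v \<omega> = (\<Sum>b\<in>Basis. (v \<omega> \<bullet> b) * (c \<omega> \<bullet> b) - (v \<omega> \<bullet> b) * (h \<omega> \<bullet> b))" for \<omega>
    by (subst euclidean_inner) (simp add: algebra_simps)
  show "integrable M (\<lambda>\<omega>. (c \<omega> - h \<omega>) \<bullet> v \<omega>)"
    unfolding expand using term_int ci h by (intro Bochner_Integration.integrable_sum Bochner_Integration.integrable_diff) auto
  show "(\<integral>\<omega>. (c \<omega> - h \<omega>) \<bullet> v \<omega> \<partial>M) = 0"
    unfolding expand using term_int ci h eq
    by (subst Bochner_Integration.integral_sum) (auto simp: Bochner_Integration.integral_diff)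
qed

text \<open>All that is left of the noise after linearising the exponential is an unbiased term, linear in
  \<open>c - h\<close>, and a multiple of its \<open>p\<close>-th power.\<close>

lemma clipped_step_pointwise:
  fixes h c v :: "'a::euclidean_space"
  assumes "0 < \<Lambda>" "norm c \<le> \<Lambda> / 2" "1 < p" "p \<le> 2" "0 \<le> l" "0 \<le> a" "norm v \<le> D"
    and small: "l * (3 / 2 * a * \<Lambda> * D + 9 / 4 * a\<^sup>2 * \<Lambda>\<^sup>2) \<le> 1"
  shows "exp (l * (a * ((c - clip \<Lambda> h) \<bullet> v) + a\<^sup>2 * (norm (c - clip \<Lambda> h))\<^sup>2))
    \<le> 1 + l * a * ((c - h) \<bullet> v)
      + (2 * l * a * D * \<Lambda> powr (1 - p)
         + (l * a\<^sup>2 + l\<^sup>2 * (2 * a\<^sup>2 * D\<^sup>2 + 9 / 2 * a^4 * \<Lambda>\<^sup>2)) * (3 / 2 * \<Lambda> powr (2 - p)))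
        * norm (h - c) powr p"
proof -
  define e m where "e = c - clip \<Lambda> h" and "m = norm (c - clip \<Lambda> h)"
  define N where "N = norm (h - c) powr p"
  define X where "X = a * (e \<bullet> v) + a\<^sup>2 * m\<^sup>2"
  have D: "0 \<le> D" using assms norm_ge_zero order_trans by blast
  have "norm (clip \<Lambda> h) \<le> \<Lambda>" using assms by (simp add: norm_clip_le)
  then have m: "m \<le> 3 / 2 * \<Lambda>" "0 \<le> m"
    using norm_triangle_ineq4[of c "clip \<Lambda> h"] assms unfolding m_def by (linarith, simp)
  have ev: "\<bar>e \<bullet> v\<bar> \<le> m * D"
    using Cauchy_Schwarz_ineq2[of e v] assms mult_left_mono[of "norm v" D m] m
    by (simp add: e_def m_def)
  have m2: "m\<^sup>2 \<le> 3 / 2 * \<Lambda> powr (2 - p) * N"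
    unfolding m_def N_def using assms by (intro clip_error_sq_le)
  have m2': "m\<^sup>2 \<le> 9 / 4 * \<Lambda>\<^sup>2"
    using power_mono[OF m, of 2] by (simp add: power_mult_distrib power_divide)
  have aev: "\<bar>a * (e \<bullet> v)\<bar> \<le> a * m * D"
    using mult_left_mono[OF ev, of a] assms by (simp add: abs_mult mult.assoc)
  have "\<bar>X\<bar> \<le> 3 / 2 * a * \<Lambda> * D + 9 / 4 * a\<^sup>2 * \<Lambda>\<^sup>2"
  proof -
    have "\<bar>X\<bar> \<le> \<bar>a * (e \<bullet> v)\<bar> + \<bar>a\<^sup>2 * m\<^sup>2\<bar>"
      unfolding X_def by (rule abs_triangle_ineq)
    also have "\<bar>a * (e \<bullet> v)\<bar> \<le> a * (3 / 2 * \<Lambda>) * D"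
      using aev m D assms by (smt (verit) mult_left_mono mult_right_mono)
    also have "\<bar>a\<^sup>2 * m\<^sup>2\<bar> \<le> a\<^sup>2 * (9 / 4 * \<Lambda>\<^sup>2)"
      using mult_left_mono[OF m2', of "a\<^sup>2"] by simp
    finally show ?thesis by (simp add: algebra_simps)
  qed
  then have "l * \<bar>X\<bar> \<le> l * (3 / 2 * a * \<Lambda> * D + 9 / 4 * a\<^sup>2 * \<Lambda>\<^sup>2)"
    using assms by (intro mult_left_mono) auto
  then have lX: "\<bar>l * X\<bar> \<le> 1" using small assms by (simp add: abs_mult)
  have X1: "X \<le> a * ((c - h) \<bullet> v) + (2 * a * D * \<Lambda> powr (1 - p)) * N + a\<^sup>2 * m\<^sup>2"
  proof -
    have "e \<bullet> v = (c - h) \<bullet> v + (h - clip \<Lambda> h) \<bullet> v"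
      by (simp add: e_def inner_diff_left)
    also have "(h - clip \<Lambda> h) \<bullet> v \<le> norm (h - clip \<Lambda> h) * norm v" by (rule norm_cauchy_schwarz)
    also have "\<dots> \<le> (2 * \<Lambda> powr (1 - p) * N) * D"
      unfolding N_def using assms by (intro mult_mono clip_bias_le) auto
    finally have "a * (e \<bullet> v) \<le> a * ((c - h) \<bullet> v + (2 * \<Lambda> powr (1 - p) * N) * D)"
      using assms by (intro mult_left_mono) auto
    then show ?thesis by (simp add: X_def algebra_simps)
  qed
  have X2: "X\<^sup>2 \<le> (2 * a\<^sup>2 * D\<^sup>2 + 9 / 2 * a^4 * \<Lambda>\<^sup>2) * m\<^sup>2"
  proof -
    have "X\<^sup>2 \<le> 2 * (a * (e \<bullet> v))\<^sup>2 + 2 * (a\<^sup>2 * m\<^sup>2)\<^sup>2"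
      using zero_le_power2[of "a * (e \<bullet> v) - a\<^sup>2 * m\<^sup>2"]
      unfolding X_def power2_sum power2_diff by linarith
    also have "(a * (e \<bullet> v))\<^sup>2 \<le> (a * m * D)\<^sup>2"
      using power_mono[OF aev, of 2] by simp
    also have "(a\<^sup>2 * m\<^sup>2)\<^sup>2 \<le> a^4 * (9 / 4 * \<Lambda>\<^sup>2) * m\<^sup>2"
    proof -
      have "(a\<^sup>2 * m\<^sup>2)\<^sup>2 = a^4 * m\<^sup>2 * m\<^sup>2" by (simp add: power2_eq_square eval_nat_numeral)
      also have "\<dots> \<le> a^4 * (9 / 4 * \<Lambda>\<^sup>2) * m\<^sup>2"
        using m2' by (intro mult_right_mono mult_left_mono) auto
      finally show ?thesis .
    qed
    finally show ?thesis by (simp add: power_mult_distrib algebra_simps)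
  qed
  have "exp (l * X) \<le> 1 + l * X + (l * X)\<^sup>2" by (rule exp_le_quadratic[OF lX])
  also have "\<dots> = 1 + l * X + l\<^sup>2 * X\<^sup>2" by (simp add: power_mult_distrib)
  also have "l * X \<le> l * (a * ((c - h) \<bullet> v) + (2 * a * D * \<Lambda> powr (1 - p)) * N + a\<^sup>2 * m\<^sup>2)"
    using X1 assms by (intro mult_left_mono)
  also have "l\<^sup>2 * X\<^sup>2 \<le> l\<^sup>2 * ((2 * a\<^sup>2 * D\<^sup>2 + 9 / 2 * a^4 * \<Lambda>\<^sup>2) * m\<^sup>2)"
    using X2 by (intro mult_left_mono) auto
  finally have "exp (l * X) \<le> 1 + l * a * ((c - h) \<bullet> v) + 2 * l * a * D * \<Lambda> powr (1 - p) * N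
      + (l * a\<^sup>2 + l\<^sup>2 * (2 * a\<^sup>2 * D\<^sup>2 + 9 / 2 * a^4 * \<Lambda>\<^sup>2)) * m\<^sup>2"
    by (simp add: algebra_simps)
  also have "(l * a\<^sup>2 + l\<^sup>2 * (2 * a\<^sup>2 * D\<^sup>2 + 9 / 2 * a^4 * \<Lambda>\<^sup>2)) * m\<^sup>2
     \<le> (l * a\<^sup>2 + l\<^sup>2 * (2 * a\<^sup>2 * D\<^sup>2 + 9 / 2 * a^4 * \<Lambda>\<^sup>2)) * (3 / 2 * \<Lambda> powr (2 - p) * N)"
    using m2 assms by (intro mult_left_mono) auto
  finally show ?thesis
    by (simp add: X_def e_def m_def N_def algebra_simps)
qed

text \<open>Integrate \<open>clipped_step_pointwise\<close> against the weight \<open>W\<close> of the past: the linear term vanishes and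
  the moment bound turns the rest into a factor \<open>1 + \<kappa> \<le> exp \<kappa>\<close>. The bound on \<open>v\<close> is only asked for
  where \<open>W\<close> does not vanish, because \<open>v\<close> is uncontrolled beyond the barrier.\<close>

lemma clipped_step_exp_moment:
  fixes h c v :: "'w \<Rightarrow> 'a::euclidean_space" and W :: "'w \<Rightarrow> real"
  assumes M: "prob_space M" "subalgebra M F"
    and W: "W \<in> borel_measurable F" "\<And>\<omega>. 0 \<le> W \<omega>" "\<And>\<omega>. W \<omega> \<le> 1"
    and v: "v \<in> borel_measurable F" "\<And>\<omega>. W \<omega> \<noteq> 0 \<Longrightarrow> norm (v \<omega>) \<le> D"
    and c: "c \<in> borel_measurable M" "\<And>\<omega>. norm (c \<omega>) \<le> \<Lambda> / 2"
    and h: "h \<in> borel_measurable M"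
    and unb: "AE \<omega> in M. vec_cond_exp M F h \<omega> = c \<omega>"
    and mom: "AE \<omega> in M. nn_cond_exp M F (\<lambda>\<omega>. ennreal (norm (h \<omega> - c \<omega>) powr p)) \<omega> \<le> ennreal s"
    and par: "0 \<le> s" "1 < p" "p \<le> 2" "0 \<le> l" "0 \<le> a" "0 \<le> D" "0 \<le> \<Lambda>" "0 \<le> \<kappa>"
    and small: "l * (3 / 2 * a * \<Lambda> * D + 9 / 4 * a\<^sup>2 * \<Lambda>\<^sup>2) \<le> 1"
    and rate: "(2 * l * a * D * \<Lambda> powr (1 - p)
         + (l * a\<^sup>2 + l\<^sup>2 * (2 * a\<^sup>2 * D\<^sup>2 + 9 / 2 * a^4 * \<Lambda>\<^sup>2)) * (3 / 2 * \<Lambda> powr (2 - p))) * s \<le> \<kappa>"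
  defines "X \<equiv> \<lambda>\<omega>. l * (a * ((c \<omega> - clip \<Lambda> (h \<omega>)) \<bullet> v \<omega>) + a\<^sup>2 * (norm (c \<omega> - clip \<Lambda> (h \<omega>)))\<^sup>2)"
  shows "integrable M (\<lambda>\<omega>. W \<omega> * exp (X \<omega>))"
    and "(\<integral>\<omega>. W \<omega> * exp (X \<omega>) \<partial>M) \<le> exp \<kappa> * (\<integral>\<omega>. W \<omega> \<partial>M)"
proof -
  interpret prob_space M by fact
  interpret finite_measure_subalgebra M F by unfold_locales fact
  note [measurable] = clip_borel_measurable[OF \<open>0 \<le> \<Lambda>\<close>]
  have [measurable]: "W \<in> borel_measurable M" "v \<in> borel_measurable M" "c \<in> borel_measurable M"
    "h \<in> borel_measurable M" "W \<in> borel_measurable F" "v \<in> borel_measurable F"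
    using W v c h measurable_from_subalg[OF M(2)] by auto
  have Xm [measurable]: "X \<in> borel_measurable M" unfolding X_def by measurable
  have W_int: "integrable M W"
    by (rule integrable_const_bound[where B = 1]) (use W in auto)
  have W0: "0 \<le> (\<integral>\<omega>. W \<omega> \<partial>M)" using W by (intro Bochner_Integration.integral_nonneg) auto
  have "integrable M (\<lambda>\<omega>. W \<omega> * exp (X \<omega>)) \<and> (\<integral>\<omega>. W \<omega> * exp (X \<omega>) \<partial>M) \<le> exp \<kappa> * (\<integral>\<omega>. W \<omega> \<partial>M)"
  proof (cases "\<Lambda> = 0")
    case True
    \<comment> \<open>The powers of \<open>\<Lambda>\<close> are useless here, but mean and clipped answer both vanish.\<close>
    then have "X \<omega> = 0" for \<omega> using c(2)[of \<omega>] by (simp add: X_def clip_def)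
    moreover have "1 * (\<integral>\<omega>. W \<omega> \<partial>M) \<le> exp \<kappa> * (\<integral>\<omega>. W \<omega> \<partial>M)"
      using W0 par by (intro mult_right_mono) auto
    ultimately show ?thesis using W_int by simp
  next
    case False
    then have L: "0 < \<Lambda>" using par by simp
    define N where "N = (\<lambda>\<omega>. norm (h \<omega> - c \<omega>) powr p)"
    define k where "k = 2 * l * a * D * \<Lambda> powr (1 - p)
         + (l * a\<^sup>2 + l\<^sup>2 * (2 * a\<^sup>2 * D\<^sup>2 + 9 / 2 * a^4 * \<Lambda>\<^sup>2)) * (3 / 2 * \<Lambda> powr (2 - p))"
    have k: "0 \<le> k" unfolding k_def using par by (intro add_nonneg_nonneg mult_nonneg_nonneg) auto
    have Nm [measurable]: "N \<in> borel_measurable M" unfolding N_def by measurable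
    note mm = integrable_and_moment_of_cond_bound[OF M Nm, where s = s]
    have Nint: "integrable M N"
      using mm(1)[of "\<lambda>_. 1"] mom par by (simp add: N_def)
    have WN: "integrable M (\<lambda>\<omega>. W \<omega> * N \<omega>)" "(\<integral>\<omega>. W \<omega> * N \<omega> \<partial>M) \<le> s * (\<integral>\<omega>. W \<omega> \<partial>M)"
      using mm[of W] W mom par by (auto simp: N_def)
    have hint: "integrable M h"
    proof (rule Bochner_Integration.integrable_bound)
      show "integrable M (\<lambda>\<omega>. \<Lambda> / 2 + 1 + N \<omega>)" using Nint by simp
      show "AE \<omega> in M. norm (h \<omega>) \<le> norm (\<Lambda> / 2 + 1 + N \<omega>)"
      proof (rule AE_I2)
        fix \<omega>
        define n where "n = norm (h \<omega> - c \<omega>)"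
        have "n \<le> 1 + n powr p"
        proof (cases "n \<le> 1")
          case False
          then have "n powr 1 \<le> n powr p" using par by (intro powr_mono) auto
          then show ?thesis using False by simp
        qed (simp add: add_increasing2)
        moreover have "norm (h \<omega>) \<le> n + norm (c \<omega>)"
          unfolding n_def using norm_triangle_sub by (simp add: norm_triangle_sub add.commute)
        ultimately show "norm (h \<omega>) \<le> norm (\<Lambda> / 2 + 1 + N \<omega>)"
          using c(2)[of \<omega>] by (simp add: N_def n_def)
      qed
    qed measurable
    have bias: "integrable M (\<lambda>\<omega>. (c \<omega> - h \<omega>) \<bullet> (W \<omega> *\<^sub>R v \<omega>))"
      "(\<integral>\<omega>. (c \<omega> - h \<omega>) \<bullet> (W \<omega> *\<^sub>R v \<omega>) \<partial>M) = 0"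
    proof -
      have "norm (W \<omega> *\<^sub>R v \<omega>) \<le> D" for \<omega>
      proof (cases "W \<omega> = 0")
        case False
        then have "W \<omega> * norm (v \<omega>) \<le> 1 * D" using W v by (intro mult_mono) auto
        then show ?thesis using W by simp
      qed (use par in simp)
      then show "integrable M (\<lambda>\<omega>. (c \<omega> - h \<omega>) \<bullet> (W \<omega> *\<^sub>R v \<omega>))"
        "(\<integral>\<omega>. (c \<omega> - h \<omega>) \<bullet> (W \<omega> *\<^sub>R v \<omega>) \<partial>M) = 0"
        using unbiased_inner_integral[OF M hint c, of "\<lambda>\<omega>. W \<omega> *\<^sub>R v \<omega>" D] unb by auto
    qed
    define B where "B = (\<lambda>\<omega>. W \<omega> + l * a * ((c \<omega> - h \<omega>) \<bullet> (W \<omega> *\<^sub>R v \<omega>)) + k * (W \<omega> * N \<omega>))"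
    have Bint: "integrable M B" unfolding B_def using W_int bias WN by simp
    have le: "W \<omega> * exp (X \<omega>) \<le> B \<omega>" for \<omega>
    proof (cases "W \<omega> = 0")
      case True
      then show ?thesis by (simp add: B_def)
    next
      case False
      have "exp (X \<omega>) \<le> 1 + l * a * ((c \<omega> - h \<omega>) \<bullet> v \<omega>) + k * N \<omega>"
        unfolding X_def k_def N_def
        using clipped_step_pointwise[OF L c(2)[of \<omega>] par(2-5) v(2)[OF False] small, of "h \<omega>"] .
      then have "W \<omega> * exp (X \<omega>) \<le> W \<omega> * (1 + l * a * ((c \<omega> - h \<omega>) \<bullet> v \<omega>) + k * N \<omega>)"
        using W by (intro mult_left_mono) auto
      then show ?thesis by (simp add: B_def algebra_simps)
    qed
    have int: "integrable M (\<lambda>\<omega>. W \<omega> * exp (X \<omega>))"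
    proof (rule Bochner_Integration.integrable_bound[OF Bint])
      show "AE \<omega> in M. norm (W \<omega> * exp (X \<omega>)) \<le> norm (B \<omega>)"
        using le W by (intro AE_I2) (smt (verit) real_norm_def mult_nonneg_nonneg exp_ge_zero)
    qed measurable
    have "(\<integral>\<omega>. W \<omega> * exp (X \<omega>) \<partial>M) \<le> (\<integral>\<omega>. B \<omega> \<partial>M)"
      using int Bint le by (intro integral_mono) auto
    also have "\<dots> = (\<integral>\<omega>. W \<omega> \<partial>M) + k * (\<integral>\<omega>. W \<omega> * N \<omega> \<partial>M)"
      unfolding B_def using W_int bias WN by simp
    also have "\<dots> \<le> (\<integral>\<omega>. W \<omega> \<partial>M) + k * (s * (\<integral>\<omega>. W \<omega> \<partial>M))"
      using WN k by (intro add_left_mono mult_left_mono)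
    also have "\<dots> = (1 + k * s) * (\<integral>\<omega>. W \<omega> \<partial>M)" by (simp add: algebra_simps)
    also have "\<dots> \<le> exp \<kappa> * (\<integral>\<omega>. W \<omega> \<partial>M)"
    proof (rule mult_right_mono[OF _ W0])
      have "1 + k * s \<le> 1 + \<kappa>" using rate by (simp add: k_def)
      also have "\<dots> \<le> exp \<kappa>" by (rule exp_ge_add_one_self)
      finally show "1 + k * s \<le> exp \<kappa>" .
    qed
    finally show ?thesis using int by simp
  qed
  then show "integrable M (\<lambda>\<omega>. W \<omega> * exp (X \<omega>))"
    and "(\<integral>\<omega>. W \<omega> * exp (X \<omega>) \<partial>M) \<le> exp \<kappa> * (\<integral>\<omega>. W \<omega> \<partial>M)" by auto
qed


section \<open>Iterates, samples and filtrations\<close>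

lemma phase_iter_count [simp]: "snd (snd (phase_iter Q a A0 \<Lambda> orc w k0 t)) = k0 + t"
proof (induction t)
  case (Suc t)
  obtain y z k where "phase_iter Q a A0 \<Lambda> orc w k0 t = (y, z, k)" by (rule prod_cases3)
  then show ?case using Suc.IH by (simp add: Let_def del: of_nat_Suc)
qed simp

lemma phase_iter_Suc_proj:
  fixes Q :: "'a::euclidean_space set" and a A0 \<Lambda> :: real and orc w k0
  defines "Y \<equiv> \<lambda>t. fst (phase_iter Q a A0 \<Lambda> orc w k0 t)"
    and "Z \<equiv> \<lambda>t. fst (snd (phase_iter Q a A0 \<Lambda> orc w k0 t))"
    and "A \<equiv> \<lambda>t. A0 + real t * a"
  defines "U \<equiv> \<lambda>t. (A t *\<^sub>R Y t + a *\<^sub>R Z t) /\<^sub>R (A t + a)"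
  shows "Z (Suc t) = closest_point Q (Z t - a *\<^sub>R clip \<Lambda> (orc (Suc (k0 + t)) (U t)))"
    and "Y (Suc t) = (A t *\<^sub>R Y t + a *\<^sub>R Z (Suc t)) /\<^sub>R (A t + a)"
proof -
  obtain y z where st: "phase_iter Q a A0 \<Lambda> orc w k0 t = (y, z, k0 + t)"
    by (metis phase_iter_count prod.collapse)
  have A: "A0 + real (Suc t) * a = A0 + real t * a + a" by (simp add: distrib_right)
  show "Z (Suc t) = closest_point Q (Z t - a *\<^sub>R clip \<Lambda> (orc (Suc (k0 + t)) (U t)))"
    "Y (Suc t) = (A t *\<^sub>R Y t + a *\<^sub>R Z (Suc t)) /\<^sub>R (A t + a)"
    unfolding Y_def Z_def U_def A_def by (simp_all only: phase_iter.simps st Let_def case_prod_conv fst_conv snd_conv A)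
qed

lemma phase_iter_in_set:
  fixes Q :: "'a::euclidean_space set"
  assumes Q: "closed Q" "convex Q" "w \<in> Q" and pos: "0 \<le> a" "0 < A0"
  shows "fst (phase_iter Q a A0 \<Lambda> orc w k0 t) \<in> Q \<and> fst (snd (phase_iter Q a A0 \<Lambda> orc w k0 t)) \<in> Q"
proof (induction t)
  case 0
  then show ?case using Q by simp
next
  case (Suc t)
  let ?Y = "fst (phase_iter Q a A0 \<Lambda> orc w k0 t)"
  let ?Z' = "fst (snd (phase_iter Q a A0 \<Lambda> orc w k0 (Suc t)))"
  have Z': "?Z' \<in> Q"
    by (subst phase_iter_Suc_proj(1), rule closest_point_in_set) (use Q in auto)
  define A where "A = A0 + real t * a"
  have A: "0 < A" using pos by (simp add: A_def add_pos_nonneg)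
  have "(A / (A + a)) *\<^sub>R ?Y + (a / (A + a)) *\<^sub>R ?Z' \<in> Q"
  proof (rule convexD[OF Q(2)])
    show "A / (A + a) + a / (A + a) = 1" using A pos by (simp flip: add_divide_distrib)
  qed (use Suc.IH Z' A pos in auto)
  also have "(A / (A + a)) *\<^sub>R ?Y + (a / (A + a)) *\<^sub>R ?Z' = (A *\<^sub>R ?Y + a *\<^sub>R ?Z') /\<^sub>R (A + a)"
    by (simp only: scaleR_right_distrib scaleR_scaleR divide_inverse_commute)
  also have "\<dots> = fst (phase_iter Q a A0 \<Lambda> orc w k0 (Suc t))"
    unfolding A_def by (rule phase_iter_Suc_proj(2)[symmetric])
  finally show ?case using Z' by blast
qed

locale sampled_objective = smooth_convex_objective f grad xstar \<mu> H0 H1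
  for f :: "'a::euclidean_space \<Rightarrow> real" and grad xstar \<mu> H0 H1 +
  fixes M :: "'w measure" and E :: "'e measure" and \<xi> :: "nat \<Rightarrow> 'w \<Rightarrow> 'e"
    and g :: "'a \<Rightarrow> 'e \<Rightarrow> 'a" and p \<alpha> \<tau> :: real
  assumes sampling: "stochastic_oracle M E \<xi> g f grad p \<alpha> \<tau>"
    and p: "1 < p" "p \<le> 2" and \<alpha>: "0 \<le> \<alpha>"
begin

abbreviation Fil :: "nat \<Rightarrow> 'w measure" where
  "Fil \<equiv> sample_filtration M E \<xi>"

sublocale prob_space M
  using sampling by (simp add: stochastic_oracle_def)

lemma space_Fil [simp]: "space (Fil k) = space M"
  unfolding sample_filtration_def by (intro space_measure_of) auto

lemma sets_Fil:
  "sets (Fil k) = sigma_sets (space M) {\<xi> i -` B \<inter> space M | i B. i \<in> {1..k} \<and> B \<in> sets E}"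
  unfolding sample_filtration_def by (intro sets_measure_of) auto

lemma Fil_subalgebra: "subalgebra M (Fil k)"
proof -
  have "\<xi> i -` B \<inter> space M \<in> sets M" if "1 \<le> i" "B \<in> sets E" for i B
    using sampling that by (auto simp: stochastic_oracle_def intro: measurable_sets)
  then show ?thesis
    unfolding subalgebra_def sets_Fil by (auto intro!: sets.sigma_sets_subset)
qed

lemma Fil_mono:
  assumes "j \<le> k"
  shows "subalgebra (Fil k) (Fil j)"
proof -
  have "{\<xi> i -` B \<inter> space M | i B. i \<in> {1..j} \<and> B \<in> sets E}
      \<subseteq> {\<xi> i -` B \<inter> space M | i B. i \<in> {1..k} \<and> B \<in> sets E}"
    using assms by fastforce
  from sigma_sets_mono'[OF this] show ?thesis
    by (simp add: subalgebra_def sets_Fil)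
qed

lemma measurable_Fil_mono: "X \<in> measurable (Fil j) N \<Longrightarrow> j \<le> k \<Longrightarrow> X \<in> measurable (Fil k) N"
  using Fil_mono measurable_from_subalg by blast

lemma measurable_Fil_M: "X \<in> measurable (Fil j) N \<Longrightarrow> X \<in> measurable M N"
  using Fil_subalgebra measurable_from_subalg by blast

lemma sample_measurable_Fil:
  assumes "1 \<le> i" "i \<le> k"
  shows "\<xi> i \<in> measurable (Fil k) E"
proof (rule measurableI)
  show "\<xi> i \<omega> \<in> space E" if "\<omega> \<in> space (Fil k)" for \<omega>
    using sampling that assms by (auto simp: stochastic_oracle_def dest: measurable_space)
  show "\<xi> i -` B \<inter> space (Fil k) \<in> sets (Fil k)" if "B \<in> sets E" for B
    unfolding sets_Fil space_Fil using that assms by (intro sigma_sets.Basic) auto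
qed

lemma answer_measurable_Fil:
  assumes "x \<in> borel_measurable (Fil k)"
  shows "(\<lambda>\<omega>. g (x \<omega>) (\<xi> (Suc k) \<omega>)) \<in> borel_measurable (Fil (Suc k))"
proof -
  have [measurable]: "x \<in> borel_measurable (Fil (Suc k))" "\<xi> (Suc k) \<in> measurable (Fil (Suc k)) E"
    using assms by (auto intro: measurable_Fil_mono sample_measurable_Fil)
  have [measurable]: "(\<lambda>(x, e). g x e) \<in> borel_measurable (borel \<Otimes>\<^sub>M E)"
    using sampling by (simp add: stochastic_oracle_def)
  have "(\<lambda>\<omega>. (\<lambda>(x, e). g x e) (x \<omega>, \<xi> (Suc k) \<omega>)) \<in> borel_measurable (Fil (Suc k))"
    by measurable
  then show ?thesis by simp
qed

lemma noise_pow_nonneg: "0 \<le> noise_pow p \<alpha> \<tau> \<Delta>"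
  by (simp add: noise_pow_def)

text \<open>The gap condition is asked for at every sample point. A query whose gap is controlled only on an
  event of the past must be replaced by a fixed good point outside of that event.\<close>

lemma answer_cond_exp:
  assumes x: "x \<in> borel_measurable (Fil k)" and gap: "\<And>\<omega>. gap f (x \<omega>) \<le> 4 * \<Delta>" and "0 < \<Delta>"
  shows "AE \<omega> in M. vec_cond_exp M (Fil k) (\<lambda>\<omega>. g (x \<omega>) (\<xi> (Suc k) \<omega>)) \<omega> = grad (x \<omega>)"
    and "AE \<omega> in M. nn_cond_exp M (Fil k)
           (\<lambda>\<omega>. ennreal (norm (g (x \<omega>) (\<xi> (Suc k) \<omega>) - grad (x \<omega>)) powr p)) \<omega>
         \<le> ennreal (noise_pow p \<alpha> \<tau> \<Delta>)"
proof -
  have "\<forall>t\<ge>1. \<forall>x \<in> borel_measurable (Fil (t - 1)).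
        (AE \<omega> in M. vec_cond_exp M (Fil (t - 1)) (\<lambda>\<omega>. g (x \<omega>) (\<xi> t \<omega>)) \<omega> = grad (x \<omega>)) \<and>
        (AE \<omega> in M. nn_cond_exp M (Fil (t - 1))
                        (\<lambda>\<omega>. ennreal (norm (g (x \<omega>) (\<xi> t \<omega>) - grad (x \<omega>)) powr p)) \<omega>
                     \<le> ennreal (\<tau> powr p * rpow (gap f (x \<omega>)) \<alpha>))"
    using sampling unfolding stochastic_oracle_def by blast
  from this[rule_format, of "Suc k" x] x
  have *: "AE \<omega> in M. vec_cond_exp M (Fil k) (\<lambda>\<omega>. g (x \<omega>) (\<xi> (Suc k) \<omega>)) \<omega> = grad (x \<omega>)"
    "AE \<omega> in M. nn_cond_exp M (Fil k)
           (\<lambda>\<omega>. ennreal (norm (g (x \<omega>) (\<xi> (Suc k) \<omega>) - grad (x \<omega>)) powr p)) \<omega>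
         \<le> ennreal (\<tau> powr p * rpow (gap f (x \<omega>)) \<alpha>)" by auto
  have "rpow (gap f (x \<omega>)) \<alpha> \<le> (4 * \<Delta>) powr \<alpha>" for \<omega>
    using gap[of \<omega>] gap_nonneg[of "x \<omega>"] \<open>0 < \<Delta>\<close> \<alpha> by (auto simp: rpow_def intro: powr_mono2)
  then have "\<tau> powr p * rpow (gap f (x \<omega>)) \<alpha> \<le> noise_pow p \<alpha> \<tau> \<Delta>" for \<omega>
    unfolding noise_pow_def by (intro mult_left_mono) auto
  then show "AE \<omega> in M. nn_cond_exp M (Fil k)
           (\<lambda>\<omega>. ennreal (norm (g (x \<omega>) (\<xi> (Suc k) \<omega>) - grad (x \<omega>)) powr p)) \<omega>
         \<le> ennreal (noise_pow p \<alpha> \<tau> \<Delta>)"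
    using *(2) by (elim eventually_mono) (meson ennreal_leI order_trans)
  show "AE \<omega> in M. vec_cond_exp M (Fil k) (\<lambda>\<omega>. g (x \<omega>) (\<xi> (Suc k) \<omega>)) \<omega> = grad (x \<omega>)" by (rule *(1))
qed

end


section \<open>One phase\<close>

text \<open>The second entry in the maximum defining the clipping level is the solution \<open>\<Lambda>\<close> of
  \<open>\<nu> \<Delta> = \<Lambda> powr (p - 1) * \<Delta> / (64 * D)\<close>. If \<open>\<Lambda> = 0\<close>, both left-hand sides are 0 since
  \<open>0 powr x = 0\<close>.\<close>

lemma noise_le_clip_level:
  fixes p \<Delta> D H0 H1 :: real and \<nu> :: "real \<Rightarrow> real"
  assumes "1 < p" "0 < \<Delta>" "0 < D" "0 \<le> \<nu> \<Delta>" "0 \<le> H0" "0 \<le> H1"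
  defines "\<Lambda> \<equiv> clip_level H0 H1 p \<nu> \<Delta> D"
  shows "\<Lambda> powr (1 - p) * \<nu> \<Delta> \<le> \<Delta> / (64 * D)" "\<Lambda> powr (2 - p) * \<nu> \<Delta> \<le> \<Lambda> * \<Delta> / (64 * D)"
proof -
  have L: "0 \<le> \<Lambda>" using G_level_nonneg[of H0 H1 \<Delta>] assms by (simp add: clip_level_def le_max_iff_disj)
  define x where "x = 64 * \<nu> \<Delta> * D / \<Delta>"
  have x: "0 \<le> x" using assms by (simp add: x_def)
  have "x powr (1 / (p - 1)) \<le> \<Lambda>" by (simp add: \<Lambda>_def clip_level_def x_def)
  then have "(x powr (1 / (p - 1))) powr (p - 1) \<le> \<Lambda> powr (p - 1)"
    using assms by (intro powr_mono2) auto
  then have xL: "x \<le> \<Lambda> powr (p - 1)" using assms x by (simp add: powr_powr)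
  have nu: "\<nu> \<Delta> = x * (\<Delta> / (64 * D))" using assms by (simp add: x_def)
  have one: "\<Lambda> powr (1 - p) * x \<le> 1"
  proof (cases "\<Lambda> = 0")
    case False
    then have "\<Lambda> powr (1 - p) * x \<le> \<Lambda> powr (1 - p) * \<Lambda> powr (p - 1)"
      using xL by (intro mult_left_mono) auto
    also have "\<dots> = 1" using False L by (simp flip: powr_add)
    finally show ?thesis .
  qed simp
  have "\<Lambda> powr (1 - p) * x * (\<Delta> / (64 * D)) \<le> 1 * (\<Delta> / (64 * D))"
    using one assms by (intro mult_right_mono) auto
  then show *: "\<Lambda> powr (1 - p) * \<nu> \<Delta> \<le> \<Delta> / (64 * D)"
    unfolding nu by (simp add: mult.assoc)
  have "\<Lambda> powr (2 - p) = \<Lambda> * \<Lambda> powr (1 - p)"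
  proof (cases "\<Lambda> = 0")
    case False
    then have "\<Lambda> powr 1 * \<Lambda> powr (1 - p) = \<Lambda> powr (2 - p)"
      unfolding powr_add[symmetric] by simp
    then show ?thesis using L by simp
  qed simp
  then show "\<Lambda> powr (2 - p) * \<nu> \<Delta> \<le> \<Lambda> * \<Delta> / (64 * D)"
    using mult_left_mono[OF * L] by (simp add: mult.assoc)
qed

lemma ln_conf_ge_2:
  fixes \<rho> :: real
  assumes "0 < \<rho>" "\<rho> \<le> 1"
  shows "2 \<le> ln (8 / \<rho>)"
proof -
  have "ln (8::real) = 3 * ln 2" using ln_realpow[of "2::real" 3] by simp
  then have "2 \<le> ln (8::real)" using ln2_ge_two_thirds by simp
  also have "\<dots> \<le> ln (8 / \<rho>)" using assms by (subst ln_le_cancel_iff) (auto simp: field_simps)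
  finally show ?thesis .
qed

lemma phase_len_ge:
  fixes p \<Delta> D H0 H1 \<rho> :: real and \<nu> :: "real \<Rightarrow> real"
  assumes "0 < \<rho>" "\<rho> \<le> 1" "0 < \<Delta>" "0 < D" "0 \<le> H0" "0 \<le> H1"
  defines "\<Lambda> \<equiv> clip_level H0 H1 p \<nu> \<Delta> D" and "T \<equiv> real (phase_len H0 H1 p \<nu> \<Delta> D \<rho>)"
    and "\<theta> \<equiv> ln (8 / \<rho>)"
  shows "1024 * \<theta> \<le> T" "D * \<Lambda> * \<theta> * 1024 \<le> \<Delta> * T"
proof -
  have l: "2 \<le> \<theta>" unfolding \<theta>_def by (rule ln_conf_ge_2[OF assms(1,2)])
  have L: "0 \<le> \<Lambda>" using G_level_nonneg[of H0 H1 \<Delta>] assms by (simp add: clip_level_def le_max_iff_disj)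
  have T: "1024 * (1 + D * \<Lambda> / \<Delta>) * \<theta> \<le> T"
    unfolding T_def phase_len_def \<Lambda>_def \<theta>_def by (rule real_nat_ceiling_ge)
  have R: "0 \<le> D * \<Lambda> / \<Delta> * \<theta>" using L l assms by simp
  have eq: "1024 * (1 + D * \<Lambda> / \<Delta>) * \<theta> = 1024 * \<theta> + 1024 * (D * \<Lambda> / \<Delta> * \<theta>)"
    by (simp add: distrib_left distrib_right)
  show "1024 * \<theta> \<le> T" using T R eq by linarith
  have "1024 * (D * \<Lambda> / \<Delta> * \<theta>) \<le> T" using T l eq by linarith
  then have "\<Delta> * (1024 * (D * \<Lambda> / \<Delta> * \<theta>)) \<le> \<Delta> * T" using assms by (intro mult_left_mono) auto
  then show "D * \<Lambda> * \<theta> * 1024 \<le> \<Delta> * T" using assms by (simp add: field_simps)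
qed

text \<open>The two side conditions of \<open>clipped_step_exp_moment\<close> for the parameters of a phase. Everything is
  expressed through \<open>x = D \<Lambda> \<theta> / (\<Delta> T) \<le> 1 / 1024\<close>; the bias contributes \<open>10/64 \<theta> / T\<close>, and the second
  moments are of order \<open>x \<theta> / T\<close>.\<close>

lemma phase_rates:
  fixes \<Lambda> \<Delta> D T \<theta> :: real
  assumes pos: "0 < \<Delta>" "0 < D" "0 \<le> \<Lambda>" "2 \<le> \<theta>" and T: "1024 * \<theta> \<le> T" "D * \<Lambda> * \<theta> * 1024 \<le> \<Delta> * T"
    and s: "\<Lambda> powr (1 - p) * s \<le> \<Delta> / (64 * D)" "\<Lambda> powr (2 - p) * s \<le> \<Lambda> * \<Delta> / (64 * D)"
  defines "l \<equiv> \<theta> / D\<^sup>2" and "a \<equiv> 5 * D\<^sup>2 / (\<Delta> * T)"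
  shows "l * (3 / 2 * a * \<Lambda> * D + 9 / 4 * a\<^sup>2 * \<Lambda>\<^sup>2) \<le> 1"
    and "(2 * l * a * D * \<Lambda> powr (1 - p)
         + (l * a\<^sup>2 + l\<^sup>2 * (2 * a\<^sup>2 * D\<^sup>2 + 9 / 2 * a^4 * \<Lambda>\<^sup>2)) * (3 / 2 * \<Lambda> powr (2 - p))) * s
      \<le> \<theta> / (4 * T)"
proof -
  have T0: "0 < T" using T pos by linarith
  define x where "x = D * \<Lambda> * \<theta> / (\<Delta> * T)"
  have x: "0 \<le> x" "x \<le> 1 / 1024"
    using pos T T0 by (auto simp: x_def field_simps)
  have xx: "x\<^sup>2 \<le> x / 1024" using mult_left_mono[OF x(2) x(1)] by (simp add: power2_eq_square)
  have aL: "a * \<Lambda> = 5 * D * x / \<theta>"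
    using pos T0 by (simp add: a_def x_def power2_eq_square)
  have l0: "0 \<le> l" "0 \<le> a" using pos T0 by (auto simp: l_def a_def)
  have e1: "l * (a * \<Lambda> * D) = 5 * x" unfolding aL using pos by (simp add: l_def power2_eq_square)
  have e2: "l * (a * \<Lambda>)\<^sup>2 = 25 * x\<^sup>2 / \<theta>"
    unfolding aL using pos by (simp add: l_def power_mult_distrib power_divide) (simp add: power2_eq_square)
  have "25 * x\<^sup>2 / \<theta> \<le> 25 * x\<^sup>2 / 1" using pos by (intro divide_left_mono) auto
  then show "l * (3 / 2 * a * \<Lambda> * D + 9 / 4 * a\<^sup>2 * \<Lambda>\<^sup>2) \<le> 1"
    using e1 e2 x xx by (simp add: algebra_simps power_mult_distrib)
  have t1: "l * a * D * (\<Delta> / (64 * D)) = 5 / 64 * (\<theta> / T)"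
    using pos T0 by (simp add: l_def a_def power2_eq_square)
  have t2: "l * a\<^sup>2 * (\<Lambda> * \<Delta> / (64 * D)) = 25 / 64 * x / T"
  proof -
    have "l * a\<^sup>2 * (\<Lambda> * \<Delta> / (64 * D)) = l * a * (a * \<Lambda>) * (\<Delta> / (64 * D))"
      by (simp add: power2_eq_square)
    then show ?thesis unfolding aL using pos T0 by (simp add: l_def a_def power2_eq_square)
  qed
  have t3: "2 * a\<^sup>2 * D\<^sup>2 + 9 / 2 * a^4 * \<Lambda>\<^sup>2 \<le> 3 * a\<^sup>2 * D\<^sup>2"
  proof -
    have "(a * \<Lambda>)\<^sup>2 \<le> (D / 100)\<^sup>2"
    proof (intro power_mono)
      have "5 * D * x / \<theta> \<le> 5 * D * x / 1" using pos x by (intro divide_left_mono) auto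
      also have "\<dots> \<le> D / 100" using x pos mult_left_mono[of x "1/1024" D] by simp
      finally show "a * \<Lambda> \<le> D / 100" unfolding aL .
    qed (use l0 pos in auto)
    also have "(D / 100)\<^sup>2 = D\<^sup>2 / 10000" by (simp add: power_divide)
    finally have "9 / 2 * (a * \<Lambda>)\<^sup>2 \<le> D\<^sup>2" using zero_le_power2[of D] by linarith
    then have "a\<^sup>2 * (9 / 2 * (a * \<Lambda>)\<^sup>2) \<le> a\<^sup>2 * D\<^sup>2"
      by (intro mult_left_mono) auto
    then show ?thesis by (simp add: power_mult_distrib power2_eq_square eval_nat_numeral algebra_simps)
  qed
  have "(2 * l * a * D * \<Lambda> powr (1 - p)
         + (l * a\<^sup>2 + l\<^sup>2 * (2 * a\<^sup>2 * D\<^sup>2 + 9 / 2 * a^4 * \<Lambda>\<^sup>2)) * (3 / 2 * \<Lambda> powr (2 - p))) * s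
    = 2 * l * a * D * (\<Lambda> powr (1 - p) * s)
       + (l * a\<^sup>2 + l\<^sup>2 * (2 * a\<^sup>2 * D\<^sup>2 + 9 / 2 * a^4 * \<Lambda>\<^sup>2)) * (3 / 2 * (\<Lambda> powr (2 - p) * s))"
    by (simp add: algebra_simps)
  also have "\<dots> \<le> 2 * l * a * D * (\<Delta> / (64 * D))
       + (l * a\<^sup>2 + l\<^sup>2 * (2 * a\<^sup>2 * D\<^sup>2 + 9 / 2 * a^4 * \<Lambda>\<^sup>2)) * (3 / 2 * (\<Lambda> * \<Delta> / (64 * D)))"
    using s l0 pos by (intro add_mono mult_left_mono) auto
  also have "\<dots> \<le> 2 * l * a * D * (\<Delta> / (64 * D))
       + (l * a\<^sup>2 + l\<^sup>2 * (3 * a\<^sup>2 * D\<^sup>2)) * (3 / 2 * (\<Lambda> * \<Delta> / (64 * D)))"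
    using t3 l0 pos by (intro add_left_mono mult_right_mono mult_left_mono) auto
  also have "\<dots> = 2 * (l * a * D * (\<Delta> / (64 * D)))
       + 3 / 2 * (1 + 3 * l * D\<^sup>2) * (l * a\<^sup>2 * (\<Lambda> * \<Delta> / (64 * D)))"
    by (simp add: algebra_simps power2_eq_square)
  also have "\<dots> = 10 / 64 * (\<theta> / T) + 3 / 2 * (1 + 3 * \<theta>) * (25 / 64 * x / T)"
    unfolding t1 t2 using pos by (simp add: l_def)
  also have "\<dots> \<le> 10 / 64 * (\<theta> / T) + 3 / 2 * (4 * \<theta>) * (25 / 64 * (1 / 1024) / T)"
    using x pos T0 by (intro add_left_mono mult_mono divide_right_mono) auto
  also have "\<dots> \<le> \<theta> / (4 * T)" using pos T0 by (simp add: field_simps)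
  finally show "(2 * l * a * D * \<Lambda> powr (1 - p)
         + (l * a\<^sup>2 + l\<^sup>2 * (2 * a\<^sup>2 * D\<^sup>2 + 9 / 2 * a^4 * \<Lambda>\<^sup>2)) * (3 / 2 * \<Lambda> powr (2 - p))) * s
      \<le> \<theta> / (4 * T)" .
qed

text \<open>One phase started after \<open>k0\<close> calls at a random point. The auxiliary set is required to be
  suitable only where the phase starts with the promised gap: in the strongly convex case the ball
  need not contain the minimizer otherwise.\<close>

locale phase_run = sampled_objective f grad xstar \<mu> H0 H1 M E \<xi> g p \<alpha> \<tau>
  for f :: "'a::euclidean_space \<Rightarrow> real" and grad xstar \<mu> H0 H1
    and M :: "'w measure" and E :: "'e measure" and \<xi> g p \<alpha> \<tau> +
  fixes k0 :: nat and w :: "'w \<Rightarrow> 'a" and Qs :: "'a \<Rightarrow> 'a set" and \<Delta> D \<rho> :: real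
  assumes start_measurable: "w \<in> borel_measurable (Fil k0)"
    and projection_measurable: "(\<lambda>(x, v). closest_point (Qs x) v) \<in> borel_measurable (borel \<Otimes>\<^sub>M borel)"
    and phase_pos: "0 < \<Delta>" "0 < D" "0 < \<rho>" "\<rho> \<le> 1"
    and auxiliary_set: "\<And>\<omega>. \<omega> \<in> space M \<Longrightarrow> gap f (w \<omega>) \<le> \<Delta> \<Longrightarrow>
      closed (Qs (w \<omega>)) \<and> convex (Qs (w \<omega>)) \<and> xstar \<in> Qs (w \<omega>) \<and> w \<omega> \<in> Qs (w \<omega>) \<and>
      (\<forall>x\<in>Qs (w \<omega>). \<forall>y\<in>Qs (w \<omega>). norm (x - y) \<le> D)"
begin

definition "\<Lambda> = clip_level H0 H1 p (noise_pow p \<alpha> \<tau>) \<Delta> D"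
definition "T = phase_len H0 H1 p (noise_pow p \<alpha> \<tau>) \<Delta> D \<rho>"
definition "a = 5 * D\<^sup>2 / (\<Delta> * real T)"
definition "A t = D\<^sup>2 / \<Delta> + real t * a"
definition "\<theta> = ln (8 / \<rho>)"
definition "l = \<theta> / D\<^sup>2"

definition "state t \<omega> = phase_iter (Qs (w \<omega>)) a (D\<^sup>2 / \<Delta>) \<Lambda> (\<lambda>k x. g x (\<xi> k \<omega>)) (w \<omega>) k0 t"
definition "Y t \<omega> = fst (state t \<omega>)"
definition "Z t \<omega> = fst (snd (state t \<omega>))"
definition "U t \<omega> = (A t *\<^sub>R Y t \<omega> + a *\<^sub>R Z t \<omega>) /\<^sub>R (A t + a)"
definition "V t \<omega> = clip \<Lambda> (g (U t \<omega>) (\<xi> (Suc (k0 + t)) \<omega>))"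

definition "potential t \<omega> = A t * gap f (Y t \<omega>) + (norm (Z t \<omega> - xstar))\<^sup>2 / 2"

definition "good t \<omega> \<longleftrightarrow> gap f (w \<omega>) \<le> \<Delta> \<and> (\<forall>s\<le>t. potential s \<omega> \<le> 3 * D\<^sup>2)"

text \<open>The exponential of the scaled potential, normalised to be 1 at the barrier and killed once the
  barrier has been crossed.\<close>

definition "weight t \<omega> = (if good t \<omega> then exp (l * (potential t \<omega> - 3 * D\<^sup>2)) else 0)"

lemma state_0: "Y 0 \<omega> = w \<omega>" "Z 0 \<omega> = w \<omega>"
  by (auto simp: Y_def Z_def state_def)

lemma state_Suc:
  "Z (Suc t) \<omega> = closest_point (Qs (w \<omega>)) (Z t \<omega> - a *\<^sub>R V t \<omega>)"
  "Y (Suc t) \<omega> = (A t *\<^sub>R Y t \<omega> + a *\<^sub>R Z (Suc t) \<omega>) /\<^sub>R (A t + a)"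
  unfolding Y_def Z_def U_def V_def state_def A_def by (rule phase_iter_Suc_proj)+

lemma clip_level_nonneg: "0 \<le> \<Lambda>" and G_le_clip_level: "2 * G_level H0 H1 \<Delta> \<le> \<Lambda>"
  using level_nonneg[OF phase_pos(1)] by (auto simp: \<Lambda>_def clip_level_def le_max_iff_disj)

lemma log_ge_2: "2 \<le> \<theta>"
  unfolding \<theta>_def using phase_pos by (intro ln_conf_ge_2)

lemma length_bounds: "1024 * \<theta> \<le> real T" "D * \<Lambda> * \<theta> * 1024 \<le> \<Delta> * real T" "0 < real T"
proof -
  show *: "1024 * \<theta> \<le> real T" "D * \<Lambda> * \<theta> * 1024 \<le> \<Delta> * real T"
    unfolding T_def \<Lambda>_def \<theta>_def using phase_pos smoothness_nonneg by (intro phase_len_ge; simp)+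
  show "0 < real T" using * log_ge_2 by linarith
qed

lemma a_pos: "0 < a" and A_pos: "0 < A t" and l_pos: "0 < l"
  and A_ge: "D\<^sup>2 / \<Delta> \<le> A t" and A_Suc: "A (Suc t) = A t + a"
proof -
  show a: "0 < a" using phase_pos length_bounds(3) by (simp add: a_def)
  show "0 < A t" using a phase_pos unfolding A_def by (intro add_pos_nonneg) auto
  show "D\<^sup>2 / \<Delta> \<le> A t" using a by (simp add: A_def)
  show "0 < l" using log_ge_2 phase_pos by (simp add: l_def)
  show "A (Suc t) = A t + a" by (simp add: A_def algebra_simps)
qed

lemma state_measurable:
  "Y t \<in> borel_measurable (Fil (k0 + t)) \<and> Z t \<in> borel_measurable (Fil (k0 + t))"
proof (induction t)
  case 0
  have "Y 0 = w" "Z 0 = w" using state_0 by auto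
  then show ?case using start_measurable by simp
next
  case (Suc t)
  note [measurable] = clip_borel_measurable[OF clip_level_nonneg] projection_measurable
  have [measurable]: "Y t \<in> borel_measurable (Fil (k0 + t))" "Z t \<in> borel_measurable (Fil (k0 + t))"
    using Suc.IH by auto
  have [measurable]: "U t \<in> borel_measurable (Fil (k0 + t))"
    unfolding U_def by measurable
  have [measurable]: "(\<lambda>\<omega>. g (U t \<omega>) (\<xi> (Suc (k0 + t)) \<omega>)) \<in> borel_measurable (Fil (Suc (k0 + t)))"
    by (rule answer_measurable_Fil) measurable
  have [measurable]: "Y t \<in> borel_measurable (Fil (Suc (k0 + t)))" "Z t \<in> borel_measurable (Fil (Suc (k0 + t)))"
    "w \<in> borel_measurable (Fil (Suc (k0 + t)))"
    using Suc.IH start_measurable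
    by (auto intro: measurable_Fil_mono[of _ "k0 + t"] measurable_Fil_mono[of _ k0])
  have [measurable]: "V t \<in> borel_measurable (Fil (Suc (k0 + t)))"
    unfolding V_def by measurable
  have "(\<lambda>\<omega>. (\<lambda>(x, v). closest_point (Qs x) v) (w \<omega>, Z t \<omega> - a *\<^sub>R V t \<omega>))
      \<in> borel_measurable (Fil (Suc (k0 + t)))"
    by measurable
  then have [measurable]: "Z (Suc t) \<in> borel_measurable (Fil (Suc (k0 + t)))"
    using state_Suc(1) by (simp cong: measurable_cong)
  have "Y (Suc t) = (\<lambda>\<omega>. (A t *\<^sub>R Y t \<omega> + a *\<^sub>R Z (Suc t) \<omega>) /\<^sub>R (A t + a))"
    using state_Suc(2) by auto
  then have "Y (Suc t) \<in> borel_measurable (Fil (Suc (k0 + t)))" by simp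
  then show ?case by simp
qed

lemma potential_measurable: "potential t \<in> borel_measurable (Fil (k0 + t))"
proof -
  have [measurable]: "Y t \<in> borel_measurable (Fil (k0 + t))" "Z t \<in> borel_measurable (Fil (k0 + t))"
    using state_measurable by auto
  show ?thesis unfolding potential_def gap_eq by measurable
qed

lemma good_measurable: "Measurable.pred (Fil (k0 + t)) (good t)"
proof -
  have [measurable]: "w \<in> borel_measurable (Fil (k0 + t))"
    using start_measurable by (auto intro: measurable_Fil_mono)
  have [measurable]: "potential s \<in> borel_measurable (Fil (k0 + t))" if "s \<in> {..t}" for s
    using potential_measurable[of s] that by (auto intro: measurable_Fil_mono)
  have "Measurable.pred (Fil (k0 + t)) (\<lambda>\<omega>. gap f (w \<omega>) \<le> \<Delta> \<and> (\<forall>s\<in>{..t}. potential s \<omega> \<le> 3 * D\<^sup>2))"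
    unfolding gap_eq by measurable
  then show ?thesis by (simp add: good_def[abs_def] Ball_def)
qed

lemma weight_measurable: "weight t \<in> borel_measurable (Fil (k0 + t))"
proof -
  note [measurable] = good_measurable[of t] potential_measurable[of t]
  show ?thesis unfolding weight_def by measurable
qed

lemma weight_bounds: "0 \<le> weight t \<omega>" "weight t \<omega> \<le> 1"
  using l_pos by (auto simp: weight_def good_def mult_le_0_iff)

text \<open>The iterates leave neither the auxiliary set nor, therefore, the ball of radius \<open>D\<close> around the
  minimizer; this bounds the vector paired with the noise.\<close>

lemma iterates_in_auxiliary_set:
  assumes "\<omega> \<in> space M" "gap f (w \<omega>) \<le> \<Delta>"
  shows "Y t \<omega> \<in> Qs (w \<omega>)" "Z t \<omega> \<in> Qs (w \<omega>)"
proof -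
  have "0 < D\<^sup>2 / \<Delta>" using phase_pos by simp
  then show "Y t \<omega> \<in> Qs (w \<omega>)" "Z t \<omega> \<in> Qs (w \<omega>)"
    using auxiliary_set[OF assms] a_pos
      phase_iter_in_set[of "Qs (w \<omega>)" "w \<omega>" a "D\<^sup>2 / \<Delta>" \<Lambda> "\<lambda>k x. g x (\<xi> k \<omega>)" k0 t]
    by (auto simp: Y_def Z_def state_def)
qed

lemma good_step:
  assumes \<omega>: "\<omega> \<in> space M" and good: "good t \<omega>"
  shows "gap f (U t \<omega>) \<le> 4 * \<Delta>" "norm (Z t \<omega> - xstar) \<le> D"
    and "potential (Suc t) \<omega> \<le> potential t \<omega>
      + (a * ((grad (U t \<omega>) - V t \<omega>) \<bullet> (Z t \<omega> - xstar)) + a\<^sup>2 * (norm (grad (U t \<omega>) - V t \<omega>))\<^sup>2)"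
proof -
  have st: "gap f (w \<omega>) \<le> \<Delta>" using good by (simp add: good_def)
  note Q = auxiliary_set[OF \<omega> st]
  note YZ = iterates_in_auxiliary_set[OF \<omega> st, of t]
  show "norm (Z t \<omega> - xstar) \<le> D" using Q YZ by auto
  have "A t * gap f (Y t \<omega>) \<le> potential t \<omega>" by (simp add: potential_def)
  also have "\<dots> \<le> 3 * D\<^sup>2" using good by (simp add: good_def)
  finally have pot: "A t * gap f (Y t \<omega>) \<le> 3 * D\<^sup>2" .
  have a_le: "a \<le> 5 / real T * (D\<^sup>2 / \<Delta>)" by (simp add: a_def field_simps)
  have small: "5 / real T * D * G_level H0 H1 \<Delta> \<le> \<Delta> / 800"
  proof -
    have "D * (2 * G_level H0 H1 \<Delta>) * 2 \<le> D * \<Lambda> * \<theta>"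
      using phase_pos G_le_clip_level level_nonneg[OF phase_pos(1)] log_ge_2 clip_level_nonneg
      by (intro mult_mono) auto
    then have "4096 * (D * G_level H0 H1 \<Delta>) \<le> \<Delta> * real T"
      using length_bounds(2) by simp
    then have "D * G_level H0 H1 \<Delta> / real T \<le> \<Delta> / 4096" using length_bounds(3) by (simp add: field_simps)
    then show ?thesis using phase_pos by simp
  qed
  note step = accelerated_step(1)[of "Qs (w \<omega>)" "Y t \<omega>" "Z t \<omega>" D \<Delta> a "5 / real T" "A t"]
    accelerated_step(2)[of "Qs (w \<omega>)" "Y t \<omega>" "Z t \<omega>" D \<Delta> a "5 / real T" "A t" "V t \<omega>"]
  show "gap f (U t \<omega>) \<le> 4 * \<Delta>"
    unfolding U_def using Q YZ a_pos A_ge a_le small pot phase_pos by (intro step(1)) auto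
  show "potential (Suc t) \<omega> \<le> potential t \<omega>
      + (a * ((grad (U t \<omega>) - V t \<omega>) \<bullet> (Z t \<omega> - xstar)) + a\<^sup>2 * (norm (grad (U t \<omega>) - V t \<omega>))\<^sup>2)"
    unfolding potential_def A_Suc state_Suc U_def add.assoc[symmetric]
    using Q YZ a_pos A_ge a_le small pot phase_pos by (intro step(2)) auto
qed

text \<open>On the event \<open>good t\<close>, \<open>exp (l * (potential (Suc t) \<omega> - 3 * D\<^sup>2))\<close> is at least 1 if step \<open>t\<close> crosses
  the barrier, and equals the new weight otherwise. So its expectation on this event dominates
  the left-hand side.\<close>

lemma weight_supermartingale_step:
  defines "\<kappa> \<equiv> \<theta> / (4 * real T)"
  shows "prob {\<omega> \<in> space M. good t \<omega> \<and> \<not> good (Suc t) \<omega>} + expectation (weight (Suc t))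
    \<le> exp \<kappa> * expectation (weight t)"
proof -
  note [measurable] = good_measurable[of t, THEN measurable_Fil_M] good_measurable[of "Suc t", THEN measurable_Fil_M]
    good_measurable[of t]
  have wint: "integrable M (weight s)" for s
    using weight_measurable[of s, THEN measurable_Fil_M] weight_bounds
    by (intro integrable_const_bound[where B = 1]) auto
  \<comment> \<open>The oracle is queried at the minimizer off the good event, where \<open>U t\<close> is uncontrolled and the
    weight vanishes.\<close>
  define u where "u = (\<lambda>\<omega>. if good t \<omega> \<and> \<omega> \<in> space M then U t \<omega> else xstar)"
  have sp [measurable]: "Measurable.pred (Fil (k0 + t)) (\<lambda>\<omega>. \<omega> \<in> space M)"
    by (rule measurable_cong[THEN iffD2, of _ _ "\<lambda>_. True"]) auto
  have [measurable]: "Y t \<in> borel_measurable (Fil (k0 + t))" "Z t \<in> borel_measurable (Fil (k0 + t))"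
    using state_measurable by auto
  have u: "u \<in> borel_measurable (Fil (k0 + t))" unfolding u_def U_def by measurable
  then have [measurable]: "u \<in> borel_measurable M" by (rule measurable_Fil_M)
  have gap_u: "gap f (u \<omega>) \<le> 4 * \<Delta>" for \<omega>
    using good_step(1)[of \<omega> t] phase_pos by (simp add: u_def)
  define h where "h = (\<lambda>\<omega>. g (u \<omega>) (\<xi> (Suc (k0 + t)) \<omega>))"
  define W where "W = (\<lambda>\<omega>. if \<omega> \<in> space M then weight t \<omega> else 0)"
  have Wm: "W \<in> borel_measurable (Fil (k0 + t))"
    unfolding W_def using weight_measurable[of t] by (simp cong: measurable_cong)
  define X where "X = (\<lambda>\<omega>. l * (a * ((grad (u \<omega>) - clip \<Lambda> (h \<omega>)) \<bullet> (Z t \<omega> - xstar))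
      + a\<^sup>2 * (norm (grad (u \<omega>) - clip \<Lambda> (h \<omega>)))\<^sup>2))"
  note rates = phase_rates[OF phase_pos(1,2) clip_level_nonneg log_ge_2 length_bounds(1,2)
      noise_le_clip_level[where \<nu> = "noise_pow p \<alpha> \<tau>", OF p(1) phase_pos(1,2) noise_pow_nonneg smoothness_nonneg, folded \<Lambda>_def],
      folded l_def a_def]
  have W01: "0 \<le> W \<omega>" "W \<omega> \<le> 1" for \<omega> using weight_bounds by (auto simp: W_def)
  have vm: "(\<lambda>\<omega>. Z t \<omega> - xstar) \<in> borel_measurable (Fil (k0 + t))" by measurable
  have vD: "norm (Z t \<omega> - xstar) \<le> D" if "W \<omega> \<noteq> 0" for \<omega>
    using that good_step(2)[of \<omega> t] by (auto simp: W_def weight_def split: if_splits)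
  have gm: "(\<lambda>\<omega>. grad (u \<omega>)) \<in> borel_measurable M" by measurable
  have gL: "norm (grad (u \<omega>)) \<le> \<Lambda> / 2" for \<omega>
    using gradient_le_level[OF _ gap_u, of \<omega>] G_le_clip_level phase_pos by simp
  have hm: "h \<in> borel_measurable M"
    unfolding h_def by (rule measurable_Fil_M[OF answer_measurable_Fil[OF u]])
  have \<kappa>: "0 \<le> \<kappa>" using log_ge_2 by (simp add: \<kappa>_def)
  have unb: "AE \<omega> in M. vec_cond_exp M (Fil (k0 + t)) h \<omega> = grad (u \<omega>)"
    and mom: "AE \<omega> in M. nn_cond_exp M (Fil (k0 + t)) (\<lambda>\<omega>. ennreal (norm (h \<omega> - grad (u \<omega>)) powr p)) \<omega>
      \<le> ennreal (noise_pow p \<alpha> \<tau> \<Delta>)"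
    unfolding h_def using answer_cond_exp[OF u gap_u phase_pos(1)] by auto
  note bound = clipped_step_exp_moment[where c = "\<lambda>\<omega>. grad (u \<omega>)" and h = h and v = "\<lambda>\<omega>. Z t \<omega> - xstar",
      OF prob_space_axioms Fil_subalgebra Wm W01 vm vD gm gL hm
      unb mom
      noise_pow_nonneg p less_imp_le[OF l_pos] less_imp_le[OF a_pos] less_imp_le[OF phase_pos(2)]
      clip_level_nonneg \<kappa> rates(1) rates(2)[folded \<kappa>_def]]
  have moment: "integrable M (\<lambda>\<omega>. W \<omega> * exp (X \<omega>))"
    "(\<integral>\<omega>. W \<omega> * exp (X \<omega>) \<partial>M) \<le> exp \<kappa> * (\<integral>\<omega>. W \<omega> \<partial>M)"
    unfolding X_def using bound by simp_all
  have pw: "indicator {\<omega> \<in> space M. good t \<omega> \<and> \<not> good (Suc t) \<omega>} \<omega> + weight (Suc t) \<omega> \<le> W \<omega> * exp (X \<omega>)"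
    if \<omega>: "\<omega> \<in> space M" for \<omega>
  proof (cases "good t \<omega>")
    case False
    then have "\<not> good (Suc t) \<omega>" unfolding good_def by (meson le_SucI)
    then show ?thesis using False weight_bounds by (simp add: weight_def W_def)
  next
    case True
    have "l * potential (Suc t) \<omega> \<le> l * (potential t \<omega>
      + (a * ((grad (U t \<omega>) - V t \<omega>) \<bullet> (Z t \<omega> - xstar)) + a\<^sup>2 * (norm (grad (U t \<omega>) - V t \<omega>))\<^sup>2))"
      using good_step(3)[OF \<omega> True] l_pos by (intro mult_left_mono) auto
    then have le: "l * (potential (Suc t) \<omega> - 3 * D\<^sup>2) \<le> l * (potential t \<omega> - 3 * D\<^sup>2) + X \<omega>"
      using True \<omega> unfolding X_def h_def u_def V_def by (simp add: algebra_simps)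
    have "W \<omega> * exp (X \<omega>) = exp (l * (potential t \<omega> - 3 * D\<^sup>2) + X \<omega>)"
      using True \<omega> by (simp add: W_def weight_def exp_add)
    with le have big: "exp (l * (potential (Suc t) \<omega> - 3 * D\<^sup>2)) \<le> W \<omega> * exp (X \<omega>)" by simp
    show ?thesis
    proof (cases "good (Suc t) \<omega>")
      case True
      then show ?thesis using big by (simp add: weight_def)
    next
      case False
      then have "3 * D\<^sup>2 \<le> potential (Suc t) \<omega>"
        using \<open>good t \<omega>\<close> by (auto simp: good_def le_Suc_eq)
      then have "1 \<le> exp (l * (potential (Suc t) \<omega> - 3 * D\<^sup>2))" using l_pos by simp
      then have "1 \<le> W \<omega> * exp (X \<omega>)" using big by (rule order_trans)
      then show ?thesis using big False \<open>good t \<omega>\<close> \<omega> by (simp add: weight_def)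
    qed
  qed
  have "prob {\<omega> \<in> space M. good t \<omega> \<and> \<not> good (Suc t) \<omega>} + expectation (weight (Suc t))
    = (\<integral>\<omega>. indicator {\<omega> \<in> space M. good t \<omega> \<and> \<not> good (Suc t) \<omega>} \<omega> + weight (Suc t) \<omega> \<partial>M)"
    using wint by (subst Bochner_Integration.integral_add) (auto simp: emeasure_eq_measure)
  also have "\<dots> \<le> (\<integral>\<omega>. W \<omega> * exp (X \<omega>) \<partial>M)"
    using wint moment(1) pw
    by (intro integral_mono) (auto simp: emeasure_eq_measure)
  also have "\<dots> \<le> exp \<kappa> * (\<integral>\<omega>. W \<omega> \<partial>M)" by (rule moment(2))
  also have "(\<integral>\<omega>. W \<omega> \<partial>M) = expectation (weight t)"
    by (intro Bochner_Integration.integral_cong) (auto simp: W_def)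
  finally show ?thesis .
qed

text \<open>Iterating \<open>weight_supermartingale_step\<close> costs \<open>exp (\<theta> / 4)\<close> in total, and the weight starts below
  \<open>exp (- 3/2 \<theta>)\<close>.\<close>

lemma phase_failure:
  "prob {\<omega> \<in> space M. gap f (w \<omega>) \<le> \<Delta> \<and> \<not> gap f (Y T \<omega>) \<le> \<Delta> / 2} \<le> \<rho> / 8"
proof -
  define \<kappa> where "\<kappa> = \<theta> / (4 * real T)"
  note [measurable] = good_measurable[THEN measurable_Fil_M]
  have [measurable]: "Y T \<in> borel_measurable M"
    using state_measurable measurable_Fil_M by blast
  have "w \<in> borel_measurable M" using start_measurable measurable_Fil_M by blast
  note [measurable] = this
  let ?bad = "\<lambda>t. {\<omega> \<in> space M. good 0 \<omega> \<and> \<not> good t \<omega>}"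
  have anti: "good t \<omega>" if "good (Suc t) \<omega>" for t \<omega> using that by (auto simp: good_def)
  have good0: "good t \<omega> \<Longrightarrow> good 0 \<omega>" for t \<omega> by (auto simp: good_def)
  have ind: "prob (?bad t) + expectation (weight t) \<le> exp (real t * \<kappa>) * expectation (weight 0)" for t
  proof (induction t)
    case 0
    then show ?case by simp
  next
    case (Suc t)
    have "?bad (Suc t) = ?bad t \<union> {\<omega> \<in> space M. good t \<omega> \<and> \<not> good (Suc t) \<omega>}"
      using anti good0 by auto
    then have "prob (?bad (Suc t)) \<le> prob (?bad t) + prob {\<omega> \<in> space M. good t \<omega> \<and> \<not> good (Suc t) \<omega>}"
      by (simp add: measure_Un_le)
    then have "prob (?bad (Suc t)) + expectation (weight (Suc t))
        \<le> prob (?bad t) + exp \<kappa> * expectation (weight t)"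
      using weight_supermartingale_step[of t] by (simp add: \<kappa>_def)
    also have "\<dots> \<le> exp \<kappa> * (prob (?bad t) + expectation (weight t))"
    proof -
      have "1 * prob (?bad t) \<le> exp \<kappa> * prob (?bad t)"
        using log_ge_2 by (intro mult_right_mono) (auto simp: \<kappa>_def)
      then show ?thesis by (simp add: algebra_simps)
    qed
    also have "\<dots> \<le> exp \<kappa> * (exp (real t * \<kappa>) * expectation (weight 0))"
      using Suc.IH by (intro mult_left_mono) auto
    finally show ?case by (simp add: exp_add algebra_simps)
  qed
  have start: "good 0 \<omega> \<and> weight 0 \<omega> \<le> exp (- (3 / 2) * \<theta>)"
    if \<omega>: "\<omega> \<in> space M" and st: "gap f (w \<omega>) \<le> \<Delta>" for \<omega>
  proof -
    have "norm (w \<omega> - xstar) \<le> D" using auxiliary_set[OF \<omega> st] by auto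
    then have "(norm (w \<omega> - xstar))\<^sup>2 \<le> D\<^sup>2" by (intro power_mono) auto
    moreover have "A 0 * gap f (w \<omega>) \<le> D\<^sup>2"
    proof -
      have "D\<^sup>2 / \<Delta> * gap f (w \<omega>) \<le> D\<^sup>2 / \<Delta> * \<Delta>"
        using st phase_pos by (intro mult_left_mono) auto
      then show ?thesis using phase_pos by (simp add: A_def)
    qed
    moreover have "potential 0 \<omega> = A 0 * gap f (w \<omega>) + (norm (w \<omega> - xstar))\<^sup>2 / 2"
      by (simp add: potential_def state_0)
    ultimately have pot: "potential 0 \<omega> \<le> 3 / 2 * D\<^sup>2" by linarith
    then have "potential 0 \<omega> \<le> 3 * D\<^sup>2" using zero_le_power2[of D] by linarith
    then have good: "good 0 \<omega>" using st by (simp add: good_def)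
    have "l * (potential 0 \<omega> - 3 * D\<^sup>2) \<le> l * (- (3 / 2) * D\<^sup>2)"
      using pot l_pos by (intro mult_left_mono) auto
    also have "\<dots> = - (3 / 2) * \<theta>" using phase_pos by (simp add: l_def)
    finally show ?thesis using good by (simp add: weight_def)
  qed
  have w0: "expectation (weight 0) \<le> exp (- (3 / 2) * \<theta>)"
  proof -
    have "weight 0 \<omega> \<le> exp (- (3 / 2) * \<theta>)" if "\<omega> \<in> space M" for \<omega>
      using start[OF that] by (cases "gap f (w \<omega>) \<le> \<Delta>") (auto simp: weight_def good_def)
    moreover have "integrable M (weight 0)"
      using weight_measurable[of 0, THEN measurable_Fil_M] weight_bounds
      by (intro integrable_const_bound[where B = 1]) auto
    ultimately have "expectation (weight 0) \<le> (\<integral>\<omega>. exp (- (3 / 2) * \<theta>) \<partial>M)"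
      by (intro integral_mono) auto
    then show ?thesis by (simp add: prob_space)
  qed
  have sub: "{\<omega> \<in> space M. gap f (w \<omega>) \<le> \<Delta> \<and> \<not> gap f (Y T \<omega>) \<le> \<Delta> / 2} \<subseteq> ?bad T"
  proof clarify
    fix \<omega> assume \<omega>: "\<omega> \<in> space M" "gap f (w \<omega>) \<le> \<Delta>" and big: "\<not> gap f (Y T \<omega>) \<le> \<Delta> / 2"
    \<comment> \<open>The step size is chosen such that \<open>T * a = 5 * D\<^sup>2 / \<Delta>\<close>.\<close>
    have "A T = 6 * (D\<^sup>2 / \<Delta>)" using length_bounds(3) by (simp add: A_def a_def)
    moreover have "A T * gap f (Y T \<omega>) \<le> potential T \<omega>" by (simp add: potential_def)
    moreover have "6 * (D\<^sup>2 / \<Delta>) * (\<Delta> / 2) < 6 * (D\<^sup>2 / \<Delta>) * gap f (Y T \<omega>)"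
      using big phase_pos by (intro mult_strict_left_mono) auto
    ultimately have "3 * D\<^sup>2 < potential T \<omega>" using phase_pos by simp
    then have "\<not> good T \<omega>" by (auto simp: good_def not_le)
    then show "good 0 \<omega> \<and> \<not> good T \<omega>" using start \<omega> by auto
  qed
  have "prob {\<omega> \<in> space M. gap f (w \<omega>) \<le> \<Delta> \<and> \<not> gap f (Y T \<omega>) \<le> \<Delta> / 2} \<le> prob (?bad T)"
    by (rule finite_measure_mono[OF sub]) measurable
  also have "\<dots> \<le> prob (?bad T) + expectation (weight T)"
    using weight_bounds by (simp add: Bochner_Integration.integral_nonneg)
  also have "\<dots> \<le> exp (real T * \<kappa>) * expectation (weight 0)" by (rule ind)
  also have "\<dots> \<le> exp (real T * \<kappa>) * exp (- (3 / 2) * \<theta>)"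
    using w0 by (intro mult_left_mono) auto
  also have "\<dots> = exp (- (5 / 4) * \<theta>)"
    using length_bounds(3) by (simp add: \<kappa>_def flip: exp_add)
  also have "\<dots> \<le> exp (- \<theta>)" using log_ge_2 by simp
  also have "\<dots> = \<rho> / 8" using phase_pos by (simp add: \<theta>_def exp_minus)
  finally show ?thesis .
qed

end


section \<open>The whole run\<close>

lemma phase_conf_bounds:
  assumes "0 < \<rho>" "\<rho> < 1"
  shows "0 < phase_conf \<rho> s" "phase_conf \<rho> s \<le> 1"
proof -
  show "0 < phase_conf \<rho> s" using assms by (simp add: phase_conf_def)
  have "3 * 3 \<le> pi * pi" using pi_gt3 by (intro mult_mono) auto
  then have "6 * 1 \<le> pi\<^sup>2 * (real s + 1)\<^sup>2"
    by (intro mult_mono) (auto simp: power2_eq_square algebra_simps)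
  then have "6 * \<rho> \<le> pi\<^sup>2 * (real s + 1)\<^sup>2" using assms by linarith
  then show "phase_conf \<rho> s \<le> 1" by (simp add: phase_conf_def divide_le_eq_1)
qed

text \<open>The confidences are normalised by \<open>\<Sum> 1 / (s + 1)\<^sup>2 = pi\<^sup>2 / 6\<close>.\<close>

lemma sum_phase_conf_le:
  assumes "0 < \<rho>"
  shows "(\<Sum>s<S. phase_conf \<rho> s) \<le> \<rho>"
proof -
  have sums: "(\<lambda>n. 1 / (real n + 1)\<^sup>2) sums (pi\<^sup>2 / 6)"
    using inverse_squares_sums by (simp add: add.commute)
  have "(\<Sum>s<S. 1 / (real s + 1)\<^sup>2) \<le> pi\<^sup>2 / 6"
    using sum_le_suminf[OF sums_summable[OF sums], of "{..<S}"] sums_unique[OF sums] by simp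
  then have "6 * \<rho> / pi\<^sup>2 * (\<Sum>s<S. 1 / (real s + 1)\<^sup>2) \<le> 6 * \<rho> / pi\<^sup>2 * (pi\<^sup>2 / 6)"
    using assms by (intro mult_left_mono) auto
  then show ?thesis by (simp add: phase_conf_def sum_distrib_left)
qed

lemma phase_gap_pos: "0 < \<Delta>0 \<Longrightarrow> 0 < phase_gap \<Delta>0 s"
  by (simp add: phase_gap_def)

lemma phase_gap_Suc: "phase_gap \<Delta>0 (Suc s) = phase_gap \<Delta>0 s / 2"
  by (simp add: phase_gap_def)

lemma phase_gap_final:
  assumes "0 < \<epsilon>" "\<epsilon> \<le> \<Delta>0"
  shows "phase_gap \<Delta>0 (num_phases \<Delta>0 \<epsilon>) \<le> \<epsilon>"
proof -
  have "log 2 (\<Delta>0 / \<epsilon>) \<le> real (num_phases \<Delta>0 \<epsilon>)"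
    unfolding num_phases_def by (rule real_nat_ceiling_ge)
  then have "2 powr (log 2 (\<Delta>0 / \<epsilon>)) \<le> 2 powr (real (num_phases \<Delta>0 \<epsilon>))"
    by (rule powr_mono) simp
  then have "\<Delta>0 / \<epsilon> \<le> 2 ^ num_phases \<Delta>0 \<epsilon>"
    using assms by (simp add: powr_realpow)
  then show ?thesis using assms by (simp add: phase_gap_def field_simps)
qed

lemma rcsag_phase_eq:
  "rcsag_phase H0 H1 p \<nu> orc k0 w \<Delta> Q D \<rho> =
    (fst (phase_iter Q (5 * D\<^sup>2 / (\<Delta> * real (phase_len H0 H1 p \<nu> \<Delta> D \<rho>))) (D\<^sup>2 / \<Delta>)
        (clip_level H0 H1 p \<nu> \<Delta> D) orc w k0 (phase_len H0 H1 p \<nu> \<Delta> D \<rho>)),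
     k0 + phase_len H0 H1 p \<nu> \<Delta> D \<rho>)"
proof -
  let ?s = "phase_iter Q (5 * D\<^sup>2 / (\<Delta> * real (phase_len H0 H1 p \<nu> \<Delta> D \<rho>))) (D\<^sup>2 / \<Delta>)
        (clip_level H0 H1 p \<nu> \<Delta> D) orc w k0 (phase_len H0 H1 p \<nu> \<Delta> D \<rho>)"
  obtain y z where st: "?s = (y, z, k0 + phase_len H0 H1 p \<nu> \<Delta> D \<rho>)"
    by (metis phase_iter_count prod.collapse)
  show ?thesis by (simp only: rcsag_phase_def Let_def st case_prod_conv fst_conv)
qed

text \<open>Both choices of auxiliary sets are covered by an invariant set \<open>R\<close> of phase starting points: the
  fixed set itself in the convex case, the whole space in the strongly convex case. Diameters may
  depend on the phase only, so that the number of calls is not random.\<close>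

lemma (in sampled_objective) rcsag_guarantee:
  fixes Qsel :: "nat \<Rightarrow> 'a \<Rightarrow> 'a set" and Ds :: "nat \<Rightarrow> real" and R :: "'a set"
  assumes gap0: "gap f x0 \<le> \<Delta>0" and \<epsilon>: "0 < \<epsilon>" "\<epsilon> \<le> \<Delta>0" and \<rho>: "0 < \<rho>" "\<rho> < 1"
    and proj: "\<And>s. (\<lambda>(x, v). closest_point (Qsel s x) v) \<in> borel_measurable (borel \<Otimes>\<^sub>M borel)"
    and diam: "\<And>s x. diameter (Qsel s x) = Ds s" "\<And>s. 0 < Ds s"
    and R: "x0 \<in> R"
    and sets: "\<And>s x. x \<in> R \<Longrightarrow> closed (Qsel s x) \<and> convex (Qsel s x) \<and> bounded (Qsel s x) \<and>
       x \<in> Qsel s x \<and> Qsel s x \<subseteq> R"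
    and contains: "\<And>s x. x \<in> R \<Longrightarrow> gap f x \<le> phase_gap \<Delta>0 s \<Longrightarrow> xstar \<in> Qsel s x"
  defines "\<nu> \<equiv> noise_pow p \<alpha> \<tau>"
  defines "run \<equiv> \<lambda>s \<omega>. rcsag H0 H1 p \<nu> \<Delta>0 \<rho> Qsel (\<lambda>k x. g x (\<xi> k \<omega>)) x0 s"
  shows "1 - \<rho> \<le> measure M {\<omega> \<in> space M. gap f (fst (run (num_phases \<Delta>0 \<epsilon>) \<omega>)) \<le> \<epsilon>}"
    and "snd (run (num_phases \<Delta>0 \<epsilon>) \<omega>) = scheduled_calls H0 H1 p \<nu> \<Delta>0 \<epsilon> \<rho> Ds"
proof -
  define len where "len = (\<lambda>s. phase_len H0 H1 p \<nu> (phase_gap \<Delta>0 s) (Ds s) (phase_conf \<rho> s))"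
  define K where "K = (\<lambda>s. \<Sum>j<s. len j)"
  define w where "w = (\<lambda>s \<omega>. fst (run s \<omega>))"
  have \<Delta>0: "0 < \<Delta>0" using \<epsilon> by linarith
  have run_Suc: "run (Suc s) \<omega> = rcsag_phase H0 H1 p \<nu> (\<lambda>k x. g x (\<xi> k \<omega>)) (snd (run s \<omega>)) (w s \<omega>)
      (phase_gap \<Delta>0 s) (Qsel s (w s \<omega>)) (Ds s) (phase_conf \<rho> s)" for s \<omega>
    by (simp add: run_def w_def split_beta Let_def diam(1))
  have count: "snd (run s \<omega>) = K s" for s \<omega>
  proof (induction s)
    case 0
    then show ?case by (simp add: run_def K_def)
  next
    case (Suc s)
    then show ?case by (simp only: run_Suc rcsag_phase_eq snd_conv) (simp add: K_def len_def)
  qed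
  then show "snd (run (num_phases \<Delta>0 \<epsilon>) \<omega>) = scheduled_calls H0 H1 p \<nu> \<Delta>0 \<epsilon> \<rho> Ds"
    by (simp add: K_def len_def scheduled_calls_def)
  have w_Suc: "w (Suc s) \<omega> = fst (phase_iter (Qsel s (w s \<omega>))
      (5 * (Ds s)\<^sup>2 / (phase_gap \<Delta>0 s * real (len s))) ((Ds s)\<^sup>2 / phase_gap \<Delta>0 s)
      (clip_level H0 H1 p \<nu> (phase_gap \<Delta>0 s) (Ds s)) (\<lambda>k x. g x (\<xi> k \<omega>)) (w s \<omega>) (K s) (len s))" for s \<omega>
    by (subst w_def) (simp only: run_Suc rcsag_phase_eq fst_conv count len_def)
  have wR: "w s \<omega> \<in> R" for s \<omega>
  proof (induction s)
    case 0
    then show ?case using R by (simp add: w_def run_def)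
  next
    case (Suc s)
    have "w (Suc s) \<omega> \<in> Qsel s (w s \<omega>)"
      unfolding w_Suc using sets[OF Suc.IH, of s] diam(2)[of s] phase_gap_pos[OF \<Delta>0, of s]
      by (intro phase_iter_in_set[THEN conjunct1]) auto
    then show ?case using sets[OF Suc.IH, of s] by auto
  qed
  have run_phase: "phase_run f grad xstar \<mu> H0 H1 M E \<xi> g p \<alpha> \<tau> (K s) (w s) (Qsel s)
      (phase_gap \<Delta>0 s) (Ds s) (phase_conf \<rho> s)" if "w s \<in> borel_measurable (Fil (K s))" for s
  proof unfold_locales
    show "w s \<in> borel_measurable (Fil (K s))" by (rule that)
    show "(\<lambda>(x, v). closest_point (Qsel s x) v) \<in> borel_measurable (borel \<Otimes>\<^sub>M borel)" by (rule proj)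
    show "0 < phase_gap \<Delta>0 s" by (rule phase_gap_pos[OF \<Delta>0])
    show "0 < Ds s" by (rule diam)
    show "0 < phase_conf \<rho> s" "phase_conf \<rho> s \<le> 1" using phase_conf_bounds[OF \<rho>] by auto
    fix \<omega> assume "\<omega> \<in> space M" and gap: "gap f (w s \<omega>) \<le> phase_gap \<Delta>0 s"
    have "norm (x - y) \<le> Ds s" if "x \<in> Qsel s (w s \<omega>)" "y \<in> Qsel s (w s \<omega>)" for x y
      using diameter_bounded_bound[of "Qsel s (w s \<omega>)" x y] sets[OF wR] that diam(1)
      by (simp add: dist_norm)
    then show "closed (Qsel s (w s \<omega>)) \<and> convex (Qsel s (w s \<omega>)) \<and> xstar \<in> Qsel s (w s \<omega>) \<and>
        w s \<omega> \<in> Qsel s (w s \<omega>) \<and> (\<forall>x\<in>Qsel s (w s \<omega>). \<forall>y\<in>Qsel s (w s \<omega>). norm (x - y) \<le> Ds s)"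
      using sets[OF wR] contains[OF wR gap] by auto
  qed
  have final: "phase_run.T H0 H1 p \<alpha> \<tau> (phase_gap \<Delta>0 s) (Ds s) (phase_conf \<rho> s) = len s"
    "phase_run.Y H0 H1 \<xi> g p \<alpha> \<tau> (K s) (w s) (Qsel s) (phase_gap \<Delta>0 s) (Ds s) (phase_conf \<rho> s) (len s) = w (Suc s)"
    if "w s \<in> borel_measurable (Fil (K s))" for s
  proof -
    interpret ph: phase_run f grad xstar \<mu> H0 H1 M E \<xi> g p \<alpha> \<tau> "K s" "w s" "Qsel s"
      "phase_gap \<Delta>0 s" "Ds s" "phase_conf \<rho> s" by (rule run_phase[OF that])
    show T: "ph.T = len s" by (simp add: ph.T_def len_def \<nu>_def)
    show "ph.Y (len s) = w (Suc s)"
      unfolding w_Suc ph.Y_def ph.state_def ph.\<Lambda>_def ph.a_def T \<nu>_def by auto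
  qed
  have wm: "w s \<in> borel_measurable (Fil (K s))" for s
  proof (induction s)
    case 0
    then show ?case by (simp add: w_def run_def)
  next
    case (Suc s)
    interpret ph: phase_run f grad xstar \<mu> H0 H1 M E \<xi> g p \<alpha> \<tau> "K s" "w s" "Qsel s"
      "phase_gap \<Delta>0 s" "Ds s" "phase_conf \<rho> s" by (rule run_phase[OF Suc.IH])
    show ?case using ph.state_measurable[of "len s"] final[OF Suc.IH] by (simp add: K_def)
  qed
  have [measurable]: "w s \<in> borel_measurable M" for s using wm measurable_Fil_M by blast
  let ?miss = "\<lambda>s. {\<omega> \<in> space M. \<not> gap f (w s \<omega>) \<le> phase_gap \<Delta>0 s}"
  have miss_m: "?miss s \<in> events" for s unfolding gap_eq by measurable
  have miss: "prob (?miss s) \<le> (\<Sum>j<s. phase_conf \<rho> j / 8)" for s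
  proof (induction s)
    case 0
    then show ?case using gap0 by (simp add: w_def run_def phase_gap_def)
  next
    case (Suc s)
    interpret ph: phase_run f grad xstar \<mu> H0 H1 M E \<xi> g p \<alpha> \<tau> "K s" "w s" "Qsel s"
      "phase_gap \<Delta>0 s" "Ds s" "phase_conf \<rho> s" by (rule run_phase[OF wm])
    let ?fail = "{\<omega> \<in> space M. gap f (w s \<omega>) \<le> phase_gap \<Delta>0 s \<and> \<not> gap f (w (Suc s) \<omega>) \<le> phase_gap \<Delta>0 s / 2}"
    have fail_m: "?fail \<in> events" unfolding gap_eq by measurable
    have "prob ?fail \<le> phase_conf \<rho> s / 8"
      using ph.phase_failure unfolding final(1)[OF wm] final(2)[OF wm] .
    moreover have "prob (?miss (Suc s)) \<le> prob (?miss s \<union> ?fail)"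
    proof (rule finite_measure_mono)
      show "?miss (Suc s) \<subseteq> ?miss s \<union> ?fail" by (auto simp: phase_gap_Suc)
      show "?miss s \<union> ?fail \<in> events" by (intro sets.Un miss_m fail_m)
    qed
    moreover have "prob (?miss s \<union> ?fail) \<le> prob (?miss s) + prob ?fail"
      by (intro measure_Un_le miss_m fail_m)
    ultimately show ?case using Suc.IH by simp
  qed
  define S where "S = num_phases \<Delta>0 \<epsilon>"
  have "(\<Sum>j<S. phase_conf \<rho> j / 8) \<le> \<rho>"
    using sum_phase_conf_le[OF \<rho>(1), of S] \<rho> by (simp flip: sum_divide_distrib)
  then have "1 - \<rho> \<le> 1 - prob (?miss S)" using miss[of S] by linarith
  also have "\<dots> = prob (space M - ?miss S)" by (rule prob_compl[symmetric, OF miss_m])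
  also have "\<dots> \<le> prob {\<omega> \<in> space M. gap f (w S \<omega>) \<le> \<epsilon>}"
  proof (rule finite_measure_mono)
    show "space M - ?miss S \<subseteq> {\<omega> \<in> space M. gap f (w S \<omega>) \<le> \<epsilon>}"
      using phase_gap_final[OF \<epsilon>] by (auto simp: S_def)
    show "{\<omega> \<in> space M. gap f (w S \<omega>) \<le> \<epsilon>} \<in> events" unfolding gap_eq by measurable
  qed
  finally show "1 - \<rho> \<le> measure M {\<omega> \<in> space M. gap f (fst (run (num_phases \<Delta>0 \<epsilon>) \<omega>)) \<le> \<epsilon>}"
    by (simp add: S_def w_def)
qed

lemma closest_point_cball_translate:
  fixes x v :: "'a::euclidean_space"
  assumes "0 \<le> r"
  shows "closest_point (cball x r) v = x + closest_point (cball 0 r) (v - x)"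
proof (rule closest_point_unique[symmetric])
  let ?c = "closest_point (cball 0 r) (v - x)"
  have "?c \<in> cball 0 r" using assms by (intro closest_point_in_set) auto
  then show "x + ?c \<in> cball x r" by (simp add: dist_norm)
  show "\<forall>z\<in>cball x r. dist v (x + ?c) \<le> dist v z"
  proof
    fix z assume "z \<in> cball x r"
    then have "z - x \<in> cball 0 r" by (simp add: dist_norm norm_minus_commute)
    then have "dist (v - x) ?c \<le> dist (v - x) (z - x)" by (intro closest_point_le) auto
    then show "dist v (x + ?c) \<le> dist v z" by (simp add: dist_norm algebra_simps)
  qed
qed auto

text \<open>The centre of the ball is random, so the projection must be measurable in the centre and the point
  jointly. Translation reduces this to a fixed ball.\<close>

lemma closest_point_cball_measurable:
  assumes "0 \<le> r"
  shows "(\<lambda>(x, v). closest_point (cball x r) (v :: 'a::euclidean_space)) \<in> borel_measurable (borel \<Otimes>\<^sub>M borel)"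
proof -
  have "continuous_on UNIV (closest_point (cball 0 r) :: 'a \<Rightarrow> 'a)"
    using assms by (intro continuous_on_closest_point) auto
  then have [measurable]: "(closest_point (cball 0 r) :: 'a \<Rightarrow> 'a) \<in> borel_measurable borel"
    by (rule borel_measurable_continuous_onI)
  have "(\<lambda>(x, v). closest_point (cball x r) v) = (\<lambda>(x, v :: 'a). x + closest_point (cball 0 r) (v - x))"
    by (rule ext, simp only: split_beta, rule closest_point_cball_translate[OF assms])
  then show ?thesis by simp
qed

lemma closest_point_fixed_measurable:
  fixes Q :: "'a::euclidean_space set"
  assumes "closed Q" "convex Q" "Q \<noteq> {}"
  shows "(\<lambda>(x :: 'a, v). closest_point Q v) \<in> borel_measurable (borel \<Otimes>\<^sub>M borel)"
proof -
  have "continuous_on UNIV (closest_point Q)"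
    using assms by (intro continuous_on_closest_point) auto
  then have [measurable]: "closest_point Q \<in> borel_measurable borel"
    by (rule borel_measurable_continuous_onI)
  show ?thesis by measurable
qed

lemma (in smooth_convex_objective) minimizer_in_growth_ball:
  assumes "0 < \<mu>" "gap f x \<le> \<Delta>"
  shows "xstar \<in> cball x (sqrt (2 * \<Delta> / \<mu>))"
proof -
  have "(norm (x - xstar))\<^sup>2 \<le> 2 * \<Delta> / \<mu>"
    using quadratic_growth[of x] assms by (simp add: field_simps)
  then show ?thesis by (simp add: dist_norm real_le_rsqrt)
qed

context sampled_objective
begin

lemma rcsag_convex:
  assumes run: "gap f x0 \<le> \<Delta>0" "0 < \<epsilon>" "\<epsilon> \<le> \<Delta>0" "0 < \<rho>" "\<rho> < 1"
    and Q: "closed Q" "convex Q" "x0 \<in> Q" "xstar \<in> Q" "bounded Q" "0 < diameter Q"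
  defines "run \<equiv> \<lambda>\<omega>. rcsag H0 H1 p (noise_pow p \<alpha> \<tau>) \<Delta>0 \<rho> (\<lambda>_ _. Q)
      (\<lambda>k x. g x (\<xi> k \<omega>)) x0 (num_phases \<Delta>0 \<epsilon>)"
  shows "1 - \<rho> \<le> measure M {\<omega> \<in> space M. gap f (fst (run \<omega>)) \<le> \<epsilon>}"
    and "snd (run \<omega>) = scheduled_calls H0 H1 p (noise_pow p \<alpha> \<tau>) \<Delta>0 \<epsilon> \<rho> (\<lambda>_. diameter Q)"
proof -
  have pm: "(\<lambda>(x :: 'a, v). closest_point Q v) \<in> borel_measurable (borel \<Otimes>\<^sub>M borel)"
    using Q by (intro closest_point_fixed_measurable) auto
  show "1 - \<rho> \<le> measure M {\<omega> \<in> space M. gap f (fst (run \<omega>)) \<le> \<epsilon>}"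
    unfolding run_def
    using rcsag_guarantee(1)[OF run, of "\<lambda>_ _. Q" "\<lambda>_. diameter Q" Q] Q pm by auto
  show "snd (run \<omega>) = scheduled_calls H0 H1 p (noise_pow p \<alpha> \<tau>) \<Delta>0 \<epsilon> \<rho> (\<lambda>_. diameter Q)"
    unfolding run_def
    using rcsag_guarantee(2)[OF run, of "\<lambda>_ _. Q" "\<lambda>_. diameter Q" Q] Q pm by auto
qed

lemma rcsag_strongly_convex:
  assumes run: "gap f x0 \<le> \<Delta>0" "0 < \<epsilon>" "\<epsilon> \<le> \<Delta>0" "0 < \<rho>" "\<rho> < 1" and \<mu>: "0 < \<mu>"
  defines "run \<equiv> \<lambda>\<omega>. rcsag H0 H1 p (noise_pow p \<alpha> \<tau>) \<Delta>0 \<rho> (\<lambda>s w. cball w (sc_radius \<mu> \<Delta>0 s))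
      (\<lambda>k x. g x (\<xi> k \<omega>)) x0 (num_phases \<Delta>0 \<epsilon>)"
  shows "1 - \<rho> \<le> measure M {\<omega> \<in> space M. gap f (fst (run \<omega>)) \<le> \<epsilon>}"
    and "snd (run \<omega>) = scheduled_calls H0 H1 p (noise_pow p \<alpha> \<tau>) \<Delta>0 \<epsilon> \<rho> (\<lambda>s. 2 * sc_radius \<mu> \<Delta>0 s)"
proof -
  have r: "0 < sc_radius \<mu> \<Delta>0 s" for s
    using \<mu> run phase_gap_pos[of \<Delta>0 s] by (simp add: sc_radius_def)
  have pm: "(\<lambda>(x :: 'a, v). closest_point (cball x (sc_radius \<mu> \<Delta>0 s)) v) \<in> borel_measurable (borel \<Otimes>\<^sub>M borel)" for s
    using r[of s] by (intro closest_point_cball_measurable) auto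
  have c: "xstar \<in> cball x (sc_radius \<mu> \<Delta>0 s)" if "gap f x \<le> phase_gap \<Delta>0 s" for s x
    unfolding sc_radius_def by (rule minimizer_in_growth_ball[OF \<mu> that])
  have d: "diameter (cball x (sc_radius \<mu> \<Delta>0 s)) = 2 * sc_radius \<mu> \<Delta>0 s" for s and x :: 'a
    using r[of s] by (simp add: diameter_cball)
  have nn: "0 \<le> sc_radius \<mu> \<Delta>0 s" for s using r[of s] by simp
  note guarantee = rcsag_guarantee[OF run, of "\<lambda>s w. cball w (sc_radius \<mu> \<Delta>0 s)" "\<lambda>s. 2 * sc_radius \<mu> \<Delta>0 s" UNIV]
  show "1 - \<rho> \<le> measure M {\<omega> \<in> space M. gap f (fst (run \<omega>)) \<le> \<epsilon>}"
    unfolding run_def using guarantee(1) r pm c d nn by (auto simp del: mem_cball simp: centre_in_cball)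
  show "snd (run \<omega>) = scheduled_calls H0 H1 p (noise_pow p \<alpha> \<tau>) \<Delta>0 \<epsilon> \<rho> (\<lambda>s. 2 * sc_radius \<mu> \<Delta>0 s)"
    unfolding run_def using guarantee(2) r pm c d nn by (auto simp del: mem_cball simp: centre_in_cball)
qed

end


section \<open>The number of oracle calls\<close>

text \<open>The geometric series \<open>\<Sum>j. 2 powr (- \<theta> * j)\<close> for \<open>\<theta> > 0\<close>.\<close>

definition geo :: "real \<Rightarrow> real" where
  "geo \<theta> = 1 / (1 - 2 powr (- \<theta>))"

lemma geo_pos: "0 < \<theta> \<Longrightarrow> 0 < geo \<theta>"
  and geo_unfold: "0 < \<theta> \<Longrightarrow> geo \<theta> = 1 + 2 powr (- \<theta>) * geo \<theta>"
proof -
  assume \<theta>: "0 < \<theta>"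
  then have "2 powr (- \<theta>) < 2 powr (0::real)" by (intro powr_less_mono) auto
  then have pos: "0 < 1 - 2 powr (- \<theta>)" by simp
  then show "0 < geo \<theta>" by (simp add: geo_def)
  have "1 / (1 - 2 powr (- \<theta>)) - 2 powr (- \<theta>) / (1 - 2 powr (- \<theta>)) = 1"
    using pos \<theta> by (simp flip: diff_divide_distrib)
  then show "geo \<theta> = 1 + 2 powr (- \<theta>) * geo \<theta>" by (simp add: geo_def)
qed

lemma phase_gap_powr_Suc:
  "0 < \<Delta>0 \<Longrightarrow> phase_gap \<Delta>0 (Suc s) powr \<theta> = 2 powr (- \<theta>) * phase_gap \<Delta>0 s powr \<theta>"
  using phase_gap_pos[of \<Delta>0 s] by (simp add: phase_gap_Suc powr_divide powr_minus field_simps)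

text \<open>For a positive power the first phase dominates, for a negative power
  (\<open>sum_phase_gap_powr_neg_le\<close>) the last one.\<close>

lemma sum_phase_gap_powr_le:
  assumes "0 < \<theta>" "0 < \<Delta>0"
  shows "(\<Sum>s<S. phase_gap \<Delta>0 s powr \<theta>) \<le> geo \<theta> * \<Delta>0 powr \<theta>"
proof -
  have "(\<Sum>s<S. phase_gap \<Delta>0 s powr \<theta>) + geo \<theta> * phase_gap \<Delta>0 S powr \<theta> = geo \<theta> * \<Delta>0 powr \<theta>"
  proof (induction S)
    case 0
    then show ?case by (simp add: phase_gap_def)
  next
    case (Suc S)
    have "phase_gap \<Delta>0 S powr \<theta> + geo \<theta> * phase_gap \<Delta>0 (Suc S) powr \<theta> = geo \<theta> * phase_gap \<Delta>0 S powr \<theta>"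
      unfolding phase_gap_powr_Suc[OF assms(2)]
      by (subst (2) geo_unfold[OF assms(1)]) (simp add: algebra_simps)
    then show ?case using Suc.IH by simp
  qed
  moreover have "0 \<le> geo \<theta> * phase_gap \<Delta>0 S powr \<theta>" using geo_pos[OF assms(1)] by simp
  ultimately show ?thesis by linarith
qed

lemma phase_gap_gt:
  assumes "0 < \<epsilon>" "\<epsilon> \<le> \<Delta>0" "s < num_phases \<Delta>0 \<epsilon>"
  shows "\<epsilon> < phase_gap \<Delta>0 s"
proof -
  have "real s < log 2 (\<Delta>0 / \<epsilon>)"
    using assms(3) unfolding num_phases_def by linarith
  then have "2 powr real s < 2 powr (log 2 (\<Delta>0 / \<epsilon>))" by (intro powr_less_mono) auto
  then have "2 ^ s < \<Delta>0 / \<epsilon>" using assms by (simp add: powr_realpow)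
  then show ?thesis using assms by (simp add: phase_gap_def field_simps)
qed

lemma sum_phase_gap_powr_neg_le:
  assumes "0 < \<theta>" "0 < \<epsilon>" "\<epsilon> \<le> \<Delta>0"
  shows "(\<Sum>s<num_phases \<Delta>0 \<epsilon>. phase_gap \<Delta>0 s powr (- \<theta>)) \<le> geo \<theta> * \<epsilon> powr (- \<theta>)"
proof (cases "num_phases \<Delta>0 \<epsilon>")
  case 0
  then show ?thesis using geo_pos[OF assms(1)] by simp
next
  case (Suc n)
  have \<Delta>0: "0 < \<Delta>0" using assms by linarith
  have "(\<Sum>s<Suc m. phase_gap \<Delta>0 s powr (- \<theta>)) \<le> geo \<theta> * phase_gap \<Delta>0 m powr (- \<theta>)" for m
  proof (induction m)
    case 0
    have "1 \<le> geo \<theta>" using geo_unfold[OF assms(1)] geo_pos[OF assms(1)] by (smt (verit) mult_nonneg_nonneg powr_ge_zero)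
    then have "1 * phase_gap \<Delta>0 0 powr (- \<theta>) \<le> geo \<theta> * phase_gap \<Delta>0 0 powr (- \<theta>)"
      by (intro mult_right_mono) auto
    then show ?case by simp
  next
    case (Suc m)
    have "geo \<theta> * phase_gap \<Delta>0 m powr (- \<theta>) + phase_gap \<Delta>0 (Suc m) powr (- \<theta>)
        = geo \<theta> * phase_gap \<Delta>0 (Suc m) powr (- \<theta>)"
    proof -
      have "phase_gap \<Delta>0 m powr (- \<theta>) = 2 powr (- \<theta>) * phase_gap \<Delta>0 (Suc m) powr (- \<theta>)"
        unfolding phase_gap_powr_Suc[OF \<Delta>0] by (simp flip: powr_add mult.assoc)
      then show ?thesis
        by (subst (2) geo_unfold[OF assms(1)]) (simp add: algebra_simps)
    qed
    then show ?case using Suc.IH by simp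
  qed
  from this[of n] have "(\<Sum>s<num_phases \<Delta>0 \<epsilon>. phase_gap \<Delta>0 s powr (- \<theta>)) \<le> geo \<theta> * phase_gap \<Delta>0 n powr (- \<theta>)"
    by (simp add: Suc)
  also have "\<dots> \<le> geo \<theta> * \<epsilon> powr (- \<theta>)"
    using phase_gap_gt[OF assms(2,3), of n] geo_pos[OF assms(1)] assms Suc
    by (intro mult_left_mono powr_mono2') auto
  finally show ?thesis .
qed

lemma num_phases_le_log:
  assumes "0 < \<epsilon>" "\<epsilon> \<le> \<Delta>0"
  shows "real (num_phases \<Delta>0 \<epsilon>) \<le> (1 / ln 2 + 1) * max 1 (ln (\<Delta>0 / \<epsilon>))"
proof -
  have "0 \<le> log 2 (\<Delta>0 / \<epsilon>)" using assms by simp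
  then have "real (num_phases \<Delta>0 \<epsilon>) \<le> log 2 (\<Delta>0 / \<epsilon>) + 1"
    unfolding num_phases_def by linarith
  also have "\<dots> = 1 / ln 2 * ln (\<Delta>0 / \<epsilon>) + 1" by (simp add: log_def)
  also have "\<dots> \<le> 1 / ln 2 * max 1 (ln (\<Delta>0 / \<epsilon>)) + max 1 (ln (\<Delta>0 / \<epsilon>))"
    by (intro add_mono mult_left_mono) auto
  finally show ?thesis by (simp add: algebra_simps)
qed

text \<open>The three regimes of \<open>noise_exponent_factor\<close> are a geometric sum dominated by its last term, a
  constant sum, and a geometric sum dominated by its first term.\<close>

lemma sum_phase_gap_noise_exponent:
  assumes "1 < p"
  obtains c where "0 < c" and "\<And>\<Delta>0 \<epsilon>. 0 < \<epsilon> \<Longrightarrow> \<epsilon> \<le> \<Delta>0 \<Longrightarrow>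
    (\<Sum>s<num_phases \<Delta>0 \<epsilon>. phase_gap \<Delta>0 s powr ((\<alpha> - \<beta>) / (p - 1)))
      \<le> c * noise_exponent_factor p \<beta> \<alpha> \<Delta>0 \<epsilon>"
proof -
  consider "\<alpha> < \<beta>" | "\<alpha> = \<beta>" | "\<beta> < \<alpha>" by linarith
  then show thesis
  proof cases
    case 1
    let ?t = "(\<beta> - \<alpha>) / (p - 1)"
    have t: "0 < ?t" using 1 assms by simp
    have eq: "(\<alpha> - \<beta>) / (p - 1) = - ?t" "- (\<beta> - \<alpha>) / (p - 1) = - ?t"
      by (simp_all only: minus_divide_left minus_diff_eq)
    show thesis
    proof (rule that[OF geo_pos[OF t]])
      fix \<Delta>0 \<epsilon> :: real assume \<epsilon>: "0 < \<epsilon>" "\<epsilon> \<le> \<Delta>0"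
      have "noise_exponent_factor p \<beta> \<alpha> \<Delta>0 \<epsilon> = \<epsilon> powr (- ?t)"
        using 1 by (simp only: noise_exponent_factor_def eq if_True)
      then show "(\<Sum>s<num_phases \<Delta>0 \<epsilon>. phase_gap \<Delta>0 s powr ((\<alpha> - \<beta>) / (p - 1)))
        \<le> geo ?t * noise_exponent_factor p \<beta> \<alpha> \<Delta>0 \<epsilon>"
        unfolding eq(1) using sum_phase_gap_powr_neg_le[OF t \<epsilon>] by simp
    qed
  next
    case 2
    have "0 < 1 / ln 2 + (1::real)" by (simp add: add_pos_pos)
    then show thesis
    proof (rule that)
      fix \<Delta>0 \<epsilon> :: real assume \<epsilon>: "0 < \<epsilon>" "\<epsilon> \<le> \<Delta>0"
      have "phase_gap \<Delta>0 s powr 0 = 1" for s using phase_gap_pos[of \<Delta>0 s] \<epsilon> by simp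
      then show "(\<Sum>s<num_phases \<Delta>0 \<epsilon>. phase_gap \<Delta>0 s powr ((\<alpha> - \<beta>) / (p - 1)))
      \<le> (1 / ln 2 + 1) * noise_exponent_factor p \<beta> \<alpha> \<Delta>0 \<epsilon>"
        using num_phases_le_log[OF \<epsilon>] 2 by (simp add: noise_exponent_factor_def)
    qed
  next
    case 3
    then have t: "0 < (\<alpha> - \<beta>) / (p - 1)" using assms by simp
    show thesis
      by (rule that[OF geo_pos[OF t]])
        (use sum_phase_gap_powr_le[OF t] 3 in \<open>simp add: noise_exponent_factor_def\<close>)
  qed
qed

lemma ln_phase_conf_le:
  assumes "0 < \<rho>" "\<rho> < 1" "s < S"
  shows "ln (8 / phase_conf \<rho> s) \<le> 5 * conf_log \<rho> S"
proof -
  have "pi * pi \<le> 4 * 4" using pi_less_4 by (intro mult_mono) auto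
  then have pi: "pi\<^sup>2 \<le> 16" by (simp add: power2_eq_square)
  have "8 / phase_conf \<rho> s = 8 * pi\<^sup>2 / 6 * (real s + 1)\<^sup>2 * (1 / \<rho>)"
    using assms by (simp add: phase_conf_def)
  also have "\<dots> \<le> 32 * (1 + real S)\<^sup>2 * (1 / \<rho>)"
    using pi assms by (intro mult_right_mono mult_mono power_mono) auto
  finally have "ln (8 / phase_conf \<rho> s) \<le> ln (32 * (1 + real S)\<^sup>2 * (1 / \<rho>))"
    using phase_conf_bounds(1)[OF assms(1,2), of s] assms by (subst ln_le_cancel_iff) (auto intro!: mult_pos_pos)
  also have "\<dots> = ln 32 + 2 * ln (1 + real S) + ln (1 / \<rho>)"
    using assms by (simp add: ln_mult ln_div ln_realpow)
  also have "ln (32::real) \<le> 5"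
  proof -
    have "ln (32::real) = 5 * ln 2" using ln_realpow[of "2::real" 5] by simp
    then show ?thesis using ln_2_less_1 by simp
  qed
  also have "5 + 2 * ln (1 + real S) + ln (1 / \<rho>) \<le> 5 * conf_log \<rho> S"
  proof -
    have "5 + 2 * a + b \<le> 5 * (1 + b + a)" if "0 \<le> a" "0 \<le> b" for a b :: real
      using that by simp
    then show ?thesis unfolding conf_log_def using assms by simp
  qed
  finally show ?thesis by simp
qed

lemma conf_log_ge_1: "0 < \<rho> \<Longrightarrow> \<rho> < 1 \<Longrightarrow> 1 \<le> conf_log \<rho> S"
  by (simp add: conf_log_def ln_div)

text \<open>A maximum is at most the sum of its entries. In the first one, \<open>35\<^sup>2\<close> exceeds \<open>32 * C_star H1\<close>; in the
  second one, \<open>D\<close> and \<open>\<tau>\<close> both appear with exponent \<open>p / (p - 1)\<close>, because \<open>1 + 1 / (p - 1) = p / (p - 1)\<close>.\<close>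

lemma clip_level_split:
  assumes "0 < \<Delta>" "0 < D" "0 \<le> \<tau>" "1 < p" "0 \<le> H0" "0 \<le> H1"
  shows "D * clip_level H0 H1 p (noise_pow p \<alpha> \<tau>) \<Delta> D / \<Delta>
    \<le> 70 * (D * sqrt ((H0 + H1 * \<Delta>) / \<Delta>))
      + 64 powr (1 / (p - 1)) * 4 powr (\<alpha> / (p - 1)) * ((\<tau> * D) powr (p / (p - 1)) * \<Delta> powr ((\<alpha> - p) / (p - 1)))"
proof -
  define r where "r = 1 / (p - 1)"
  have r: "0 < r" using assms by (simp add: r_def)
  have one: "(p - 1) * r = 1" using assms by (simp add: r_def)
  have q: "p / (p - 1) = p * r" "p * r = 1 + r" "\<alpha> / (p - 1) = \<alpha> * r" "(\<alpha> - p) / (p - 1) = \<alpha> * r - r - 1"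
  proof -
    show "p / (p - 1) = p * r" "\<alpha> / (p - 1) = \<alpha> * r" by (simp_all add: r_def)
    show "p * r = 1 + r" using one by (simp add: left_diff_distrib)
    have "(\<alpha> - p) / (p - 1) = (\<alpha> - p) * r" by (simp add: r_def)
    also have "\<dots> = \<alpha> * r - r - (p - 1) * r" by (simp add: left_diff_distrib)
    finally show "(\<alpha> - p) / (p - 1) = \<alpha> * r - r - 1" unfolding one .
  qed
  let ?n = "(64 * noise_pow p \<alpha> \<tau> \<Delta> * D / \<Delta>) powr r"
  have G0: "0 \<le> G_level H0 H1 \<Delta>" using assms by (intro G_level_nonneg)
  have "clip_level H0 H1 p (noise_pow p \<alpha> \<tau>) \<Delta> D \<le> 2 * G_level H0 H1 \<Delta> + ?n"
    unfolding clip_level_def r_def[symmetric] using G0 by simp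
  then have "D * clip_level H0 H1 p (noise_pow p \<alpha> \<tau>) \<Delta> D / \<Delta> \<le> D * (2 * G_level H0 H1 \<Delta> + ?n) / \<Delta>"
    using assms by (intro divide_right_mono mult_left_mono) auto
  also have "\<dots> = 2 * D * (G_level H0 H1 \<Delta> / \<Delta>) + D / \<Delta> * ?n"
    by (simp add: add_divide_distrib distrib_left)
  also have "G_level H0 H1 \<Delta> / \<Delta> \<le> 35 * sqrt ((H0 + H1 * \<Delta>) / \<Delta>)"
  proof -
    have "sqrt 2 \<le> sqrt ((3 / 2)\<^sup>2)" by (intro real_sqrt_le_mono) (simp add: power2_eq_square)
    then have "sqrt 2 \<le> 3 / 2" by simp
    then have C: "32 * C_star H1 \<le> 1225" by (simp add: C_star_def)
    have "G_level H0 H1 \<Delta> / \<Delta> = sqrt (32 * C_star H1 * \<Delta> * (H0 + H1 * \<Delta>) / \<Delta>\<^sup>2)"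
      using assms by (simp add: G_level_def real_sqrt_divide)
    also have "\<dots> = sqrt (32 * C_star H1 * ((H0 + H1 * \<Delta>) / \<Delta>))"
      using assms by (simp add: power2_eq_square)
    also have "\<dots> \<le> sqrt (1225 * ((H0 + H1 * \<Delta>) / \<Delta>))"
      using C assms by (intro real_sqrt_le_mono mult_right_mono) auto
    also have "sqrt (1225::real) = 35" using real_sqrt_abs[of 35] by simp
    then have "sqrt (1225 * ((H0 + H1 * \<Delta>) / \<Delta>)) = 35 * sqrt ((H0 + H1 * \<Delta>) / \<Delta>)"
      by (simp only: real_sqrt_mult)
    finally show ?thesis .
  qed
  also have "D / \<Delta> * ?n = 64 powr r * 4 powr (\<alpha> * r) * ((\<tau> * D) powr (p * r) * \<Delta> powr (\<alpha> * r - r - 1))"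
  proof -
    have "?n = 64 powr r * ((\<tau> powr (p * r)) * (4 powr (\<alpha> * r) * \<Delta> powr (\<alpha> * r))) * D powr r / \<Delta> powr r"
      using assms by (simp add: noise_pow_def powr_mult powr_divide powr_powr)
    moreover have "(\<tau> * D) powr (p * r) = \<tau> powr (p * r) * (D * D powr r)"
      using assms by (simp add: powr_mult) (simp add: q(2) powr_add)
    moreover have "\<Delta> powr (\<alpha> * r - r - 1) = \<Delta> powr (\<alpha> * r) / \<Delta> powr r / \<Delta>"
      using assms by (simp add: powr_diff)
    ultimately show ?thesis by (simp add: mult_ac)
  qed
  finally show ?thesis using assms unfolding q(1,3,4) r_def[symmetric] by simp
qed

text \<open>The constant is \<open>1024 * 5 + 1\<close>: the logarithm is at most \<open>5 * conf_log \<rho> S\<close>, and rounding up costs one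
  call.\<close>

lemma phase_len_le:
  assumes "0 < \<Delta>" "0 < D" "0 \<le> \<tau>" "1 < p" "0 \<le> H0" "0 \<le> H1" "0 < \<rho>" "\<rho> < 1" "s < S"
  shows "real (phase_len H0 H1 p (noise_pow p \<alpha> \<tau>) \<Delta> D (phase_conf \<rho> s))
    \<le> 5121 * conf_log \<rho> S * (1 + 70 * (D * sqrt ((H0 + H1 * \<Delta>) / \<Delta>))
      + 64 powr (1 / (p - 1)) * 4 powr (\<alpha> / (p - 1)) * ((\<tau> * D) powr (p / (p - 1)) * \<Delta> powr ((\<alpha> - p) / (p - 1))))"
proof -
  define R where "R = D * clip_level H0 H1 p (noise_pow p \<alpha> \<tau>) \<Delta> D / \<Delta>"
  define L where "L = conf_log \<rho> S"
  have L: "1 \<le> L" unfolding L_def using assms by (intro conf_log_ge_1)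
  have R: "0 \<le> R"
    using assms G_level_nonneg[of H0 H1 \<Delta>] by (simp add: R_def clip_level_def le_max_iff_disj)
  have l: "0 \<le> ln (8 / phase_conf \<rho> s)" using ln_conf_ge_2[OF phase_conf_bounds, of \<rho> s] assms by simp
  have "real (phase_len H0 H1 p (noise_pow p \<alpha> \<tau>) \<Delta> D (phase_conf \<rho> s))
      \<le> 1024 * (1 + R) * ln (8 / phase_conf \<rho> s) + 1"
  proof -
    have "0 \<le> 1024 * (1 + R) * ln (8 / phase_conf \<rho> s)" using R l by simp
    then show ?thesis unfolding phase_len_def R_def[symmetric] by linarith
  qed
  also have "\<dots> \<le> 1024 * (1 + R) * (5 * L) + L * (1 + R)"
  proof (intro add_mono mult_left_mono)
    show "ln (8 / phase_conf \<rho> s) \<le> 5 * L" unfolding L_def using assms by (intro ln_phase_conf_le)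
    have "1 * 1 \<le> L * (1 + R)" using L R by (intro mult_mono) auto
    then show "1 \<le> L * (1 + R)" by simp
  qed (use R in auto)
  also have "\<dots> = 5121 * L * (1 + R)" by (simp add: algebra_simps)
  also have "\<dots> \<le> 5121 * L * (1 + (70 * (D * sqrt ((H0 + H1 * \<Delta>) / \<Delta>))
      + 64 powr (1 / (p - 1)) * 4 powr (\<alpha> / (p - 1)) * ((\<tau> * D) powr (p / (p - 1)) * \<Delta> powr ((\<alpha> - p) / (p - 1)))))"
    unfolding R_def using L assms by (intro mult_left_mono add_left_mono clip_level_split) auto
  finally show ?thesis by (simp add: L_def add.assoc)
qed

lemma scheduled_calls_le:
  fixes \<Delta>0 \<epsilon> :: real
  assumes "0 < \<Delta>0" "\<And>s. 0 < Ds s" "0 \<le> \<tau>" "1 < p" "0 \<le> H0" "0 \<le> H1" "0 < \<rho>" "\<rho> < 1"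
  defines "S \<equiv> num_phases \<Delta>0 \<epsilon>" and "\<Delta> \<equiv> phase_gap \<Delta>0"
  shows "real (scheduled_calls H0 H1 p (noise_pow p \<alpha> \<tau>) \<Delta>0 \<epsilon> \<rho> Ds)
    \<le> 5121 * conf_log \<rho> S * (real S + 70 * (\<Sum>s<S. Ds s * sqrt ((H0 + H1 * \<Delta> s) / \<Delta> s))
      + 64 powr (1 / (p - 1)) * 4 powr (\<alpha> / (p - 1)) *
          (\<Sum>s<S. (\<tau> * Ds s) powr (p / (p - 1)) * \<Delta> s powr ((\<alpha> - p) / (p - 1))))"
proof -
  have "real (scheduled_calls H0 H1 p (noise_pow p \<alpha> \<tau>) \<Delta>0 \<epsilon> \<rho> Ds)
    \<le> (\<Sum>s<S. 5121 * conf_log \<rho> S * (1 + 70 * (Ds s * sqrt ((H0 + H1 * \<Delta> s) / \<Delta> s))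
      + 64 powr (1 / (p - 1)) * 4 powr (\<alpha> / (p - 1)) *
        ((\<tau> * Ds s) powr (p / (p - 1)) * \<Delta> s powr ((\<alpha> - p) / (p - 1)))))"
    unfolding scheduled_calls_def S_def[symmetric] \<Delta>_def of_nat_sum
    using assms phase_gap_pos by (intro sum_mono phase_len_le) auto
  then show ?thesis
    by (simp add: sum.distrib flip: sum_distrib_left)
qed

text \<open>The quantity \<open>H1 * phase_gap \<Delta>0 s\<close> halves in each phase, and the crossover counts the halvings that bring
  it down to \<open>H0\<close>.\<close>

lemma phase_gap_after_crossover:
  assumes "0 \<le> H0" "0 \<le> H1" "0 < \<Delta>0" "crossover H0 H1 \<Delta>0 \<epsilon> \<le> s" "s < num_phases \<Delta>0 \<epsilon>"
  shows "H1 * phase_gap \<Delta>0 s \<le> H0"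
proof (cases "H1 = 0")
  case False
  then have H1: "0 < H1" using assms by simp
  have H0: "0 < H0" using assms False by (auto simp: crossover_def split: if_splits)
  let ?J = "nat \<lceil>max 0 (log 2 (H1 * \<Delta>0 / H0))\<rceil>"
  have "crossover H0 H1 \<Delta>0 \<epsilon> = min (num_phases \<Delta>0 \<epsilon>) ?J"
    unfolding crossover_def using False H0 by simp
  then have "?J \<le> s" using assms(4,5) unfolding min_def by (cases "num_phases \<Delta>0 \<epsilon> \<le> ?J") simp_all
  then have "log 2 (H1 * \<Delta>0 / H0) \<le> real s" by linarith
  then have "2 powr (log 2 (H1 * \<Delta>0 / H0)) \<le> 2 powr real s" by (intro powr_mono) auto
  then have "H1 * \<Delta>0 / H0 \<le> 2 ^ s" using H0 H1 assms by (simp add: powr_realpow)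
  then show ?thesis using H0 by (simp add: phase_gap_def field_simps)
qed (use assms in simp)

text \<open>Before the crossover, \<open>\<surd>H1\<close> is split off and summed trivially; afterwards \<open>H1 * \<Delta>\<^sub>s \<le> H0\<close>, so it costs only
  a factor in the term with \<open>H0\<close>, whose sum is geometric and dominated by the last phase.\<close>

lemma sum_smoothness_convex:
  assumes "0 \<le> H0" "0 \<le> H1" "0 < \<epsilon>" "\<epsilon> \<le> \<Delta>0"
  shows "(\<Sum>s<num_phases \<Delta>0 \<epsilon>. sqrt ((H0 + H1 * phase_gap \<Delta>0 s) / phase_gap \<Delta>0 s))
    \<le> 2 * geo (1 / 2) * sqrt (H0 / \<epsilon>) + sqrt H1 * real (crossover H0 H1 \<Delta>0 \<epsilon>)"
proof -
  define S where "S = num_phases \<Delta>0 \<epsilon>"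
  define J where "J = crossover H0 H1 \<Delta>0 \<epsilon>"
  define \<Delta> where "\<Delta> = phase_gap \<Delta>0"
  have \<Delta>: "0 < \<Delta> s" for s using phase_gap_pos assms by (simp add: \<Delta>_def)
  have split: "sqrt ((H0 + H1 * \<Delta> s) / \<Delta> s)
      \<le> 2 * (sqrt H0 * \<Delta> s powr (- (1 / 2))) + (if s < J then sqrt H1 else 0)" if s: "s < S" for s
  proof -
    have e: "sqrt H0 * \<Delta> s powr (- (1 / 2)) = sqrt (H0 / \<Delta> s)"
      using \<Delta>[of s] by (simp add: powr_minus powr_half_sqrt real_sqrt_divide field_simps)
    have e2: "(H0 + H1 * \<Delta> s) / \<Delta> s = H0 / \<Delta> s + H1" using \<Delta>[of s] by (simp add: field_simps)
    have n: "0 \<le> H0 / \<Delta> s" using \<Delta>[of s] assms by simp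
    show ?thesis
    proof (cases "s < J")
      case True
      have "sqrt (H0 / \<Delta> s + H1) \<le> sqrt (H0 / \<Delta> s) + sqrt H1"
        using n assms by (intro sqrt_add_le_add_sqrt)
      also have "\<dots> \<le> 2 * sqrt (H0 / \<Delta> s) + sqrt H1" using n by simp
      finally show ?thesis unfolding e e2 using True by simp
    next
      case False
      then have "H1 * \<Delta> s \<le> H0"
        unfolding \<Delta>_def using assms s by (intro phase_gap_after_crossover) (auto simp: J_def S_def)
      then have "H1 \<le> H0 / \<Delta> s" using \<Delta>[of s] by (simp add: field_simps)
      then have "sqrt (H0 / \<Delta> s + H1) \<le> sqrt (2\<^sup>2 * (H0 / \<Delta> s))"
        using n by (intro real_sqrt_le_mono) simp
      also have "\<dots> = 2 * sqrt (H0 / \<Delta> s)" by (subst real_sqrt_mult) simp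
      finally show ?thesis unfolding e e2 using False by simp
    qed
  qed
  have "(\<Sum>s<S. sqrt ((H0 + H1 * \<Delta> s) / \<Delta> s))
      \<le> (\<Sum>s<S. 2 * (sqrt H0 * \<Delta> s powr (- (1 / 2))) + (if s < J then sqrt H1 else 0))"
    using split by (intro sum_mono) auto
  also have "\<dots> = 2 * sqrt H0 * (\<Sum>s<S. \<Delta> s powr (- (1 / 2))) + (\<Sum>s<S. if s < J then sqrt H1 else 0)"
    by (simp add: sum.distrib sum_distrib_left mult.assoc)
  also have "(\<Sum>s<S. \<Delta> s powr (- (1 / 2))) \<le> geo (1 / 2) * \<epsilon> powr (- (1 / 2))"
    unfolding S_def \<Delta>_def using assms by (intro sum_phase_gap_powr_neg_le) auto
  also have "(\<Sum>s<S. if s < J then sqrt H1 else 0) = real (card ({..<S} \<inter> {s. s < J})) * sqrt H1"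
    by (simp add: sum.If_cases)
  also have "\<dots> \<le> real J * sqrt H1"
  proof (intro mult_right_mono)
    have "card ({..<S} \<inter> {s. s < J}) \<le> card {..<J}" by (rule card_mono) auto
    then show "real (card ({..<S} \<inter> {s. s < J})) \<le> real J" by simp
  qed (use assms in simp)
  finally have "(\<Sum>s<S. sqrt ((H0 + H1 * \<Delta> s) / \<Delta> s))
    \<le> 2 * sqrt H0 * (geo (1 / 2) * \<epsilon> powr (- (1 / 2))) + real J * sqrt H1"
    using assms by (simp add: mult_left_mono)
  moreover have "sqrt H0 * \<epsilon> powr (- (1 / 2)) = sqrt (H0 / \<epsilon>)"
    using assms by (simp add: powr_minus powr_half_sqrt real_sqrt_divide field_simps)
  moreover have "2 * sqrt H0 * (geo (1 / 2) * \<epsilon> powr (- (1 / 2))) = 2 * geo (1 / 2) * (sqrt H0 * \<epsilon> powr (- (1 / 2)))"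
    by simp
  ultimately show ?thesis by (simp only: S_def \<Delta>_def J_def mult.commute[of "sqrt H1"])
qed

lemma sum_smoothness_strongly_convex:
  assumes "0 \<le> H0" "0 \<le> H1" "0 < \<Delta>0" "0 < \<mu>"
  shows "(\<Sum>s<S. 2 * sc_radius \<mu> \<Delta>0 s * sqrt ((H0 + H1 * phase_gap \<Delta>0 s) / phase_gap \<Delta>0 s))
    \<le> 3 * (sqrt (H0 / \<mu>) * real S + geo (1 / 2) * sqrt (H1 * \<Delta>0 / \<mu>))"
proof -
  define \<Delta> where "\<Delta> = phase_gap \<Delta>0"
  have \<Delta>: "0 < \<Delta> s" for s using phase_gap_pos assms by (simp add: \<Delta>_def)
  have "sqrt 2 \<le> sqrt ((3 / 2)\<^sup>2)" by (intro real_sqrt_le_mono) (simp add: power2_eq_square)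
  then have sq2: "2 * sqrt 2 \<le> 3" by simp
  have "2 * sc_radius \<mu> \<Delta>0 s * sqrt ((H0 + H1 * \<Delta> s) / \<Delta> s)
      \<le> 3 * (sqrt (H0 / \<mu>) + sqrt (H1 / \<mu>) * \<Delta> s powr (1 / 2))" for s
  proof -
    have "2 * sc_radius \<mu> \<Delta>0 s * sqrt ((H0 + H1 * \<Delta> s) / \<Delta> s)
       = 2 * sqrt (2 * \<Delta> s / \<mu> * ((H0 + H1 * \<Delta> s) / \<Delta> s))"
      unfolding sc_radius_def \<Delta>_def by (simp only: real_sqrt_mult mult.assoc)
    also have "2 * \<Delta> s / \<mu> * ((H0 + H1 * \<Delta> s) / \<Delta> s) = 2 * (H0 / \<mu> + H1 / \<mu> * \<Delta> s)"
      using \<Delta>[of s] assms by (simp add: field_simps)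
    also have "2 * sqrt (2 * (H0 / \<mu> + H1 / \<mu> * \<Delta> s)) = 2 * sqrt 2 * sqrt (H0 / \<mu> + H1 / \<mu> * \<Delta> s)"
      by (simp only: real_sqrt_mult mult.assoc)
    also have "\<dots> \<le> 3 * (sqrt (H0 / \<mu>) + sqrt (H1 / \<mu> * \<Delta> s))"
      using sq2 \<Delta>[of s] assms
      by (intro mult_mono sqrt_add_le_add_sqrt) auto
    also have "sqrt (H1 / \<mu> * \<Delta> s) = sqrt (H1 / \<mu>) * \<Delta> s powr (1 / 2)"
      using \<Delta>[of s] by (subst real_sqrt_mult) (simp add: powr_half_sqrt)
    finally show ?thesis .
  qed
  then have "(\<Sum>s<S. 2 * sc_radius \<mu> \<Delta>0 s * sqrt ((H0 + H1 * \<Delta> s) / \<Delta> s))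
      \<le> (\<Sum>s<S. 3 * (sqrt (H0 / \<mu>) + sqrt (H1 / \<mu>) * \<Delta> s powr (1 / 2)))"
    by (intro sum_mono)
  also have "\<dots> = 3 * (sqrt (H0 / \<mu>) * real S + sqrt (H1 / \<mu>) * (\<Sum>s<S. \<Delta> s powr (1 / 2)))"
    by (simp add: sum.distrib sum_distrib_left algebra_simps)
  also have "\<dots> \<le> 3 * (sqrt (H0 / \<mu>) * real S + sqrt (H1 / \<mu>) * (geo (1 / 2) * \<Delta>0 powr (1 / 2)))"
    unfolding \<Delta>_def using assms by (intro mult_left_mono add_left_mono sum_phase_gap_powr_le) auto
  also have "sqrt (H1 / \<mu>) * (geo (1 / 2) * \<Delta>0 powr (1 / 2)) = geo (1 / 2) * sqrt (H1 * \<Delta>0 / \<mu>)"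
    using assms by (simp add: powr_half_sqrt real_sqrt_mult real_sqrt_divide)
  finally show ?thesis by (simp add: \<Delta>_def)
qed

text \<open>The diameter is proportional to \<open>\<surd>\<Delta>\<^sub>s\<close>, which raises the exponent of \<open>\<Delta>\<^sub>s\<close> by \<open>q / 2\<close>, where
  \<open>q = p / (p - 1)\<close>: this is why \<open>p / 2\<close> takes the place of \<open>p\<close>.\<close>

lemma noise_term_strongly_convex:
  assumes "0 < \<Delta>0" "0 < \<mu>" "0 \<le> \<tau>" "1 < p"
  shows "(\<tau> * (2 * sc_radius \<mu> \<Delta>0 s)) powr (p / (p - 1)) * phase_gap \<Delta>0 s powr ((\<alpha> - p) / (p - 1))
    = (2 * sqrt 2) powr (p / (p - 1)) * (\<tau> / sqrt \<mu>) powr (p / (p - 1)) *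
        phase_gap \<Delta>0 s powr ((\<alpha> - p / 2) / (p - 1))"
proof -
  define \<Delta> q where "\<Delta> = phase_gap \<Delta>0 s" and "q = p / (p - 1)"
  have \<Delta>: "0 < \<Delta>" using phase_gap_pos assms by (simp add: \<Delta>_def)
  have base: "\<tau> * (2 * sc_radius \<mu> \<Delta>0 s) = (2 * sqrt 2) * (\<tau> / sqrt \<mu>) * \<Delta> powr (1 / 2)"
    using \<Delta> by (simp add: sc_radius_def \<Delta>_def[symmetric] powr_half_sqrt real_sqrt_mult real_sqrt_divide)
  have "(\<tau> * (2 * sc_radius \<mu> \<Delta>0 s)) powr q = (2 * sqrt 2) powr q * (\<tau> / sqrt \<mu>) powr q * \<Delta> powr (q / 2)"
  proof -
    have "(x * y * \<Delta> powr (1 / 2)) powr q = x powr q * y powr q * \<Delta> powr (q / 2)"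
      if "0 \<le> x" "0 \<le> y" for x y using that by (simp add: powr_mult powr_powr)
    moreover have "0 \<le> 2 * sqrt (2::real)" "0 \<le> \<tau> / sqrt \<mu>" using assms by auto
    ultimately show ?thesis unfolding base by blast
  qed
  moreover have "q / 2 + (\<alpha> - p) / (p - 1) = (\<alpha> - p / 2) / (p - 1)"
  proof -
    have "q / 2 = (p / 2) / (p - 1)" by (simp add: q_def)
    then have "q / 2 + (\<alpha> - p) / (p - 1) = (p / 2 + (\<alpha> - p)) / (p - 1)"
      by (simp only: add_divide_distrib)
    then show ?thesis by simp
  qed
  ultimately show ?thesis
    unfolding q_def[symmetric] \<Delta>_def[symmetric] by (simp add: mult.assoc flip: powr_add)
qed

text \<open>The factor \<open>5121\<close> is the one of \<open>scheduled_calls_le\<close>; \<open>210\<close> is \<open>3 * 70\<close>, where \<open>3\<close> is enough to bound the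
  smoothness sums of both cases by \<open>1 + geo (1 / 2)\<close> times the target expression.\<close>

definition smooth_const :: real where
  "smooth_const = 5121 * (1 + 210 * (1 + geo (1 / 2)))"

definition noise_const :: "real \<Rightarrow> real \<Rightarrow> real" where
  "noise_const p \<alpha> = 5121 * (64 powr (1 / (p - 1)) * 4 powr (\<alpha> / (p - 1)))"

lemma geo_half_pos: "0 < geo (1 / 2)"
  by (rule geo_pos) simp

lemma smooth_const_pos: "0 < smooth_const" and noise_const_pos: "0 < noise_const p \<alpha>"
  using geo_half_pos by (simp_all add: smooth_const_def noise_const_def)

text \<open>Assembles the bound of \<open>scheduled_calls_le\<close> with a bound on the smoothness sum \<open>P\<close> and one on the noise sum
  \<open>N\<close>; this is the step common to both cases.\<close>

lemma combine_call_bounds: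
  assumes n: "n \<le> 5121 * L * (S + 70 * P + 64 powr (1 / (p - 1)) * 4 powr (\<alpha> / (p - 1)) * N)"
    and L: "1 \<le> L" and S: "S \<le> X" and P: "P \<le> 3 * ((1 + geo (1 / 2)) * X)" and N: "N \<le> c * Y"
  shows "n \<le> smooth_const * L * X + noise_const p \<alpha> * c * L * Y"
proof -
  have SP: "5121 * (S + 70 * P) \<le> smooth_const * X"
  proof -
    have "5121 * (S + 70 * P) \<le> 5121 * (X + 70 * (3 * ((1 + geo (1 / 2)) * X)))"
      using S P by (intro mult_left_mono add_mono) auto
    then show ?thesis by (simp add: smooth_const_def algebra_simps)
  qed
  let ?k = "64 powr (1 / (p - 1)) * 4 powr (\<alpha> / (p - 1))"
  have "n \<le> L * (5121 * (S + 70 * P)) + L * (5121 * ?k * N)"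
    using n by (simp add: algebra_simps)
  also have "\<dots> \<le> L * (smooth_const * X) + L * (5121 * ?k * (c * Y))"
    using L SP N by (intro add_mono mult_left_mono) auto
  finally show ?thesis by (simp add: noise_const_def algebra_simps)
qed

lemma convex_calls_le:
  assumes par: "0 \<le> H0" "0 \<le> H1" "0 \<le> \<tau>" "0 < \<epsilon>" "\<epsilon> \<le> \<Delta>0" "0 < \<rho>" "\<rho> < 1" "1 < p" "0 < D"
    and noise: "(\<Sum>s<num_phases \<Delta>0 \<epsilon>. phase_gap \<Delta>0 s powr ((\<alpha> - p) / (p - 1))) \<le> c * K"
  defines "S \<equiv> num_phases \<Delta>0 \<epsilon>"
  shows "real (scheduled_calls H0 H1 p (noise_pow p \<alpha> \<tau>) \<Delta>0 \<epsilon> \<rho> (\<lambda>_. D)) \<le>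
    smooth_const * conf_log \<rho> S * (real S + D * (sqrt (H0 / \<epsilon>) + sqrt H1 * real (crossover H0 H1 \<Delta>0 \<epsilon>)))
    + noise_const p \<alpha> * c * conf_log \<rho> S * ((\<tau> * D) powr (p / (p - 1)) * K)"
proof (rule combine_call_bounds)
  have \<Delta>0: "0 < \<Delta>0" using par by linarith
  show "real (scheduled_calls H0 H1 p (noise_pow p \<alpha> \<tau>) \<Delta>0 \<epsilon> \<rho> (\<lambda>_. D))
      \<le> 5121 * conf_log \<rho> S * (real S + 70 * (\<Sum>s<S. D * sqrt ((H0 + H1 * phase_gap \<Delta>0 s) / phase_gap \<Delta>0 s))
        + 64 powr (1 / (p - 1)) * 4 powr (\<alpha> / (p - 1)) *
          (\<Sum>s<S. (\<tau> * D) powr (p / (p - 1)) * phase_gap \<Delta>0 s powr ((\<alpha> - p) / (p - 1))))"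
    unfolding S_def using par \<Delta>0 by (intro scheduled_calls_le) auto
  show "1 \<le> conf_log \<rho> S" using par by (intro conf_log_ge_1)
  let ?X = "sqrt (H0 / \<epsilon>) + sqrt H1 * real (crossover H0 H1 \<Delta>0 \<epsilon>)"
  have nonneg: "0 \<le> sqrt (H0 / \<epsilon>)" "0 \<le> sqrt H1 * real (crossover H0 H1 \<Delta>0 \<epsilon>)" using par by auto
  then have DX: "0 \<le> D * ?X" using par by (intro mult_nonneg_nonneg add_nonneg_nonneg) auto
  then show "real S \<le> real S + D * ?X" by simp
  have absorb: "2 * k * x + y \<le> 3 * (1 + k) * (x + y)" if "0 \<le> k" "0 \<le> x" "0 \<le> y" for k x y :: real
  proof -
    have "3 * (1 + k) * (x + y) = 2 * k * x + y + (3 * x + 2 * y + k * x + 3 * (k * y))"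
      by (simp add: algebra_simps)
    then show ?thesis using that by simp
  qed
  have "(\<Sum>s<S. D * sqrt ((H0 + H1 * phase_gap \<Delta>0 s) / phase_gap \<Delta>0 s))
      \<le> D * (2 * geo (1 / 2) * sqrt (H0 / \<epsilon>) + sqrt H1 * real (crossover H0 H1 \<Delta>0 \<epsilon>))"
    unfolding S_def sum_distrib_left[symmetric]
    using par by (intro mult_left_mono sum_smoothness_convex) auto
  also have "\<dots> \<le> D * (3 * (1 + geo (1 / 2)) * ?X)"
    using par nonneg geo_half_pos by (intro mult_left_mono absorb) auto
  also have "\<dots> = 3 * ((1 + geo (1 / 2)) * (D * ?X))" by (simp add: mult_ac)
  also have "\<dots> \<le> 3 * ((1 + geo (1 / 2)) * (real S + D * ?X))"
    using geo_half_pos by (intro mult_left_mono) auto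
  finally show "(\<Sum>s<S. D * sqrt ((H0 + H1 * phase_gap \<Delta>0 s) / phase_gap \<Delta>0 s))
      \<le> 3 * ((1 + geo (1 / 2)) * (real S + D * ?X))" .
  have "(\<tau> * D) powr (p / (p - 1)) * (\<Sum>s<S. phase_gap \<Delta>0 s powr ((\<alpha> - p) / (p - 1)))
      \<le> (\<tau> * D) powr (p / (p - 1)) * (c * K)"
    unfolding S_def using noise by (intro mult_left_mono) auto
  then show "(\<Sum>s<S. (\<tau> * D) powr (p / (p - 1)) * phase_gap \<Delta>0 s powr ((\<alpha> - p) / (p - 1)))
      \<le> c * ((\<tau> * D) powr (p / (p - 1)) * K)"
    by (simp add: sum_distrib_left mult.left_commute)
qed

lemma strongly_convex_calls_le:
  assumes par: "0 \<le> H0" "0 \<le> H1" "0 \<le> \<tau>" "0 < \<epsilon>" "\<epsilon> \<le> \<Delta>0" "0 < \<rho>" "\<rho> < 1" "1 < p" "0 < \<mu>"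
    and noise: "(\<Sum>s<num_phases \<Delta>0 \<epsilon>. phase_gap \<Delta>0 s powr ((\<alpha> - p / 2) / (p - 1))) \<le> c * K"
  defines "S \<equiv> num_phases \<Delta>0 \<epsilon>"
  shows "real (scheduled_calls H0 H1 p (noise_pow p \<alpha> \<tau>) \<Delta>0 \<epsilon> \<rho> (\<lambda>s. 2 * sc_radius \<mu> \<Delta>0 s)) \<le>
    smooth_const * conf_log \<rho> S * ((1 + sqrt (H0 / \<mu>)) * real S + sqrt (H1 * \<Delta>0 / \<mu>))
    + noise_const p \<alpha> * ((2 * sqrt 2) powr (p / (p - 1)) * c) * conf_log \<rho> S *
        ((\<tau> / sqrt \<mu>) powr (p / (p - 1)) * K)"
proof (rule combine_call_bounds)
  have \<Delta>0: "0 < \<Delta>0" using par by linarith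
  have r: "0 < 2 * sc_radius \<mu> \<Delta>0 s" for s
    using par \<Delta>0 phase_gap_pos[of \<Delta>0 s] by (simp add: sc_radius_def)
  show "real (scheduled_calls H0 H1 p (noise_pow p \<alpha> \<tau>) \<Delta>0 \<epsilon> \<rho> (\<lambda>s. 2 * sc_radius \<mu> \<Delta>0 s))
      \<le> 5121 * conf_log \<rho> S * (real S
        + 70 * (\<Sum>s<S. 2 * sc_radius \<mu> \<Delta>0 s * sqrt ((H0 + H1 * phase_gap \<Delta>0 s) / phase_gap \<Delta>0 s))
        + 64 powr (1 / (p - 1)) * 4 powr (\<alpha> / (p - 1)) *
          (\<Sum>s<S. (\<tau> * (2 * sc_radius \<mu> \<Delta>0 s)) powr (p / (p - 1)) * phase_gap \<Delta>0 s powr ((\<alpha> - p) / (p - 1))))"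
    unfolding S_def using par \<Delta>0 r by (intro scheduled_calls_le) auto
  show "1 \<le> conf_log \<rho> S" using par by (intro conf_log_ge_1)
  let ?x = "sqrt (H0 / \<mu>) * real S" and ?y = "sqrt (H1 * \<Delta>0 / \<mu>)"
  have nonneg: "0 \<le> ?x" "0 \<le> ?y" using par \<Delta>0 by auto
  have X: "(1 + sqrt (H0 / \<mu>)) * real S + ?y = real S + (?x + ?y)" by (simp add: algebra_simps)
  show "real S \<le> (1 + sqrt (H0 / \<mu>)) * real S + ?y"
    unfolding X using add_nonneg_nonneg[OF nonneg] by simp
  have absorb: "x + k * y \<le> (1 + k) * (n + (x + y))" if "0 \<le> k" "0 \<le> x" "0 \<le> y" "0 \<le> n" for k x y n :: real
  proof -
    have "(1 + k) * (n + (x + y)) = x + k * y + (n + k * n + y + k * x)" by (simp add: algebra_simps)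
    then show ?thesis using that by simp
  qed
  have "(\<Sum>s<S. 2 * sc_radius \<mu> \<Delta>0 s * sqrt ((H0 + H1 * phase_gap \<Delta>0 s) / phase_gap \<Delta>0 s))
      \<le> 3 * (?x + geo (1 / 2) * ?y)"
    using par \<Delta>0 by (intro sum_smoothness_strongly_convex)
  also have "\<dots> \<le> 3 * ((1 + geo (1 / 2)) * (real S + (?x + ?y)))"
    using nonneg geo_half_pos by (intro mult_left_mono absorb) auto
  finally show "(\<Sum>s<S. 2 * sc_radius \<mu> \<Delta>0 s * sqrt ((H0 + H1 * phase_gap \<Delta>0 s) / phase_gap \<Delta>0 s))
      \<le> 3 * ((1 + geo (1 / 2)) * ((1 + sqrt (H0 / \<mu>)) * real S + ?y))"
    unfolding X .
  let ?b = "(2 * sqrt 2) powr (p / (p - 1))" and ?t = "(\<tau> / sqrt \<mu>) powr (p / (p - 1))"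
  have "(\<Sum>s<S. (\<tau> * (2 * sc_radius \<mu> \<Delta>0 s)) powr (p / (p - 1)) * phase_gap \<Delta>0 s powr ((\<alpha> - p) / (p - 1)))
      = ?b * ?t * (\<Sum>s<S. phase_gap \<Delta>0 s powr ((\<alpha> - p / 2) / (p - 1)))"
    unfolding noise_term_strongly_convex[OF \<Delta>0 par(9) par(3) par(8)]
    by (simp add: sum_distrib_left)
  also have "\<dots> \<le> ?b * ?t * (c * K)"
    unfolding S_def using noise by (intro mult_left_mono) auto
  also have "\<dots> = ?b * c * (?t * K)" by simp
  finally show "(\<Sum>s<S. (\<tau> * (2 * sc_radius \<mu> \<Delta>0 s)) powr (p / (p - 1)) * phase_gap \<Delta>0 s powr ((\<alpha> - p) / (p - 1)))
      \<le> ?b * c * (?t * K)" .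
qed

lemma noise_exponent_factor_nonneg: "0 < \<epsilon> \<Longrightarrow> 0 \<le> noise_exponent_factor p \<beta> \<alpha> \<Delta>0 \<epsilon>"
  by (simp add: noise_exponent_factor_def le_max_iff_disj)


theorem theorem11:
  fixes p :: real
  assumes "1 < p" and "p \<le> 2"
  shows
    "(\<forall>(f :: 'a::euclidean_space \<Rightarrow> real) grad xstar x0 \<mu> H0 H1 \<alpha> \<tau> \<Delta>0 \<epsilon> \<rho>
        (M :: 'w measure) (E :: 'e measure) \<xi> g.
        convex_modulus \<mu> f grad \<and> H_smooth H0 H1 f grad \<and>
        is_arg_min f (\<lambda>_. True) xstar \<and> gap f x0 \<le> \<Delta>0 \<and>
        0 \<le> \<alpha> \<and> 0 \<le> \<tau> \<and> stochastic_oracle M E \<xi> g f grad p \<alpha> \<tau> \<and>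
        0 < \<epsilon> \<and> \<epsilon> \<le> \<Delta>0 \<and> 0 < \<rho> \<and> \<rho> < 1 \<longrightarrow>
        (\<forall>Q. closed Q \<and> convex Q \<and> x0 \<in> Q \<and> xstar \<in> Q \<and> bounded Q \<and> 0 < diameter Q \<longrightarrow>
           (let run = (\<lambda>\<omega>. rcsag H0 H1 p (noise_pow p \<alpha> \<tau>) \<Delta>0 \<rho> (\<lambda>_ _. Q)
                              (\<lambda>k x. g x (\<xi> k \<omega>)) x0 (num_phases \<Delta>0 \<epsilon>))
            in measure M {\<omega> \<in> space M. gap f (fst (run \<omega>)) \<le> \<epsilon>} \<ge> 1 - \<rho> \<and>
               (\<forall>\<omega>\<in>space M. snd (run \<omega>) =
                  scheduled_calls H0 H1 p (noise_pow p \<alpha> \<tau>) \<Delta>0 \<epsilon> \<rho> (\<lambda>_. diameter Q)))) \<and>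
        (0 < \<mu> \<longrightarrow>
           (let run = (\<lambda>\<omega>. rcsag H0 H1 p (noise_pow p \<alpha> \<tau>) \<Delta>0 \<rho> (\<lambda>s w. cball w (sc_radius \<mu> \<Delta>0 s))
                              (\<lambda>k x. g x (\<xi> k \<omega>)) x0 (num_phases \<Delta>0 \<epsilon>))
            in measure M {\<omega> \<in> space M. gap f (fst (run \<omega>)) \<le> \<epsilon>} \<ge> 1 - \<rho> \<and>
               (\<forall>\<omega>\<in>space M. snd (run \<omega>) =
                  scheduled_calls H0 H1 p (noise_pow p \<alpha> \<tau>) \<Delta>0 \<epsilon> \<rho> (\<lambda>s. 2 * sc_radius \<mu> \<Delta>0 s))))) \<and>
     (\<exists>C>0. \<forall>\<alpha>\<ge>0. \<exists>C'>0. \<forall>H0 H1 \<tau> \<Delta>0 \<epsilon> \<rho>.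
        0 \<le> H0 \<and> 0 \<le> H1 \<and> 0 \<le> \<tau> \<and> 0 < \<epsilon> \<and> \<epsilon> \<le> \<Delta>0 \<and> 0 < \<rho> \<and> \<rho> < 1 \<longrightarrow>
        (let S = num_phases \<Delta>0 \<epsilon>; q = p / (p - 1); L = conf_log \<rho> S
         in (\<forall>D>0. real (scheduled_calls H0 H1 p (noise_pow p \<alpha> \<tau>) \<Delta>0 \<epsilon> \<rho> (\<lambda>_. D)) \<le>
               C * L * (real S + D * (sqrt (H0 / \<epsilon>) + sqrt H1 * real (crossover H0 H1 \<Delta>0 \<epsilon>))) +
               C' * L * ((\<tau> * D) powr q * noise_exponent_factor p p \<alpha> \<Delta>0 \<epsilon>)) \<and>
            (\<forall>\<mu>>0. real (scheduled_calls H0 H1 p (noise_pow p \<alpha> \<tau>) \<Delta>0 \<epsilon> \<rho>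
                             (\<lambda>s. 2 * sc_radius \<mu> \<Delta>0 s)) \<le>
               C * L * ((1 + sqrt (H0 / \<mu>)) * real S + sqrt (H1 * \<Delta>0 / \<mu>)) +
               C' * L * ((\<tau> / sqrt \<mu>) powr q * noise_exponent_factor p (p / 2) \<alpha> \<Delta>0 \<epsilon>))))"
proof (rule conjI, goal_cases)
  case 1
  show ?case
  proof (intro allI impI, elim conjE, intro conjI allI impI, goal_cases)
    case (1 f grad xstar x0 \<mu> H0 H1 \<alpha> \<tau> \<Delta>0 \<epsilon> \<rho> M E \<xi> g Q)
    then interpret sampled_objective f grad xstar \<mu> H0 H1 M E \<xi> g p \<alpha> \<tau>
      using assms by unfold_locales
    show ?case unfolding Let_def using 1 by (intro conjI ballI rcsag_convex) auto
  next
    case (2 f grad xstar x0 \<mu> H0 H1 \<alpha> \<tau> \<Delta>0 \<epsilon> \<rho> M E \<xi> g)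
    then interpret sampled_objective f grad xstar \<mu> H0 H1 M E \<xi> g p \<alpha> \<tau>
      using assms by unfold_locales
    show ?case unfolding Let_def using 2 by (intro conjI ballI rcsag_strongly_convex) auto
  qed
next
  case 2
  show ?case
    unfolding Let_def
  proof (rule exI[of _ smooth_const], intro conjI smooth_const_pos allI impI)
    fix \<alpha> :: real
    obtain c1 where c1: "0 < c1" "\<And>\<Delta>0 \<epsilon>. 0 < \<epsilon> \<Longrightarrow> \<epsilon> \<le> \<Delta>0 \<Longrightarrow>
      (\<Sum>s<num_phases \<Delta>0 \<epsilon>. phase_gap \<Delta>0 s powr ((\<alpha> - p) / (p - 1)))
      \<le> c1 * noise_exponent_factor p p \<alpha> \<Delta>0 \<epsilon>"
      using sum_phase_gap_noise_exponent[OF assms(1)] by blast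
    obtain c2 where c2: "0 < c2" "\<And>\<Delta>0 \<epsilon>. 0 < \<epsilon> \<Longrightarrow> \<epsilon> \<le> \<Delta>0 \<Longrightarrow>
      (\<Sum>s<num_phases \<Delta>0 \<epsilon>. phase_gap \<Delta>0 s powr ((\<alpha> - p / 2) / (p - 1)))
      \<le> c2 * noise_exponent_factor p (p / 2) \<alpha> \<Delta>0 \<epsilon>"
      using sum_phase_gap_noise_exponent[OF assms(1)] by blast
    define c3 where "c3 = (2 * sqrt 2) powr (p / (p - 1)) * c2"
    have c3: "0 < c3" using c2 by (simp add: c3_def)
    \<comment> \<open>One constant has to serve both cases, hence the sum.\<close>
    define C' where "C' = noise_const p \<alpha> * (c1 + c3)"
    have C': "0 < C'" using c1 c3 noise_const_pos by (simp add: C'_def)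
    have widen: "noise_const p \<alpha> * c * L * X \<le> C' * L * X"
      if "c = c1 \<or> c = c3" "1 \<le> L" "0 \<le> X" for c L X
      unfolding C'_def using that c1 c3 noise_const_pos
      by (intro mult_right_mono mult_left_mono) (auto simp: less_imp_le)
    show "\<exists>C'>0. \<forall>H0 H1 \<tau> \<Delta>0 \<epsilon> \<rho>.
        0 \<le> H0 \<and> 0 \<le> H1 \<and> 0 \<le> \<tau> \<and> 0 < \<epsilon> \<and> \<epsilon> \<le> \<Delta>0 \<and> 0 < \<rho> \<and> \<rho> < 1 \<longrightarrow>
        (\<forall>D>0. real (scheduled_calls H0 H1 p (noise_pow p \<alpha> \<tau>) \<Delta>0 \<epsilon> \<rho> (\<lambda>_. D)) \<le>
           smooth_const * conf_log \<rho> (num_phases \<Delta>0 \<epsilon>) * (real (num_phases \<Delta>0 \<epsilon>) +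
             D * (sqrt (H0 / \<epsilon>) + sqrt H1 * real (crossover H0 H1 \<Delta>0 \<epsilon>))) +
           C' * conf_log \<rho> (num_phases \<Delta>0 \<epsilon>) *
             ((\<tau> * D) powr (p / (p - 1)) * noise_exponent_factor p p \<alpha> \<Delta>0 \<epsilon>)) \<and>
        (\<forall>\<mu>>0. real (scheduled_calls H0 H1 p (noise_pow p \<alpha> \<tau>) \<Delta>0 \<epsilon> \<rho> (\<lambda>s. 2 * sc_radius \<mu> \<Delta>0 s)) \<le>
           smooth_const * conf_log \<rho> (num_phases \<Delta>0 \<epsilon>) * ((1 + sqrt (H0 / \<mu>)) * real (num_phases \<Delta>0 \<epsilon>) +
             sqrt (H1 * \<Delta>0 / \<mu>)) +
           C' * conf_log \<rho> (num_phases \<Delta>0 \<epsilon>) *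
             ((\<tau> / sqrt \<mu>) powr (p / (p - 1)) * noise_exponent_factor p (p / 2) \<alpha> \<Delta>0 \<epsilon>))"
    proof (rule exI[of _ C'], intro conjI C' allI impI; elim conjE)
      fix H0 H1 \<tau> \<Delta>0 \<epsilon> \<rho> D :: real
      assume par: "0 \<le> H0" "0 \<le> H1" "0 \<le> \<tau>" "0 < \<epsilon>" "\<epsilon> \<le> \<Delta>0" "0 < \<rho>" "\<rho> < 1" and D: "0 < D"
      show "real (scheduled_calls H0 H1 p (noise_pow p \<alpha> \<tau>) \<Delta>0 \<epsilon> \<rho> (\<lambda>_. D)) \<le>
          smooth_const * conf_log \<rho> (num_phases \<Delta>0 \<epsilon>) * (real (num_phases \<Delta>0 \<epsilon>) +
             D * (sqrt (H0 / \<epsilon>) + sqrt H1 * real (crossover H0 H1 \<Delta>0 \<epsilon>))) +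
          C' * conf_log \<rho> (num_phases \<Delta>0 \<epsilon>) *
             ((\<tau> * D) powr (p / (p - 1)) * noise_exponent_factor p p \<alpha> \<Delta>0 \<epsilon>)"
        using convex_calls_le[OF par assms(1) D c1(2)[OF par(4,5)]]
        by (rule order_trans)
          (use par in \<open>auto intro!: add_left_mono widen conf_log_ge_1 mult_nonneg_nonneg noise_exponent_factor_nonneg\<close>)
    next
      fix H0 H1 \<tau> \<Delta>0 \<epsilon> \<rho> \<mu> :: real
      assume par: "0 \<le> H0" "0 \<le> H1" "0 \<le> \<tau>" "0 < \<epsilon>" "\<epsilon> \<le> \<Delta>0" "0 < \<rho>" "\<rho> < 1" and \<mu>: "0 < \<mu>"
      show "real (scheduled_calls H0 H1 p (noise_pow p \<alpha> \<tau>) \<Delta>0 \<epsilon> \<rho> (\<lambda>s. 2 * sc_radius \<mu> \<Delta>0 s)) \<le>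
          smooth_const * conf_log \<rho> (num_phases \<Delta>0 \<epsilon>) * ((1 + sqrt (H0 / \<mu>)) * real (num_phases \<Delta>0 \<epsilon>) +
             sqrt (H1 * \<Delta>0 / \<mu>)) +
          C' * conf_log \<rho> (num_phases \<Delta>0 \<epsilon>) *
             ((\<tau> / sqrt \<mu>) powr (p / (p - 1)) * noise_exponent_factor p (p / 2) \<alpha> \<Delta>0 \<epsilon>)"
        using strongly_convex_calls_le[OF par assms(1) \<mu> c2(2)[OF par(4,5)], folded c3_def]
        by (rule order_trans)
          (use par in \<open>auto intro!: add_left_mono widen conf_log_ge_1 mult_nonneg_nonneg noise_exponent_factor_nonneg\<close>)
    qed
  qed
qed

end
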